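(* Let $U$ be an open subset of $\mathbb{R}^d$, $G:U\to\mathrm{GL}_k(\mathbb{R})$ an analytic map and $\mathbf x_0\in U$. Then there is a ball $B_0\subset U$ centred at $\mathbf x_0$ and constants $K_0,\alpha>0$ such that for any ball $B\subset B_0$ there is a constant $\delta=\delta(B)>0$ such that for any $k$-tuple $\bar\theta=(\theta_1,\dots,\theta_k)$ of positive numbers $$\mu_d\big(B\cap\mathcal A(G,\bar\theta)\big)\le K_0\Big(1+\sup_{\mathbf x\in B}\widehat\Theta_{\bar\theta}(\mathbf x)^\alpha/\delta^\alpha\Big)\theta^\alpha\mu_d(B).$$
   Context: Write $G(\mathbf x)=(g_{i,j}(\mathbf x))_{1\le i,j\le k}$ and let $\mathbf g_i(\mathbf x)$ be its $i$-th row. $\mathcal A(G,\bar\theta)$ is the set of $\mathbf x\in U$ for which there is $\mathbf a=(a_1,\dots,a_k)\in\mathbb Z^k\setminus\{0\}$ with $|\sum_{j=1}^kg_{i,j}(\mathbf x)a_j|\le\theta_i$ for all $1\le i\le k$. Let $\theta=(\theta_1\cdots\theta_k)^{1/k}$. For $\mathbf x\in U$ and a linear subspace $V\subset\mathbb{R}^k$ with $\operatorname{codim}V=r$, $1\le r<k$, let $\Theta_{\bar\theta}(\mathbf x,V)$ be the minimum of $\theta^{-r}\prod_{i=1}^r\theta_{j_i}$ over all $r$-element subsets $\{j_1,\dots,j_r\}\subset\{1,\dots,k\}$ with $V\oplus\operatorname{span}(\mathbf g_{j_1}(\mathbf x),\dots,\mathbf g_{j_r}(\mathbf x))=\mathbb{R}^k$.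 Set $\widehat\Theta_{\bar\theta}(\mathbf x_0,V)=\liminf_{\mathbf x\to\mathbf x_0}\Theta_{\bar\theta}(\mathbf x,V)$ and $\widehat\Theta_{\bar\theta}(\mathbf x_0)=\sup_V\widehat\Theta_{\bar\theta}(\mathbf x_0,V)$, the supremum over all linear subspaces $V$ with $1\le\operatorname{codim}V<k$. $\mu_d$ is Lebesgue measure. *)

theory Defs
  imports "HOL-Analysis.Analysis"
begin

(* Real analyticity in several variables: near every point of U the function is the sum of its
   multivariate power series. Multi-indices are functions 'd => nat; over the reals has_sum is
   unconditional, hence absolute, convergence. Only used for open U, where the ball can be shrunk
   to lie inside U, so values of f outside U are irrelevant. *)
definition real_analytic_on :: "(real ^ 'd \<Rightarrow> real) \<Rightarrow> (real ^ 'd) set \<Rightarrow> bool" where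
  "real_analytic_on f U \<longleftrightarrow>
     (\<forall>x\<in>U. \<exists>(c :: ('d \<Rightarrow> nat) \<Rightarrow> real) r. r > 0 \<and>
       (\<forall>y\<in>ball x r.
         ((\<lambda>m. c m * (\<Prod>i\<in>UNIV. (y $ i - x $ i) ^ m i)) has_sum f y) UNIV))"

definition analytic_GL_on :: "(real ^ 'd \<Rightarrow> real ^ 'k ^ 'k) \<Rightarrow> (real ^ 'd) set \<Rightarrow> bool" where
  "analytic_GL_on G U \<longleftrightarrow>
     (\<forall>x\<in>U. invertible (G x)) \<and> (\<forall>i j. real_analytic_on (\<lambda>x. G x $ i $ j) U)"

definition approx_set ::
  "(real ^ 'd) set \<Rightarrow> (real ^ 'd \<Rightarrow> real ^ 'k ^ 'k) \<Rightarrow> real ^ 'k \<Rightarrow> (real ^ 'd) set" where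
  "approx_set U G \<theta> =
     {x \<in> U. \<exists>a :: int ^ 'k. a \<noteq> 0 \<and>
        (\<forall>i. \<bar>\<Sum>j\<in>UNIV. G x $ i $ j * real_of_int (a $ j)\<bar> \<le> \<theta> $ i)}"

definition geo_mean :: "real ^ 'k \<Rightarrow> real" where
  "geo_mean \<theta> = (\<Prod>i\<in>UNIV. \<theta> $ i) powr (1 / real CARD('k))"

definition codim :: "(real ^ 'k) set \<Rightarrow> nat" where
  "codim V = CARD('k) - dim V"

definition complementary :: "(real ^ 'k) set \<Rightarrow> (real ^ 'k) set \<Rightarrow> bool" where
  "complementary V W \<longleftrightarrow> V \<inter> W = {0} \<and> {v + w | v w. v \<in> V \<and> w \<in> W} = UNIV"

(* If G x is invertible, its rows span the whole space, so the minimum is over a nonempty set. *)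
definition Theta ::
  "(real ^ 'd \<Rightarrow> real ^ 'k ^ 'k) \<Rightarrow> real ^ 'k \<Rightarrow> real ^ 'd \<Rightarrow> (real ^ 'k) set \<Rightarrow> real" where
  "Theta G \<theta> x V =
     Min {(\<Prod>j\<in>J. \<theta> $ j) / geo_mean \<theta> ^ codim V | J :: 'k set.
            card J = codim V \<and> complementary V (span ((\<lambda>j. row j (G x)) ` J))}"

(* Liminf over the punctured filter. For G continuous and invertible near x0 and \<theta> > 0 this is the
   same as including x0: complementarity is an open condition in x, so
   Theta G \<theta> x V <= Theta G \<theta> x0 V for all x near x0. *)
definition Theta_hat_at ::
  "(real ^ 'd \<Rightarrow> real ^ 'k ^ 'k) \<Rightarrow> real ^ 'k \<Rightarrow> real ^ 'd \<Rightarrow> (real ^ 'k) set \<Rightarrow> ennreal" where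
  "Theta_hat_at G \<theta> x0 V = Liminf (at x0) (\<lambda>x. ennreal (Theta G \<theta> x V))"

(* For positive \<theta>, every Theta G \<theta> x V with G x invertible lies in a finite set of positive numbers
   depending on \<theta> only, so Theta_hat is finite, and bounded uniformly in x0. For k = 1 there is no
   admissible V, and the supremum, taken in [0, \<infinity>], is 0. *)
definition Theta_hat ::
  "(real ^ 'd \<Rightarrow> real ^ 'k ^ 'k) \<Rightarrow> real ^ 'k \<Rightarrow> real ^ 'd \<Rightarrow> ennreal" where
  "Theta_hat G \<theta> x0 =
     (SUP V\<in>{V. subspace V \<and> 1 \<le> codim V \<and> codim V < CARD('k)}. Theta_hat_at G \<theta> x0 V)"

end

(* The set approx_set U G theta consists of the x for which the lattice D G(x) Z^k, where
   D = diag(t / theta_i) and t = geo_mean theta, has a nonzero vector of sup norm at most t, so the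
   estimate is an instance of quantitative nondivergence in the sense of Kleinbock and Margulis.
   Its inputs are (a) the covolumes of the rational subspaces, as functions of x, are (C, alpha)-good
   with constants depending on x0 only: every component is a linear combination of finitely many
   fixed analytic functions; and (b) on every ball each of these covolumes is somewhere at least
   const * delta / Theta: if V is the orthogonal complement of the rational subspace, then a set J
   complementary to V gives a nonvanishing minor whose weight is the inverse of
   t^-r * prod_{j in J} theta_j. The number delta depends on the ball only, because the unit
   decomposable r-vectors form a compact set and only finitely many families of sets J can be
   distinguished by their weights.
   Vitali's covering lemma replaces Besicovitch's; this costs a doubling constant for good functions
   and spares the discreteness of the set of covolumes. *)
theory Submission
  imports Defs "HOL-Complex_Analysis.Cauchy_Integral_Formula"
begin

section \<open>Quantitative nondivergence for chains in a poset\<close>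

text \<open>Goodness has to come from one-variable calculus, and the obstacle there is that a
  nonzero combination of the fixed functions is only known to have one nonvanishing derivative, at
  \<open>x0\<close> in one direction \<open>u\<close>. This persists in a thin cone about
  \<open>u\<close>, and segments from a point of a small ball in such directions do not fill the
  ball. Hence the apex is moved far out along \<open>u\<close>, at the price of enlarged balls. The
  order of the derivative and the width of the cone must not depend on the combination; relations
  among the functions are split off so that the coefficients can be normalized to a compact sphere.
  In the lattice argument, adding an integer vector that is small at \<open>x\<close> to a rational
  subspace multiplies its covolume by at most k t, where k is the dimension. This dictates the lower
  threshold 2 k t. The members of a chain have to stay at most 1, so the upper threshold absorbs the
  doubling constant: it is 1 / (Q + s), where \<open>s\<close> bounds \<open>Theta_hat\<close> /
  \<delta> at the centre of the ball, the only point at which \<open>Theta_hat\<close> is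
  evaluated.\<close>

abbreviation vol :: "'a::euclidean_space set \<Rightarrow> real" where
  "vol \<equiv> measure lebesgue"

text \<open>The \<open>(C, \<alpha>)\<close>-good functions of Kleinbock and Margulis; the estimate is cleared of the division by
  \<open>sup |f|\<close>, so that the zero function needs no special treatment.\<close>

definition good_on :: "'a set \<Rightarrow> real \<Rightarrow> real \<Rightarrow> ('a::euclidean_space \<Rightarrow> real) \<Rightarrow> bool" where
  "good_on B C \<alpha> f \<longleftrightarrow> continuous_on B f \<and>
     (\<forall>c r z \<epsilon>. ball c r \<subseteq> B \<and> z \<in> ball c r \<and> 0 < \<epsilon> \<longrightarrow>
        vol {x \<in> ball c r. \<bar>f x\<bar> < \<epsilon>} * \<bar>f z\<bar> powr \<alpha>
          \<le> C * \<epsilon> powr \<alpha> * vol (ball c r))"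

lemma good_onD:
  assumes "good_on B C \<alpha> f" "ball c r \<subseteq> B" "z \<in> ball c r" "0 < \<epsilon>"
  shows "vol {x \<in> ball c r. \<bar>f x\<bar> < \<epsilon>} * \<bar>f z\<bar> powr \<alpha>
          \<le> C * \<epsilon> powr \<alpha> * vol (ball c r)"
  using assms unfolding good_on_def by blast

lemma measure_ball_scale:
  fixes c c' :: "'a::euclidean_space"
  assumes "0 \<le> r" "0 \<le> t"
  shows "vol (ball c (t * r)) = t ^ DIM('a) * vol (ball c' r)"
  using assms by (simp add: content_ball power_mult_distrib)

lemma open_sublevel:
  fixes f :: "'a::euclidean_space \<Rightarrow> real"
  assumes "continuous_on B f" "ball c r \<subseteq> B"
  shows "open {x \<in> ball c r. \<bar>f x\<bar> < \<epsilon>}"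
proof -
  have "continuous_on (ball c r) (\<lambda>x. \<bar>f x\<bar>)"
    using assms by (intro continuous_intros) (auto intro: continuous_on_subset)
  then have "open (ball c r \<inter> (\<lambda>x. \<bar>f x\<bar>) -` {..<\<epsilon>})"
    by (intro continuous_open_preimage) auto
  moreover have "ball c r \<inter> (\<lambda>x. \<bar>f x\<bar>) -` {..<\<epsilon>} = {x \<in> ball c r. \<bar>f x\<bar> < \<epsilon>}" by auto
  ultimately show ?thesis by simp
qed

lemma sublevel_lmeasurable:
  fixes f :: "'a::euclidean_space \<Rightarrow> real"
  assumes "continuous_on B f" "ball c r \<subseteq> B"
  shows "{x \<in> ball c r. \<bar>f x\<bar> < \<epsilon>} \<in> lmeasurable"
  by (rule lmeasurable_open[OF bounded_subset[OF bounded_ball[of c r]] open_sublevel[OF assms]]) auto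

text \<open>Passage from a Vitali cover to a volume bound: each exceptional set \<open>E i\<close>
  is paid for by its own \<open>D i\<close>, and the \<open>D i\<close> are disjoint inside
  \<open>Q\<close>. The bound for finite unions is uniform, so the countable union inherits
  it.\<close>

lemma measure_UN_disjoint_comparison:
  fixes E D :: "'i \<Rightarrow> 'a::euclidean_space set"
  assumes "countable I" "0 \<le> k" and E: "\<And>i. i \<in> I \<Longrightarrow> E i \<in> lmeasurable"
    and D: "\<And>i. i \<in> I \<Longrightarrow> D i \<in> lmeasurable" "disjoint_family_on D I"
    and le: "\<And>i. i \<in> I \<Longrightarrow> vol (E i) \<le> k * vol (D i)"
    and Q: "\<And>i. i \<in> I \<Longrightarrow> D i \<subseteq> Q" "Q \<in> lmeasurable"
  shows "(\<Union>i\<in>I. E i) \<in> lmeasurable" "vol (\<Union>i\<in>I. E i) \<le> k * vol Q"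
proof -
  have b: "vol (\<Union>i\<in>J. E i) \<le> k * vol Q" if J: "J \<subseteq> I" "finite J" for J
  proof -
    have "vol (\<Union>i\<in>J. E i) \<le> (\<Sum>i\<in>J. vol (E i))"
      using J E by (intro measure_UNION_le) (auto simp: fmeasurableD)
    also have "\<dots> \<le> (\<Sum>i\<in>J. k * vol (D i))"
      using J le by (intro sum_mono) auto
    also have "\<dots> = k * vol (\<Union>i\<in>J. D i)"
    proof -
      have "vol (\<Union>i\<in>J. D i) = (\<Sum>i\<in>J. vol (D i))"
      proof (rule measure_finite_Union)
        show "disjoint_family_on D J" using D(2) J(1) by (rule disjoint_family_on_mono[rotated])
        show "emeasure lebesgue (D i) \<noteq> \<infinity>" if "i \<in> J" for i
          using that J D(1) fmeasurableD2 unfolding infinity_ennreal_def by blast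
      qed (use J D in auto)
      then show ?thesis by (simp add: sum_distrib_left)
    qed
    also have "\<dots> \<le> k * vol Q"
      using J Q D \<open>0 \<le> k\<close>
      by (intro mult_left_mono measure_mono_fmeasurable) (auto intro!: sets.finite_UN simp: fmeasurableD subset_iff)
    finally show ?thesis .
  qed
  show "(\<Union>i\<in>I. E i) \<in> lmeasurable" by (rule fmeasurable_UN_bound[OF \<open>countable I\<close> E b])
  show "vol (\<Union>i\<in>I. E i) \<le> k * vol Q"
    by (rule measure_UN_bound[OF \<open>countable I\<close> E b])
qed

text \<open>A chain \<open>F' \<supseteq> F\<close> witnessing that nothing below \<open>\<epsilon>\<close> happens at \<open>x\<close>; cf. the marked points of
  Kleinbock and Margulis. The upper bound is a separate \<open>\<rho>'\<close> because covering by dilated balls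
  only controls the functions up to a doubling constant.\<close>

definition marked ::
  "'s set \<Rightarrow> ('s \<Rightarrow> 's \<Rightarrow> bool) \<Rightarrow> ('s \<Rightarrow> 'a \<Rightarrow> real) \<Rightarrow> real \<Rightarrow> real \<Rightarrow> real \<Rightarrow> 's set \<Rightarrow> 'a \<Rightarrow> bool" where
  "marked S cmp \<psi> \<epsilon> \<rho> \<rho>' F x \<longleftrightarrow>
     (\<exists>F'. F \<subseteq> F' \<and> F' \<subseteq> S \<and> finite F' \<and> pairwise cmp F' \<and>
        (\<forall>s\<in>F' - F. \<epsilon> \<le> \<psi> s x \<and> \<psi> s x \<le> \<rho>') \<and>
        (\<forall>s\<in>S. s \<notin> F' \<and> (\<forall>t\<in>F'. cmp s t) \<longrightarrow> \<rho> \<le> \<psi> s x))"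

text \<open>The radius is only required to be within a factor 2 of the optimal one. Hence it exists even when
  infinitely many \<open>s\<close> are small at \<open>y\<close>.\<close>

lemma maximal_radius:
  fixes \<psi> :: "'s \<Rightarrow> 'a::euclidean_space \<Rightarrow> real"
  assumes cont: "\<And>s. s \<in> T \<Longrightarrow> continuous_on (ball c r) (\<psi> s)"
    and large: "\<And>s. s \<in> T \<Longrightarrow> \<exists>z\<in>ball c r. \<rho> \<le> \<psi> s z"
    and y: "y \<in> ball c r" "s0 \<in> T" "\<psi> s0 y < \<rho>"
  obtains s t where "s \<in> T" "0 < t" "t \<le> 2 * r" "\<forall>x\<in>ball y t. \<psi> s x < \<rho>"
    "\<And>s. s \<in> T \<Longrightarrow> \<exists>z\<in>ball y (2 * t). \<rho> \<le> \<psi> s z"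
proof -
  define A where "A = {t. 0 < t \<and> (\<exists>s\<in>T. \<forall>x\<in>ball y t. \<psi> s x < \<rho>)}"
  \<comment> \<open>As \<open>dist c y < r\<close>, a larger radius would swallow
    \<open>ball c r\<close>, where every index of \<open>T\<close> reaches \<rho>.\<close>
  have bound: "t \<le> 2 * r" if "t \<in> A" for t
  proof (rule ccontr)
    assume "\<not> t \<le> 2 * r"
    moreover have "dist c y < r" using y(1) by simp
    ultimately have "dist c y + r \<le> t" by linarith
    then have "ball c r \<subseteq> ball y t" by (simp add: ball_subset_ball_iff)
    then show False using that large unfolding A_def by fastforce
  qed
  have "open (ball c r \<inter> \<psi> s0 -` {..<\<rho>})"
    using cont[OF y(2)] by (intro continuous_open_preimage) auto
  then obtain e where "e > 0" "ball y e \<subseteq> ball c r \<inter> \<psi> s0 -` {..<\<rho>}"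
    using y by (auto elim: openE[where x = y])
  then have "e \<in> A" using y unfolding A_def by blast
  have bdd: "bdd_above A" using bound by (intro bdd_aboveI) auto
  have "e \<le> Sup A" using \<open>e \<in> A\<close> bdd by (rule cSup_upper)
  \<comment> \<open>With \<open>T\<close> infinite the supremum need not be attained. Any
    \<open>t\<close> above half of it will do: then \<open>2 * t\<close> is not in \<open>A\<close>,
    which is a statement about all indices of \<open>T\<close> at once.\<close>
  then have "Sup A / 2 < Sup A" using \<open>e > 0\<close> by simp
  then obtain t where t: "t \<in> A" "Sup A / 2 < t"
    using less_cSup_iff[OF _ bdd] \<open>e \<in> A\<close> by blast
  then obtain s where s: "s \<in> T" "\<forall>x\<in>ball y t. \<psi> s x < \<rho>" "0 < t" unfolding A_def by blast
  have "2 * t \<notin> A" using t(2) cSup_upper[OF _ bdd, of "2 * t"] by linarith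
  then have "\<exists>z\<in>ball y (2 * t). \<rho> \<le> \<psi> s z" if "s \<in> T" for s
    using that s(3) unfolding A_def by (auto simp: not_less)
  with s bound[OF t(1)] show ?thesis using that by blast
qed

text \<open>The ball of radius \<open>t\<close> lies in the sublevel set and fills a fixed fraction
  of the fivefold ball, so goodness, used with the point \<open>x\<close> itself, limits the value
  there. In the induction this keeps a new member of the chain bounded on a whole Vitali
  ball.\<close>

lemma good_on_doubling:
  fixes f :: "'a::euclidean_space \<Rightarrow> real"
  assumes g: "good_on B C \<alpha> f" and C: "0 < C" "0 < \<alpha>" and B: "ball y (5 * t) \<subseteq> B" "0 < t"
    and small: "\<forall>x\<in>ball y t. \<bar>f x\<bar> < \<rho>" and x: "x \<in> ball y (5 * t)"
  shows "\<bar>f x\<bar> \<le> (C * 5 ^ DIM('a)) powr (1 / \<alpha>) * \<rho>"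
proof -
  have \<rho>: "0 < \<rho>" using small B(2) by (metis abs_ge_zero centre_in_ball le_less_trans)
  let ?m = "vol (ball y t)"
  have m: "0 < ?m" using B(2) by simp
  have 5: "vol (ball y (5 * t)) = 5 ^ DIM('a) * ?m"
    using B(2) by (intro measure_ball_scale) auto
  have "?m \<le> vol {x \<in> ball y (5*t). \<bar>f x\<bar> < \<rho>}"
  proof (rule measure_mono_fmeasurable)
    show "ball y t \<subseteq> {x \<in> ball y (5*t). \<bar>f x\<bar> < \<rho>}" using small B(2) by auto
    show "{x \<in> ball y (5*t). \<bar>f x\<bar> < \<rho>} \<in> lmeasurable"
      using g B(1) sublevel_lmeasurable unfolding good_on_def by blast
  qed simp
  then have "?m * \<bar>f x\<bar> powr \<alpha> \<le> vol {x \<in> ball y (5*t). \<bar>f x\<bar> < \<rho>} * \<bar>f x\<bar> powr \<alpha>"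
    by (intro mult_right_mono) auto
  also have "\<dots> \<le> C * \<rho> powr \<alpha> * (5 ^ DIM('a) * ?m)"
    using good_onD[OF g B(1) x \<rho>] 5 by simp
  finally have "\<bar>f x\<bar> powr \<alpha> \<le> C * 5 ^ DIM('a) * \<rho> powr \<alpha>"
    using m by (simp add: field_simps)
  also have "\<dots> = ((C * 5 ^ DIM('a)) powr (1 / \<alpha>) * \<rho>) powr \<alpha>"
    using C \<rho> by (simp add: powr_mult powr_powr)
  finally have le: "\<bar>f x\<bar> powr \<alpha> \<le> ((C * 5 ^ DIM('a)) powr (1 / \<alpha>) * \<rho>) powr \<alpha>" .
  have "0 \<le> (C * 5 ^ DIM('a)) powr (1 / \<alpha>) * \<rho>" using \<rho> by simp
  then show ?thesis
    using le powr_less_mono2[OF C(2)] by (meson not_le)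
qed

text \<open>Induction on the number \<open>n\<close> of elements by which the chain \<open>F\<close> can still grow: on each Vitali ball
  the index \<open>s\<close> of almost maximal radius joins the chain.\<close>

lemma nondivergence:
  fixes \<psi> :: "'s \<Rightarrow> 'a::euclidean_space \<Rightarrow> real"
  assumes good: "\<And>s. s \<in> S \<Longrightarrow> good_on B C \<alpha> (\<psi> s)" and nonneg: "\<And>s x. 0 \<le> \<psi> s x"
    and sym: "\<And>s t. cmp s t \<Longrightarrow> cmp t s"
    and clique: "\<And>F. F \<subseteq> S \<Longrightarrow> finite F \<Longrightarrow> pairwise cmp F \<Longrightarrow> card F \<le> N"
    and pos: "0 < C" "0 < \<alpha>" "0 < \<epsilon>" "0 < \<rho>"
    and \<rho>': "\<rho>' = (C * 5 ^ DIM('a)) powr (1 / \<alpha>) * \<rho>"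
  shows "F \<subseteq> S \<Longrightarrow> finite F \<Longrightarrow> pairwise cmp F \<Longrightarrow> N \<le> card F + n \<Longrightarrow> 0 < r \<Longrightarrow>
      ball c (11 ^ n * r) \<subseteq> B \<Longrightarrow>
      (\<And>s. s \<in> S \<Longrightarrow> s \<notin> F \<Longrightarrow> \<forall>t\<in>F. cmp s t \<Longrightarrow> \<exists>z\<in>ball c r. \<rho> \<le> \<psi> s z) \<Longrightarrow>
      \<exists>E\<in>lmeasurable. vol E
          \<le> (C * n * (15 ^ DIM('a)) ^ n) * (\<epsilon> / \<rho>) powr \<alpha> * vol (ball c r) \<and>
        (\<forall>x\<in>ball c r - E. marked S cmp \<psi> \<epsilon> \<rho> \<rho>' F x)"
proof (induction n arbitrary: F c r)
  case 0
  \<comment> \<open>\<open>F\<close> already has at least \<open>N\<close> elements, so no clique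
    extends it properly and \<open>F\<close> itself marks every point.\<close>
  have "False" if s: "s \<in> S" "s \<notin> F" "\<forall>t\<in>F. cmp s t" for s
  proof -
    have "pairwise cmp (insert s F)"
      using s(3) "0.prems"(3) sym by (auto simp: pairwise_insert)
    then have "card (insert s F) \<le> N" using clique[of "insert s F"] s(1) "0.prems" by auto
    then show False using s(2) "0.prems"(2,4) by simp
  qed
  then have "marked S cmp \<psi> \<epsilon> \<rho> \<rho>' F x" for x
    using "0.prems" unfolding marked_def by (intro exI[of _ F]) auto
  then show ?case by (intro bexI[of _ "{}"]) auto
next
  case (Suc n)
  define T where "T = {s \<in> S. s \<notin> F \<and> (\<forall>t\<in>F. cmp s t)}"
  define Y where "Y = {y \<in> ball c r. \<exists>s\<in>T. \<psi> s y < \<rho>}"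
  let ?D = "DIM('a)"
  \<comment> \<open>The term with \<open>n\<close> comes from the induction hypothesis, the summand
    1 from the sublevel set of the function that joins the chain now.\<close>
  let ?k = "C * (real n * (15 ^ ?D) ^ n + 1) * (\<epsilon> / \<rho>) powr \<alpha>"
  have rB: "ball c r \<subseteq> B"
    using Suc.prems(5,6) mult_right_mono[of 1 "11 ^ Suc n" r]
      one_le_power[of "11::real" "Suc n"] subset_ball[of r "11 ^ Suc n * r" c] by simp
  have large: "\<exists>z\<in>ball c r. \<rho> \<le> \<psi> s z" if "s \<in> T" for s
    using that Suc.prems(7) unfolding T_def by blast
  have cont: "continuous_on (ball c r) (\<psi> s)" if "s \<in> T" for s
    using that good rB unfolding T_def good_on_def by (blast intro: continuous_on_subset)
  have "\<exists>s t. s \<in> T \<and> 0 < t \<and> t \<le> 2 * r \<and> (\<forall>x\<in>ball y t. \<psi> s x < \<rho>) \<and>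
      (\<forall>s\<in>T. \<exists>z\<in>ball y (2 * t). \<rho> \<le> \<psi> s z)" if y: "y \<in> Y" for y
  proof -
    obtain s0 where "s0 \<in> T" "\<psi> s0 y < \<rho>" "y \<in> ball c r" using y unfolding Y_def by auto
    from maximal_radius[of T c r \<psi> \<rho>, OF cont large this(3,1,2)] show ?thesis by metis
  qed
  then have "\<forall>y\<in>Y. \<exists>p. fst p \<in> T \<and> 0 < snd p \<and> snd p \<le> 2 * r \<and>
      (\<forall>x\<in>ball y (snd p). \<psi> (fst p) x < \<rho>) \<and>
      (\<forall>s\<in>T. \<exists>z\<in>ball y (2 * snd p). \<rho> \<le> \<psi> s z)" by (simp del: ball_simps mem_ball)
  from bchoice[OF this] obtain p where p: "\<forall>y\<in>Y. fst (p y) \<in> T \<and> 0 < snd (p y) \<and> snd (p y) \<le> 2 * r \<and>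
      (\<forall>x\<in>ball y (snd (p y)). \<psi> (fst (p y)) x < \<rho>) \<and>
      (\<forall>s\<in>T. \<exists>z\<in>ball y (2 * snd (p y)). \<rho> \<le> \<psi> s z)" ..
  define \<sigma> \<tau> where "\<sigma> y = fst (p y)" and "\<tau> y = snd (p y)" for y
  have \<sigma>: "\<sigma> y \<in> T" and \<tau>: "0 < \<tau> y" "\<tau> y \<le> 2 * r"
    and small: "\<forall>x\<in>ball y (\<tau> y). \<psi> (\<sigma> y) x < \<rho>"
    and big: "\<And>s. s \<in> T \<Longrightarrow> \<exists>z\<in>ball y (2 * \<tau> y). \<rho> \<le> \<psi> s z" if "y \<in> Y" for y
    using p that unfolding \<sigma>_def \<tau>_def by blast+
  \<comment> \<open>11 = 1 + 5 * 2: the centre moves by less than \<open>r\<close>, and the new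
    radius is \<open>5 * \<tau> y\<close> with \<open>\<tau> y \<le> 2 * r\<close>.\<close>
  have sub: "ball y (11 ^ n * (5 * \<tau> y)) \<subseteq> B" "ball y (5 * \<tau> y) \<subseteq> B" if "y \<in> Y" for y
  proof -
    have "dist c y + 11 ^ n * (5 * \<tau> y) \<le> 1 * r + 11 ^ n * (5 * (2 * r))"
      using \<tau>[OF that] that unfolding Y_def by (intro add_mono mult_left_mono) auto
    also have "\<dots> \<le> 11 ^ n * r + 11 ^ n * (5 * (2 * r))"
      using Suc.prems(5) by (intro add_mono mult_right_mono) auto
    finally have "dist c y + 11 ^ n * (5 * \<tau> y) \<le> 11 ^ Suc n * r" by (simp add: mult_ac)
    then have "ball y (11 ^ n * (5 * \<tau> y)) \<subseteq> ball c (11 ^ Suc n * r)"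
      by (simp add: ball_subset_ball_iff dist_commute)
    then show *: "ball y (11 ^ n * (5 * \<tau> y)) \<subseteq> B" using Suc.prems(6) by blast
    have "1 * (5 * \<tau> y) \<le> 11 ^ n * (5 * \<tau> y)"
      using \<tau>[OF that] by (intro mult_right_mono) auto
    then show "ball y (5 * \<tau> y) \<subseteq> B" using * subset_ball[of "5 * \<tau> y" "11 ^ n * (5 * \<tau> y)" y] by simp
  qed
  have "\<exists>E\<in>lmeasurable. vol E
          \<le> (C * n * (15 ^ ?D) ^ n) * (\<epsilon> / \<rho>) powr \<alpha> * vol (ball y (5 * \<tau> y)) \<and>
        (\<forall>x\<in>ball y (5 * \<tau> y) - E. marked S cmp \<psi> \<epsilon> \<rho> \<rho>' (insert (\<sigma> y) F) x)" if y: "y \<in> Y" for y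
  proof (rule Suc.IH)
    have s: "\<sigma> y \<in> S" "\<sigma> y \<notin> F" "\<forall>t\<in>F. cmp (\<sigma> y) t" using \<sigma>[OF y] unfolding T_def by auto
    show "pairwise cmp (insert (\<sigma> y) F)"
      using s Suc.prems(3) sym by (auto simp: pairwise_insert)
    show "insert (\<sigma> y) F \<subseteq> S" "finite (insert (\<sigma> y) F)" "N \<le> card (insert (\<sigma> y) F) + n"
      using s Suc.prems by auto
    show "0 < 5 * \<tau> y" "ball y (11 ^ n * (5 * \<tau> y)) \<subseteq> B" using \<tau>[OF y] sub[OF y] by auto
    \<comment> \<open>A candidate for the longer chain was one for \<open>F\<close>, hence lies in
      \<open>T\<close>. By the choice of \<open>\<tau> y\<close> all of \<open>T\<close> reaches
      \<rho> in \<open>ball y (2 * \<tau> y)\<close>, inside the new ball.\<close>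
    fix s' assume "s' \<in> S" "s' \<notin> insert (\<sigma> y) F" "\<forall>t\<in>insert (\<sigma> y) F. cmp s' t"
    then have "s' \<in> T" unfolding T_def by auto
    moreover have "ball y (2 * \<tau> y) \<subseteq> ball y (5 * \<tau> y)" using \<tau>[OF y] by (intro subset_ball) auto
    ultimately show "\<exists>z\<in>ball y (5 * \<tau> y). \<rho> \<le> \<psi> s' z" using big[OF y] by blast
  qed
  then have "\<forall>y\<in>Y. \<exists>E. E \<in> lmeasurable \<and> vol E
          \<le> (C * n * (15 ^ ?D) ^ n) * (\<epsilon> / \<rho>) powr \<alpha> * vol (ball y (5 * \<tau> y)) \<and>
        (\<forall>x\<in>ball y (5 * \<tau> y) - E. marked S cmp \<psi> \<epsilon> \<rho> \<rho>' (insert (\<sigma> y) F) x)" by blast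
  from bchoice[OF this] obtain E where "\<forall>y\<in>Y. E y \<in> lmeasurable \<and> vol (E y)
          \<le> (C * n * (15 ^ ?D) ^ n) * (\<epsilon> / \<rho>) powr \<alpha> * vol (ball y (5 * \<tau> y)) \<and>
        (\<forall>x\<in>ball y (5 * \<tau> y) - E y. marked S cmp \<psi> \<epsilon> \<rho> \<rho>' (insert (\<sigma> y) F) x)" ..
  then have E: "E y \<in> lmeasurable" "vol (E y)
          \<le> (C * n * (15 ^ ?D) ^ n) * (\<epsilon> / \<rho>) powr \<alpha> * vol (ball y (5 * \<tau> y))"
    "\<And>x. x \<in> ball y (5 * \<tau> y) - E y \<Longrightarrow> marked S cmp \<psi> \<epsilon> \<rho> \<rho>' (insert (\<sigma> y) F) x"
    if "y \<in> Y" for y using that by blast+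
  define A where "A y = {x \<in> ball y (5 * \<tau> y). \<bar>\<psi> (\<sigma> y) x\<bar> < \<epsilon>}" for y
  have gs: "good_on B C \<alpha> (\<psi> (\<sigma> y))" if "y \<in> Y" for y using good \<sigma>[OF that] unfolding T_def by blast
  have A: "A y \<in> lmeasurable" if "y \<in> Y" for y
    unfolding A_def using gs[OF that] sub[OF that] sublevel_lmeasurable unfolding good_on_def by blast
  have Am: "vol (A y) \<le> C * (\<epsilon> / \<rho>) powr \<alpha> * vol (ball y (5 * \<tau> y))"
    if y: "y \<in> Y" for y
  proof -
    obtain z where z: "z \<in> ball y (2 * \<tau> y)" "\<rho> \<le> \<psi> (\<sigma> y) z" using big[OF y \<sigma>[OF y]] by blast
    then have z5: "z \<in> ball y (5 * \<tau> y)" using \<tau>[OF y] by auto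
    have "vol (A y) * \<rho> powr \<alpha> \<le> vol (A y) * \<bar>\<psi> (\<sigma> y) z\<bar> powr \<alpha>"
      using z pos by (intro mult_left_mono powr_mono2) auto
    also have "\<dots> \<le> C * \<epsilon> powr \<alpha> * vol (ball y (5 * \<tau> y))"
      unfolding A_def by (rule good_onD[OF gs[OF y] sub(2)[OF y] z5 pos(3)])
    finally show ?thesis using pos by (simp add: powr_divide field_simps)
  qed
  obtain I where I: "countable I" "I \<subseteq> Y"
     "pairwise (\<lambda>i j. disjnt (cball i (\<tau> i)) (cball j (\<tau> j))) I"
     "\<And>i. i \<in> Y \<Longrightarrow> \<exists>j. j \<in> I \<and> cball i (\<tau> i) \<subseteq> ball j (5 * \<tau> j)"
  proof (rule Vitali_covering_lemma_cballs_balls[of Y \<tau> "2 * r" "\<lambda>y. y"])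
    show "0 < \<tau> i \<and> \<tau> i \<le> 2 * r" if "i \<in> Y" for i using \<tau> that by blast
  next
    fix J assume J: "countable J" "J \<subseteq> Y"
      "pairwise (\<lambda>i j. disjnt (cball i (\<tau> i)) (cball j (\<tau> j))) J"
      "\<And>i. i \<in> Y \<Longrightarrow> \<exists>j. j \<in> J \<and> \<not> disjnt (cball i (\<tau> i)) (cball j (\<tau> j)) \<and>
         cball i (\<tau> i) \<subseteq> ball j (5 * \<tau> j)"
    show thesis by (rule that[OF J(1,2,3)]) (use J(4) in blast)
  qed
  have m5: "vol (ball y (5 * \<tau> y)) = 5 ^ ?D * vol (cball y (\<tau> y))"
    if "y \<in> Y" for y
    using \<tau>(1)[OF that] by (simp add: content_ball content_cball power_mult_distrib)
  have U: "vol (E y \<union> A y) \<le> (?k * 5 ^ ?D) * vol (cball y (\<tau> y))" if y: "y \<in> Y" for y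
  proof -
    have "vol (E y \<union> A y) \<le> vol (E y) + vol (A y)"
      using E(1)[OF y] A[OF y] by (intro measure_Un_le) auto
    also have "\<dots> \<le> ?k * vol (ball y (5 * \<tau> y))"
      using E(2)[OF y] Am[OF y] by (simp add: algebra_simps)
    finally show ?thesis unfolding m5[OF y] by (simp add: mult.assoc)
  qed
  have Q: "cball y (\<tau> y) \<subseteq> ball c (3 * r)" if "y \<in> Y" for y
  proof
    fix x assume "x \<in> cball y (\<tau> y)"
    then show "x \<in> ball c (3 * r)"
      using that \<tau>(2)[OF that] dist_triangle[of c x y] unfolding Y_def by auto
  qed
  have k0: "0 \<le> ?k * 5 ^ ?D" using pos by simp
  have dj: "disjoint_family_on (\<lambda>y. cball y (\<tau> y)) I"
    using I(3) unfolding disjoint_family_on_def pairwise_def disjnt_def by auto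
  have EA: "(\<Union>y\<in>I. E y \<union> A y) \<in> lmeasurable"
    "vol (\<Union>y\<in>I. E y \<union> A y) \<le> (?k * 5 ^ ?D) * vol (ball c (3 * r))"
  proof -
    have IY: "i \<in> Y" if "i \<in> I" for i using that I(2) by blast
    note cmpr = measure_UN_disjoint_comparison[OF I(1) k0 fmeasurable.Un[OF E(1) A]
        lmeasurable_cball dj U Q lmeasurable_ball, OF IY IY IY IY]
    show "(\<Union>y\<in>I. E y \<union> A y) \<in> lmeasurable" by (rule cmpr(1))
    show "vol (\<Union>y\<in>I. E y \<union> A y) \<le> (?k * 5 ^ ?D) * vol (ball c (3 * r))"
      by (rule cmpr(2))
  qed
  \<comment> \<open>The factor 15 is 5 * 3: Vitali balls are dilated by 5, and the disjoint ones lie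
    in \<open>ball c (3 * r)\<close>.\<close>
  have le: "vol (\<Union>y\<in>I. E y \<union> A y)
     \<le> C * Suc n * (15 ^ ?D) ^ Suc n * (\<epsilon> / \<rho>) powr \<alpha> * vol (ball c r)"
  proof -
    define P :: real where "P = 15 ^ ?D"
    define m where "m = C * (\<epsilon> / \<rho>) powr \<alpha> * vol (ball c r)"
    have m0: "0 \<le> m" using pos unfolding m_def by simp
    have P1: "1 \<le> P" unfolding P_def by (rule one_le_power) simp
    have P53: "5 ^ ?D * 3 ^ ?D = P" unfolding P_def using power_mult_distrib[of "5::real" 3 ?D] by simp
    have "vol (\<Union>y\<in>I. E y \<union> A y)
        \<le> (?k * 5 ^ ?D) * (3 ^ ?D * vol (ball c r))"
      using EA(2) Suc.prems(5) measure_ball_scale[of r 3 c c] by simp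
    also have "\<dots> = (C * (real n * P ^ n + 1) * (\<epsilon> / \<rho>) powr \<alpha> * vol (ball c r)) * (5 ^ ?D * 3 ^ ?D)"
      unfolding P_def by (simp only: mult_ac)
    also have "\<dots> = (real n * P ^ n + 1) * P * m"
      unfolding P53 m_def by (simp only: mult_ac)
    also have "\<dots> \<le> (real (Suc n) * P ^ Suc n) * m"
      using one_le_power[OF P1, of n] P1 m0 by (intro mult_right_mono) (auto simp: algebra_simps)
    finally show ?thesis unfolding m_def P_def by (simp only: mult_ac)
  qed
  have "marked S cmp \<psi> \<epsilon> \<rho> \<rho>' F x" if x: "x \<in> ball c r - (\<Union>y\<in>I. E y \<union> A y)" for x
  proof (cases "x \<in> Y")
    case False
    then have "\<rho> \<le> \<psi> s x" if "s \<in> T" for s using x that unfolding Y_def by force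
    then show ?thesis
      using Suc.prems unfolding marked_def T_def by (intro exI[of _ F]) auto
  next
    case True
    then obtain y where y: "y \<in> I" "cball x (\<tau> x) \<subseteq> ball y (5 * \<tau> y)" using I(4) by blast
    with I(2) have yY: "y \<in> Y" by blast
    have x5: "x \<in> ball y (5 * \<tau> y)" using y(2) \<tau>(1)[OF True] by (auto simp: subset_iff)
    \<comment> \<open>\<open>\<sigma> y\<close> obeys both bounds: the lower one because
      \<open>x\<close> avoids \<open>A y\<close>, the upper one by doubling, as the function is
      below \<rho> on \<open>ball y (\<tau> y)\<close>.\<close>
    have lo: "\<epsilon> \<le> \<psi> (\<sigma> y) x" using x x5 y(1) nonneg unfolding A_def by force
    have hi: "\<psi> (\<sigma> y) x \<le> \<rho>'"
      using good_on_doubling[OF gs[OF yY] pos(1,2) sub(2)[OF yY] \<tau>(1)[OF yY] _ x5, of \<rho>]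
        small[OF yY] nonneg unfolding \<rho>' by simp
    have "marked S cmp \<psi> \<epsilon> \<rho> \<rho>' (insert (\<sigma> y) F) x" using E(3)[OF yY] x x5 y(1) by blast
    then obtain F' where F': "insert (\<sigma> y) F \<subseteq> F'" "F' \<subseteq> S" "finite F'" "pairwise cmp F'"
      "\<forall>s\<in>F' - insert (\<sigma> y) F. \<epsilon> \<le> \<psi> s x \<and> \<psi> s x \<le> \<rho>'"
      "\<forall>s\<in>S. s \<notin> F' \<and> (\<forall>t\<in>F'. cmp s t) \<longrightarrow> \<rho> \<le> \<psi> s x"
      unfolding marked_def by blast
    with lo hi have "\<forall>s\<in>F' - F. \<epsilon> \<le> \<psi> s x \<and> \<psi> s x \<le> \<rho>'" by blast
    with F' show ?thesis unfolding marked_def by blast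
  qed
  with EA(1) le show ?case by (intro bexI[of _ "\<Union>y\<in>I. E y \<union> A y"]) auto
qed

section \<open>Sublevel sets of one-variable functions\<close>

text \<open>Induction that removes the largest point: Rolle gives a new zero between the two largest
  ones. The clause \<open>y < Max X\<close> separates it from the zeros found before.\<close>

lemma rolle_zeros:
  fixes f f' :: "real \<Rightarrow> real"
  assumes D: "\<And>t. t \<in> {a..b} \<Longrightarrow> (f has_real_derivative f' t) (at t)"
  shows "X \<subseteq> {a..b} \<Longrightarrow> finite X \<Longrightarrow> card X = Suc n \<Longrightarrow> (\<And>x. x \<in> X \<Longrightarrow> f x = 0) \<Longrightarrow>
    \<exists>Y\<subseteq>{a..b}. finite Y \<and> card Y = n \<and> (\<forall>y\<in>Y. f' y = 0 \<and> y < Max X)"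
proof (induction n arbitrary: X)
  case 0
  then show ?case by (intro exI[of _ "{}"]) auto
next
  case (Suc n)
  define M where "M = Max X"
  have MX: "M \<in> X" unfolding M_def using Suc.prems by (intro Max_in) auto
  let ?X = "X - {M}"
  have c: "card ?X = Suc n" using Suc.prems MX by simp
  then obtain Y where Y: "Y \<subseteq> {a..b}" "finite Y" "card Y = n" "\<forall>y\<in>Y. f' y = 0 \<and> y < Max ?X"
    using Suc.IH[of ?X] Suc.prems by auto
  define m where "m = Max ?X"
  have "?X \<noteq> {}" using c by (metis card.empty nat.distinct(1))
  then have m: "m \<in> ?X" unfolding m_def using Suc.prems(2) by (intro Max_in) auto
  have "m \<le> M" unfolding M_def using m Suc.prems(2) by (intro Max_ge) auto
  with m have mM: "m < M" by auto
  have sub: "{m..M} \<subseteq> {a..b}" using m MX Suc.prems(1) by auto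
  have "\<exists>z>m. z < M \<and> (f has_real_derivative 0) (at z)"
  proof (rule Rolle[OF mM])
    show "f m = f M" using Suc.prems(4) m MX by simp
    show "continuous_on {m..M} f"
      using D sub DERIV_isCont by (intro continuous_at_imp_continuous_on ballI) blast
    show "f differentiable (at x)" if "m < x" "x < M" for x
      using D[of x] that sub by (force simp: real_differentiable_def)
  qed
  then obtain z where z: "m < z" "z < M" "(f has_real_derivative 0) (at z)" by blast
  then have "f' z = 0" using D[of z] sub DERIV_unique by fastforce
  moreover have "z \<notin> Y" using Y(4) z(1) unfolding m_def by force
  ultimately show ?case
    using Y z sub mM unfolding m_def[symmetric] M_def[symmetric]
    by (intro exI[of _ "insert z Y"]) force
qed

text \<open>Rolle hands zeros down the chain of derivatives until \<open>g n\<close> has one. In the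
  other direction, each earlier function has a zero in an interval of length 1 and is therefore
  bounded by the bound of its derivative.\<close>

lemma vanishing_chain:
  fixes g :: "nat \<Rightarrow> real \<Rightarrow> real"
  shows "(\<And>j t. j < n \<Longrightarrow> t \<in> {0..1} \<Longrightarrow> (g j has_real_derivative g (Suc j) t) (at t)) \<Longrightarrow>
    X \<subseteq> {0..1} \<Longrightarrow> finite X \<Longrightarrow> card X = Suc n \<Longrightarrow> (\<And>x. x \<in> X \<Longrightarrow> g 0 x = 0) \<Longrightarrow>
    (\<exists>\<xi>\<in>{0..1}. g n \<xi> = 0) \<and> (\<forall>K. (\<forall>t\<in>{0..1}. \<bar>g n t\<bar> \<le> K) \<longrightarrow> (\<forall>t\<in>{0..1}. \<bar>g 0 t\<bar> \<le> K))"
proof (induction n arbitrary: g X)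
  case 0
  then obtain x where "X = {x}" by (auto simp: card_Suc_eq)
  with 0 show ?case by auto
next
  case (Suc n)
  have D: "(g 0 has_real_derivative g 1 t) (at t)" if "t \<in> {0..1}" for t
    using Suc.prems(1)[of 0 t] that by simp
  obtain Y where Y: "Y \<subseteq> {0..1}" "finite Y" "card Y = Suc n" "\<forall>y\<in>Y. g 1 y = 0"
    using rolle_zeros[of 0 1 "g 0" "g 1" X "Suc n"] D Suc.prems by auto
  have IH: "(\<exists>\<xi>\<in>{0..1}. g (Suc n) \<xi> = 0) \<and>
    (\<forall>K. (\<forall>t\<in>{0..1}. \<bar>g (Suc n) t\<bar> \<le> K) \<longrightarrow> (\<forall>t\<in>{0..1}. \<bar>g 1 t\<bar> \<le> K))"
    using Suc.IH[of "\<lambda>j. g (Suc j)" Y] Suc.prems(1) Y by simp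
  have "X \<noteq> {}" using Suc.prems(4) by auto
  then obtain x where x: "x \<in> X" by blast
  then have x01: "x \<in> {0..1}" using Suc.prems(2) by blast
  have "\<bar>g 0 t\<bar> \<le> K" if K: "\<forall>t\<in>{0..1}. \<bar>g (Suc n) t\<bar> \<le> K" and t: "t \<in> {0..1}" for K t
  proof -
    have b: "\<bar>g 1 t\<bar> \<le> K" if "t \<in> {0..1}" for t using IH K that by blast
    have "norm (g 0 t - g 0 x) \<le> K * norm (t - x)"
      by (rule field_differentiable_bound[of "{0..1}" "g 0" "g 1"])
        (use D b t x01 in \<open>auto intro: has_field_derivative_at_within\<close>)
    also have "\<dots> \<le> K * 1"
      using t x01 b[OF t] by (intro mult_left_mono) auto
    finally show ?thesis using Suc.prems(5)[OF x] by simp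
  qed
  with IH show ?case by blast
qed

text \<open>Each Lagrange polynomial is a monic product of \<open>n\<close> linear factors, at most
  1 in size on the unit interval, divided by a product of \<open>n\<close> differences of size at
  least \<open>h\<close>. Hence one quantity bounds both leading coefficient and values.\<close>

lemma lagrange_interpolation:
  fixes X :: "real set" and g :: "real \<Rightarrow> real"
  assumes X: "X \<subseteq> {0..1}" "finite X" "card X = Suc n" and h: "0 < h"
    and sep: "\<And>x y. x \<in> X \<Longrightarrow> y \<in> X \<Longrightarrow> x \<noteq> y \<Longrightarrow> h \<le> \<bar>x - y\<bar>"
    and g: "\<And>x. x \<in> X \<Longrightarrow> \<bar>g x\<bar> \<le> \<epsilon>"
  obtains P where "degree P \<le> n" "\<And>x. x \<in> X \<Longrightarrow> poly P x = g x"
    "\<bar>coeff P n\<bar> \<le> Suc n * (\<epsilon> / h ^ n)" "\<And>t. t \<in> {0..1} \<Longrightarrow> \<bar>poly P t\<bar> \<le> Suc n * (\<epsilon> / h ^ n)"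
proof -
  define w where "w a = g a / (\<Prod>b\<in>X - {a}. a - b)" for a
  define Q where "Q a = (\<Prod>b\<in>X - {a}. [:-b, 1:])" for a :: real
  define P where "P = (\<Sum>a\<in>X. smult (w a) (Q a))"
  have cd: "card (X - {a}) = n" if "a \<in> X" for a using X that by simp
  have w: "\<bar>w a\<bar> \<le> \<epsilon> / h ^ n" if a: "a \<in> X" for a
  proof -
    have "h ^ n = (\<Prod>b\<in>X - {a}. h)" using cd[OF a] by simp
    also have "\<dots> \<le> (\<Prod>b\<in>X - {a}. \<bar>a - b\<bar>)"
      using h sep[OF a] by (intro prod_mono) auto
    finally have "h ^ n \<le> \<bar>\<Prod>b\<in>X - {a}. a - b\<bar>" by (simp add: abs_prod)
    then show ?thesis
      unfolding w_def abs_divide using g[OF a] h by (intro frac_le) auto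
  qed
  have \<epsilon>: "0 \<le> \<epsilon> / h ^ n"
  proof -
    have "X \<noteq> {}" using X by auto
    then obtain a where "a \<in> X" by blast
    from w[OF this] show ?thesis by linarith
  qed
  have dQ: "degree (Q a) = n" if "a \<in> X" for a
    unfolding Q_def using cd[OF that] by (subst degree_prod_eq_sum_degree) auto
  have "lead_coeff (Q a) = 1" for a
    unfolding Q_def by (simp add: lead_coeff_prod)
  then have cQ: "coeff (Q a) n = 1" if "a \<in> X" for a using dQ[OF that] by metis
  have pQ: "\<bar>poly (Q a) t\<bar> \<le> 1" if "t \<in> {0..1}" for a t
    unfolding Q_def poly_prod abs_prod using X that by (intro prod_le_1) (auto simp: abs_le_iff)
  show ?thesis
  proof
    show "degree P \<le> n" unfolding P_def using X dQ
      by (intro degree_sum_le) (auto intro: order_trans[OF degree_smult_le])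
    show "poly P x = g x" if x: "x \<in> X" for x
    proof -
      have "poly P x = (\<Sum>a\<in>X. if a = x then g x else 0)"
        unfolding P_def poly_sum
      proof (rule sum.cong[OF refl])
        fix a assume a: "a \<in> X"
        show "poly (smult (w a) (Q a)) x = (if a = x then g x else 0)"
        proof (cases "a = x")
          case True
          have "(\<Prod>b\<in>X - {x}. x - b) \<noteq> 0" using X by auto
          then show ?thesis using True unfolding w_def Q_def by (simp add: poly_prod)
        next
          case False
          then show ?thesis using x X unfolding Q_def by (auto simp: poly_prod intro!: prod_zero)
        qed
      qed
      then show ?thesis using x X by simp
    qed
    have "\<bar>coeff P n\<bar> \<le> (\<Sum>a\<in>X. \<bar>w a\<bar>)"
      unfolding P_def coeff_sum using cQ by (intro order_trans[OF sum_abs]) (auto intro!: sum_mono)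
    also have "\<dots> \<le> (\<Sum>a\<in>X. \<epsilon> / h ^ n)" by (intro sum_mono w)
    finally show "\<bar>coeff P n\<bar> \<le> Suc n * (\<epsilon> / h ^ n)" using X by simp
    fix t :: real assume t: "t \<in> {0..1}"
    have "\<bar>poly P t\<bar> \<le> (\<Sum>a\<in>X. \<bar>w a\<bar> * \<bar>poly (Q a) t\<bar>)"
      unfolding P_def poly_sum by (intro order_trans[OF sum_abs]) (auto simp: abs_mult)
    also have "\<dots> \<le> (\<Sum>a\<in>X. \<epsilon> / h ^ n * 1)"
      using w pQ[OF t] \<epsilon> by (intro sum_mono mult_mono) auto
    finally show "\<bar>poly P t\<bar> \<le> Suc n * (\<epsilon> / h ^ n)" using X by simp
  qed
qed

text \<open>Interpolate \<open>g 0\<close> at the points of \<open>X\<close>. By Rolle, the \<open>l\<close>-th derivative of the interpolation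
  polynomial is a value of \<open>g l\<close>, which therefore is small; the interpolation error is bounded by the
  same quantity.\<close>

lemma bound_from_spread_points:
  fixes g :: "nat \<Rightarrow> real \<Rightarrow> real"
  assumes D: "\<And>j t. j < l \<Longrightarrow> t \<in> {0..1} \<Longrightarrow> (g j has_real_derivative g (Suc j) t) (at t)"
    and ratio: "\<And>t t'. t \<in> {0..1} \<Longrightarrow> t' \<in> {0..1} \<Longrightarrow> \<bar>g l t\<bar> \<le> \<kappa> * \<bar>g l t'\<bar>" and "0 \<le> \<kappa>"
    and X: "X \<subseteq> {0..1}" "finite X" "card X = Suc l" and h: "0 < h"
    and sep: "\<And>x y. x \<in> X \<Longrightarrow> y \<in> X \<Longrightarrow> x \<noteq> y \<Longrightarrow> h \<le> \<bar>x - y\<bar>"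
    and small: "\<And>x. x \<in> X \<Longrightarrow> \<bar>g 0 x\<bar> \<le> \<epsilon>" and z: "z \<in> {0..1}"
  shows "\<bar>g 0 z\<bar> \<le> (1 + (\<kappa> + 1) * fact l) * (Suc l * (\<epsilon> / h ^ l))"
proof -
  obtain P where P: "degree P \<le> l" "\<And>x. x \<in> X \<Longrightarrow> poly P x = g 0 x"
    "\<bar>coeff P l\<bar> \<le> Suc l * (\<epsilon> / h ^ l)" "\<And>t. t \<in> {0..1} \<Longrightarrow> \<bar>poly P t\<bar> \<le> Suc l * (\<epsilon> / h ^ l)"
    by (rule lagrange_interpolation[OF X h, of "g 0" \<epsilon>]) (use sep small in blast)+
  have "(pderiv ^^ l) P = [:fact l * coeff P l:]"
    using P(1) by (intro poly_eqI)
      (auto simp: coeff_higher_pderiv coeff_pCons coeff_eq_0 pochhammer_fact split: nat.split)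
  then have Pl: "poly ((pderiv ^^ l) P) t = fact l * coeff P l" for t by simp
  define q where "q = \<bar>fact l * coeff P l\<bar>"
  have q: "q \<le> fact l * (Suc l * (\<epsilon> / h ^ l))"
    unfolding q_def abs_mult using mult_left_mono[OF P(3), of "fact l"] by simp
  define H where "H j t = g j t - poly ((pderiv ^^ j) P) t" for j t
  have "(\<exists>\<xi>\<in>{0..1}. H l \<xi> = 0) \<and>
    (\<forall>K. (\<forall>t\<in>{0..1}. \<bar>H l t\<bar> \<le> K) \<longrightarrow> (\<forall>t\<in>{0..1}. \<bar>H 0 t\<bar> \<le> K))"
  proof (rule vanishing_chain[OF _ X])
    show "(H j has_real_derivative H (Suc j) t) (at t)" if "j < l" "t \<in> {0..1}" for j t
      unfolding H_def using D[OF that] by (auto intro!: derivative_eq_intros poly_DERIV)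
    show "H 0 x = 0" if "x \<in> X" for x unfolding H_def using P(2)[OF that] by simp
  qed
  then obtain \<xi> where \<xi>: "\<xi> \<in> {0..1}" "H l \<xi> = 0"
    and bd: "\<And>K t. \<forall>t\<in>{0..1}. \<bar>H l t\<bar> \<le> K \<Longrightarrow> t \<in> {0..1} \<Longrightarrow> \<bar>H 0 t\<bar> \<le> K" by blast
  have gq: "\<bar>g l \<xi>\<bar> = q" using \<xi>(2) unfolding H_def Pl q_def by simp
  have "\<bar>H l t\<bar> \<le> (\<kappa> + 1) * q" if "t \<in> {0..1}" for t
  proof -
    have "\<bar>H l t\<bar> \<le> \<bar>g l t\<bar> + q" unfolding H_def Pl q_def by linarith
    also have "\<bar>g l t\<bar> \<le> \<kappa> * q" using ratio[OF that \<xi>(1)] gq by simp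
    finally show ?thesis by (simp add: algebra_simps)
  qed
  then have "\<bar>H 0 z\<bar> \<le> (\<kappa> + 1) * q" using bd z by blast
  also have "\<dots> \<le> (\<kappa> + 1) * (fact l * (Suc l * (\<epsilon> / h ^ l)))"
    using q \<open>0 \<le> \<kappa>\<close> by (intro mult_left_mono) auto
  finally have "\<bar>H 0 z\<bar> \<le> (\<kappa> + 1) * (fact l * (Suc l * (\<epsilon> / h ^ l)))" .
  moreover have "\<bar>g 0 z\<bar> \<le> \<bar>H 0 z\<bar> + \<bar>poly P z\<bar>" unfolding H_def by simp
  moreover have "(1 + (\<kappa> + 1) * fact l) * (Suc l * (\<epsilon> / h ^ l)) =
      Suc l * (\<epsilon> / h ^ l) + (\<kappa> + 1) * (fact l * (Suc l * (\<epsilon> / h ^ l)))"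
    by (simp only: distrib_right mult_1 mult.assoc)
  ultimately show ?thesis using P(4)[OF z] by linarith
qed

text \<open>Greedy choice: intervals of length \<open>2 * h\<close> around the points chosen so far
  have total measure below that of \<open>E\<close>, so a further point remains.\<close>

lemma spread_points:
  fixes E :: "real set"
  assumes E: "E \<in> lmeasurable" and h: "0 < h"
  shows "real n * (2 * h) < vol E \<Longrightarrow>
    \<exists>X\<subseteq>E. finite X \<and> card X = Suc n \<and> (\<forall>x\<in>X. \<forall>y\<in>X. x \<noteq> y \<longrightarrow> h \<le> \<bar>x - y\<bar>)"
proof (induction n)
  case 0
  then have "E \<noteq> {}" by auto
  then obtain x where "x \<in> E" by blast
  then show ?case by (intro exI[of _ "{x}"]) auto
next
  case (Suc n)
  have "real n * (2 * h) \<le> real (Suc n) * (2 * h)" using h by (intro mult_right_mono) auto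
  with Suc obtain X where X: "X \<subseteq> E" "finite X" "card X = Suc n"
    "\<forall>x\<in>X. \<forall>y\<in>X. x \<noteq> y \<longrightarrow> h \<le> \<bar>x - y\<bar>" by fastforce
  have "\<not> E \<subseteq> (\<Union>x\<in>X. ball x h)"
  proof
    assume sub: "E \<subseteq> (\<Union>x\<in>X. ball x h)"
    have "vol E \<le> vol (\<Union>x\<in>X. ball x h)"
      using E X(2) by (intro measure_mono_fmeasurable[OF sub] fmeasurable.finite_UN) auto
    also have "\<dots> \<le> (\<Sum>x\<in>X. vol (ball x h))"
      using X by (intro measure_UNION_le) auto
    also have "\<dots> = real (Suc n) * (2 * h)"
      using X h by (simp add: ball_eq_greaterThanLessThan)
    finally show False using Suc.prems by simp
  qed
  then obtain y where "y \<in> E" "y \<notin> (\<Union>x\<in>X. ball x h)" by blast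
  then have y: "y \<in> E" "\<forall>x\<in>X. h \<le> \<bar>x - y\<bar>" by (auto simp: dist_real_def not_less)
  then have "y \<notin> X" using h by force
  then show ?case using X y
    by (intro exI[of _ "insert y X"]) (auto simp: abs_minus_commute)
qed

lemma sublevel_Icc_lmeasurable:
  fixes g :: "real \<Rightarrow> real"
  assumes "continuous_on {0..1} g"
  shows "{t \<in> {0..1}. \<bar>g t\<bar> < \<epsilon>} \<in> lmeasurable"
proof -
  have "continuous_on {0..1} (\<lambda>t. \<bar>g t\<bar>)" using assms by (intro continuous_intros)
  then have "openin (top_of_set {0..1}) ({0..1} \<inter> (\<lambda>t. \<bar>g t\<bar>) -` {..<\<epsilon>})"
    by (intro continuous_openin_preimage_gen) auto
  moreover have "{0..1} \<inter> (\<lambda>t. \<bar>g t\<bar>) -` {..<\<epsilon>} = {t \<in> {0..1}. \<bar>g t\<bar> < \<epsilon>}" by auto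
  ultimately obtain W where "open W" "{t \<in> {0..1}. \<bar>g t\<bar> < \<epsilon>} = {0..1} \<inter> W" by (auto simp: openin_open)
  then show ?thesis
    by (metis (no_types, lifting) fmeasurable_Int_fmeasurable lborelD borel_open lmeasurable_interval(1) sets_completionI_sets)
qed

text \<open>A sublevel set of measure \<open>m\<close> contains \<open>l + 1\<close> points whose
  mutual distances are at least a constant times \<open>m\<close>, so \<open>g 0\<close> is at most
  a constant times \<open>\<epsilon> / m ^ l\<close>. The order \<open>l\<close> varies with the
  function; as \<open>m \<le> 1\<close>, it can be replaced by the common bound
  \<open>L\<close>.\<close>

lemma segment_sublevel:
  fixes g :: "nat \<Rightarrow> real \<Rightarrow> real"
  assumes D: "\<And>j t. j \<le> l \<Longrightarrow> t \<in> {0..1} \<Longrightarrow> (g j has_real_derivative g (Suc j) t) (at t)"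
    and ratio: "\<And>t t'. t \<in> {0..1} \<Longrightarrow> t' \<in> {0..1} \<Longrightarrow> \<bar>g l t\<bar> \<le> \<kappa> * \<bar>g l t'\<bar>" and "0 \<le> \<kappa>"
    and L: "l \<le> L" "1 \<le> L" and "0 < \<epsilon>" and z: "z \<in> {0..1}"
  shows "vol {t \<in> {0..1}. \<bar>g 0 t\<bar> < \<epsilon>} ^ L * \<bar>g 0 z\<bar>
    \<le> (1 + (\<kappa> + 1) * fact L) * real (Suc L) * (2 * real (Suc L)) ^ L * \<epsilon>"
proof -
  define E where "E = {t \<in> {0..1}. \<bar>g 0 t\<bar> < \<epsilon>}"
  have "continuous_on {0..1} (g 0)"
    using D[of 0] DERIV_isCont by (intro continuous_at_imp_continuous_on ballI) blast
  then have E: "E \<in> lmeasurable" unfolding E_def by (rule sublevel_Icc_lmeasurable)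
  define m where "m = vol E"
  have "m \<le> vol {0..1::real}"
    unfolding m_def using E by (intro measure_mono_fmeasurable) (auto simp: E_def)
  then have m1: "m \<le> 1" by simp
  have m0: "0 \<le> m" unfolding m_def by simp
  show ?thesis
  proof (cases "m = 0")
    case True
    then show ?thesis using L \<open>0 \<le> \<kappa>\<close> \<open>0 < \<epsilon>\<close> unfolding m_def E_def by (auto simp: power_0_left)
  next
    case False
    define h where "h = m / (2 * Suc l)"
    have h: "0 < h" using False m0 unfolding h_def by simp
    have "real l * (2 * h) < m" using False m0 unfolding h_def by (simp add: field_simps)
    then obtain X where X: "X \<subseteq> E" "finite X" "card X = Suc l"
      "\<forall>x\<in>X. \<forall>y\<in>X. x \<noteq> y \<longrightarrow> h \<le> \<bar>x - y\<bar>"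
      using spread_points[OF E h] unfolding m_def by blast
    have "\<bar>g 0 z\<bar> \<le> (1 + (\<kappa> + 1) * fact l) * (Suc l * (\<epsilon> / h ^ l))"
    proof (rule bound_from_spread_points[where g = g and l = l and \<kappa> = \<kappa> and X = X and h = h])
      show "X \<subseteq> {0..1}" using X(1) unfolding E_def by auto
      show "\<bar>g 0 x\<bar> \<le> \<epsilon>" if "x \<in> X" for x using X(1) that unfolding E_def by force
    qed (use D ratio \<open>0 \<le> \<kappa>\<close> X h z in auto)
    then have "m ^ l * \<bar>g 0 z\<bar> \<le> m ^ l * ((1 + (\<kappa> + 1) * fact l) * (Suc l * (\<epsilon> / h ^ l)))"
      using m0 by (intro mult_left_mono) auto
    also have "\<dots> = (1 + (\<kappa> + 1) * fact l) * real (Suc l) * (2 * real (Suc l)) ^ l * \<epsilon>"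
      using False unfolding h_def by (simp add: power_divide)
    also have "\<dots> \<le> (1 + (\<kappa> + 1) * fact L) * real (Suc L) * (2 * real (Suc L)) ^ L * \<epsilon>"
    proof -
      have "(2 * Suc l) ^ l \<le> (2 * Suc L) ^ L"
        using L by (intro order_trans[OF power_mono[of "2 * Suc l" "2 * Suc L"] power_increasing]) auto
      then have "real ((2 * Suc l) ^ l) \<le> real ((2 * Suc L) ^ L)" by (simp only: of_nat_le_iff)
      then have 1: "(2 * real (Suc l)) ^ l \<le> (2 * real (Suc L)) ^ L" by simp
      have "(fact l :: real) \<le> fact L" using L by (intro fact_mono)
      then show ?thesis
        using 1 L \<open>0 \<le> \<kappa>\<close> \<open>0 < \<epsilon>\<close> by (intro mult_mono add_mono mult_left_mono) auto
    qed
    finally have "m ^ l * \<bar>g 0 z\<bar> \<le> (1 + (\<kappa> + 1) * fact L) * real (Suc L) * (2 * real (Suc L)) ^ L * \<epsilon>" .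
    moreover have "m ^ L * \<bar>g 0 z\<bar> \<le> m ^ l * \<bar>g 0 z\<bar>"
      using L m0 m1 by (intro mult_right_mono power_decreasing) auto
    ultimately show ?thesis unfolding m_def E_def by linarith
  qed
qed

section \<open>From segments in a cone to balls\<close>

text \<open>Integrate the indicator function of \<open>q + t (x - q) \<in> E\<close> over \<open>(t, x)\<close> in both orders.\<close>

lemma sublevel_by_dilations:
  fixes E Q :: "'a::euclidean_space set" and q :: 'a
  assumes "open E" "bounded E" "Q \<in> lmeasurable" "0 \<le> \<beta>"
    and \<beta>: "\<And>x. x \<in> Q \<Longrightarrow> vol {t \<in> {1/2..1}. q + t *\<^sub>R (x - q) \<in> E} \<le> \<beta>"
    and Q: "\<And>x t. t \<in> {1/2..1} \<Longrightarrow> q + t *\<^sub>R (x - q) \<in> E \<Longrightarrow> x \<in> Q"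
  shows "vol E \<le> 2 * \<beta> * vol Q"
proof -
  define A where "A = {p :: real \<times> 'a. fst p \<in> {1/2..1} \<and> q + fst p *\<^sub>R (snd p - q) \<in> E}"
  have "A = (fst -` {1/2..1}) \<inter> (\<lambda>p. q + fst p *\<^sub>R (snd p - q)) -` E"
    unfolding A_def by auto
  moreover have "closed (fst -` {1/2..1::real} :: (real \<times> 'a) set)"
    by (intro continuous_closed_vimage) auto
  moreover have "open ((\<lambda>p::real \<times> 'a. q + fst p *\<^sub>R (snd p - q)) -` E)"
    using \<open>open E\<close> by (intro open_vimage continuous_intros)
  ultimately have "A \<in> sets borel" by auto
  then have A: "A \<in> sets (lborel \<Otimes>\<^sub>M lborel)" using lborel_prod by (metis sets_lborel)
  have meas: "(\<lambda>(t, x). indicator A (t, x) :: ennreal) \<in> borel_measurable (lborel \<Otimes>\<^sub>M lborel)"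
    using A by (simp add: case_prod_beta')
  let ?F = "\<lambda>t x. indicator A (t, x) :: ennreal"
  have fub: "(\<integral>\<^sup>+x. (\<integral>\<^sup>+t. ?F t x \<partial>lborel) \<partial>lborel) = (\<integral>\<^sup>+t. (\<integral>\<^sup>+x. ?F t x \<partial>lborel) \<partial>lborel)"
    by (rule lborel_pair.Fubini'[OF meas])
  have Eb: "E \<in> sets borel" using \<open>open E\<close> by simp
  \<comment> \<open>The slice at \<open>t\<close> is \<open>E\<close> dilated about \<open>q\<close>
    by \<open>1 / t \<ge> 1\<close>, so its volume is at least that of \<open>E\<close>. The length
    1/2 of the range of \<open>t\<close> then causes the factor 2.\<close>
  have inner1: "emeasure lborel E * indicator {1/2..1} t \<le> (\<integral>\<^sup>+x. ?F t x \<partial>lborel)" for t :: real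
  proof (cases "t \<in> {1/2..1}")
    case True
    let ?S = "(\<lambda>x. q + t *\<^sub>R (x - q)) -` E"
    have S: "?S \<in> sets borel" using \<open>open E\<close> by (intro borel_open open_vimage continuous_intros)
    have im: "E = (\<lambda>x. t *\<^sub>R x + (q - t *\<^sub>R q)) ` ?S"
    proof
      show "E \<subseteq> (\<lambda>x. t *\<^sub>R x + (q - t *\<^sub>R q)) ` ?S"
      proof
        fix y assume y: "y \<in> E"
        let ?x = "q + (1/t) *\<^sub>R (y - q)"
        have "t \<noteq> 0" using True by auto
        then have "y = t *\<^sub>R ?x + (q - t *\<^sub>R q)" "?x \<in> ?S" using y by (auto simp: algebra_simps)
        then show "y \<in> (\<lambda>x. t *\<^sub>R x + (q - t *\<^sub>R q)) ` ?S" by blast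
      qed
    qed (auto simp: algebra_simps)
    have "emeasure lborel E = emeasure lebesgue E" using Eb by simp
    also have "\<dots> = ennreal (\<bar>t\<bar> ^ DIM('a)) * emeasure lebesgue ?S"
      by (subst im, subst emeasure_lebesgue_affine) (auto simp: ennreal_power)
    also have "\<dots> \<le> 1 * emeasure lebesgue ?S"
      using True by (intro mult_right_mono) (auto intro!: power_le_one simp: ennreal_le_1)
    also have "\<dots> = emeasure lborel ?S" using S by simp
    also have "\<dots> = (\<integral>\<^sup>+x. indicator ?S x \<partial>lborel)" using S by simp
    also have "\<dots> = (\<integral>\<^sup>+x. ?F t x \<partial>lborel)"
      using True by (intro nn_integral_cong) (auto simp: A_def indicator_def)
    finally show ?thesis using True by simp
  qed auto
  have inner2: "(\<integral>\<^sup>+t. ?F t x \<partial>lborel) \<le> ennreal \<beta> * indicator Q x" for x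
  proof -
    let ?T = "{t \<in> {1/2..1}. q + t *\<^sub>R (x - q) \<in> E}"
    have T: "?T = {1/2..1} \<inter> (\<lambda>t. q + t *\<^sub>R (x - q)) -` E" by auto
    have Tb: "?T \<in> sets borel"
      unfolding T using \<open>open E\<close>
      by (intro sets.Int borel_closed borel_open open_vimage continuous_intros) auto
    have Tl: "?T \<in> lmeasurable"
      using Tb by (intro bounded_set_imp_lmeasurable) (auto intro: bounded_subset[of "{1/2..1}"])
    have "(\<integral>\<^sup>+t. ?F t x \<partial>lborel) = (\<integral>\<^sup>+t. indicator ?T t \<partial>lborel)"
      by (intro nn_integral_cong) (auto simp: A_def indicator_def)
    also have "\<dots> = emeasure lebesgue ?T" using Tb by simp
    also have "\<dots> = ennreal (vol ?T)" using Tl by (simp add: emeasure_eq_measure2)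
    also have "\<dots> \<le> ennreal \<beta> * indicator Q x"
    proof (cases "x \<in> Q")
      case True
      then show ?thesis using \<beta>[OF True] \<open>0 \<le> \<beta>\<close> by (simp add: ennreal_leI)
    next
      case False
      then have "?T = {}" using Q by blast
      then show ?thesis by (simp only: measure_empty) simp
    qed
    finally show ?thesis .
  qed
  have "ennreal (1/2) * emeasure lborel E = (\<integral>\<^sup>+t. emeasure lborel E * indicator {1/2..1::real} t \<partial>lborel)"
    by (simp add: nn_integral_cmult mult.commute)
  also have "\<dots> \<le> (\<integral>\<^sup>+t. (\<integral>\<^sup>+x. ?F t x \<partial>lborel) \<partial>lborel)" by (intro nn_integral_mono inner1)
  also have "\<dots> = (\<integral>\<^sup>+x. (\<integral>\<^sup>+t. ?F t x \<partial>lborel) \<partial>lborel)" by (rule fub[symmetric])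
  \<comment> \<open>\<open>Q\<close> is merely Lebesgue measurable, hence the passage to the
    completed measure.\<close>
  also have "\<dots> \<le> (\<integral>\<^sup>+x. ennreal \<beta> * indicator Q x \<partial>lebesgue)"
  proof -
    have "(\<integral>\<^sup>+x. (\<integral>\<^sup>+t. ?F t x \<partial>lborel) \<partial>lborel) = (\<integral>\<^sup>+x. (\<integral>\<^sup>+t. ?F t x \<partial>lborel) \<partial>lebesgue)"
      by (rule nn_integral_completion[symmetric])
    also have "\<dots> \<le> (\<integral>\<^sup>+x. ennreal \<beta> * indicator Q x \<partial>lebesgue)"
      by (intro nn_integral_mono inner2)
    finally show ?thesis .
  qed
  also have "\<dots> = ennreal \<beta> * emeasure lebesgue Q"
    using \<open>Q \<in> lmeasurable\<close> by (simp add: nn_integral_cmult fmeasurableD)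
  finally have main: "ennreal (1/2) * emeasure lebesgue E \<le> ennreal \<beta> * emeasure lebesgue Q"
    using Eb by simp
  have El: "E \<in> lmeasurable" using \<open>open E\<close> \<open>bounded E\<close> by (rule lmeasurable_open[rotated])
  have "ennreal (1/2 * vol E) \<le> ennreal (\<beta> * vol Q)"
  proof -
    have "ennreal (1/2 * vol E) = ennreal (1/2) * emeasure lebesgue E"
      using El by (subst ennreal_mult) (auto simp: emeasure_eq_measure2)
    moreover have "ennreal (\<beta> * vol Q) = ennreal \<beta> * emeasure lebesgue Q"
      using \<open>Q \<in> lmeasurable\<close> \<open>0 \<le> \<beta>\<close> by (subst ennreal_mult) (auto simp: emeasure_eq_measure2)
    ultimately show ?thesis using main by simp
  qed
  then have "1/2 * vol E \<le> \<beta> * vol Q"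
    using \<open>0 \<le> \<beta>\<close> by (subst (asm) ennreal_le_iff) auto
  then show ?thesis by simp
qed

text \<open>The hypothesis is an estimate along segments whose direction is close to the line through \<open>u\<close>. Starting
  from \<open>z\<close>, move far in the direction \<open>u\<close> to a point \<open>q\<close> where \<open>f\<close> is still large; from there the
  whole ball is seen under directions close to \<open>u\<close>, and averaging over dilations about \<open>q\<close>
  applies.\<close>

lemma cone_sublevel:
  fixes f :: "'a::euclidean_space \<Rightarrow> real"
  assumes cont: "continuous_on (ball x0 R) f"
    and seg: "\<And>z k \<omega> \<epsilon>. z \<in> ball x0 R \<Longrightarrow> z + k *\<^sub>R \<omega> \<in> ball x0 R \<Longrightarrow> \<omega> \<in> ball u \<eta> \<Longrightarrow> 0 < \<epsilon> \<Longrightarrow>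
       vol {t \<in> {0..1}. \<bar>f (z + t *\<^sub>R (k *\<^sub>R \<omega>))\<bar> < \<epsilon>} ^ L * \<bar>f z\<bar> \<le> K * \<epsilon>"
    and u: "norm u \<le> 1" and \<eta>: "0 < \<eta>" "\<eta> \<le> 1" and L: "1 \<le> L" and K: "0 < K"
    and B: "ball c (20 / \<eta> * r) \<subseteq> ball x0 R" and z: "z \<in> ball c r" and \<epsilon>: "0 < \<epsilon>"
  shows "vol {x \<in> ball c r. \<bar>f x\<bar> < \<epsilon>} * \<bar>f z\<bar> powr (1 / L)
     \<le> (2 * (12 / \<eta>) ^ DIM('a) * (K * K * 5 ^ L) powr (1 / L)) * \<epsilon> powr (1 / L) * vol (ball c r)"
proof (cases "f z = 0")
  case True
  then show ?thesis using \<eta> by simp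
next
  case False
  define s where "s = \<bar>f z\<bar>"
  have s: "0 < s" using False unfolding s_def by simp
  have r: "0 < r" using z zero_le_dist[of c z] unfolding mem_ball by linarith
  \<comment> \<open>The scale of the apex: from a parameter of at least \<open>3 * rr\<close> along
    \<open>u\<close>, a displacement below \<open>2 * r\<close> changes the direction by less than
    \<eta>.\<close>
  define rr where "rr = r / \<eta>"
  have rr: "0 < rr" "rr * \<eta> = r" using r \<eta> unfolding rr_def by auto
  have r\<eta>: "r \<le> rr" using r \<eta> unfolding rr_def by (simp add: field_simps)
  \<comment> \<open>All points used are within \<open>12 * rr + 4 * rr + r\<close>, at most
    \<open>17 * rr\<close>, of \<open>c\<close>.\<close>
  have Bsub: "y \<in> ball x0 R" if "norm (y - c) < 20 * rr" for y
    using B that unfolding rr_def by (auto simp: subset_iff dist_norm norm_minus_commute)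
  have zc: "norm (z - c) < r" using z by (simp add: dist_norm norm_minus_commute)
  define v where "v = (4 * rr) *\<^sub>R u"
  have nv: "norm v \<le> 4 * rr"
    using mult_left_mono[OF u, of "4 * rr"] rr unfolding v_def norm_scaleR by simp
  \<comment> \<open>If \<open>f\<close> were below \<open>\<delta> * s\<close> on the last quarter
    of the segment, the hypothesis would give \<open>(1/4) ^ L \<le> (1/5) ^ L\<close>.\<close>
  define \<delta> where "\<delta> = (1/5) ^ L / K"
  have \<delta>: "0 < \<delta>" unfolding \<delta>_def using K by simp
  have zB: "z \<in> ball x0 R" using Bsub[of z] zc r\<eta> r by simp
  have zvB: "z + v \<in> ball x0 R"
    using Bsub[of "z + v"] norm_triangle_ineq[of "z - c" v] zc nv r\<eta> r by (simp add: algebra_simps)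
  have uball: "u \<in> ball u \<eta>" using \<eta> by simp
  have "\<exists>t0\<in>{3/4..1}. \<delta> * s \<le> \<bar>f (z + t0 *\<^sub>R v)\<bar>"
  proof (rule ccontr)
    assume "\<not> (\<exists>t0\<in>{3/4..1}. \<delta> * s \<le> \<bar>f (z + t0 *\<^sub>R v)\<bar>)"
    then have small: "\<bar>f (z + t *\<^sub>R v)\<bar> < \<delta> * s" if "t \<in> {3/4..1}" for t
      using that by (meson not_le)
    let ?T = "{t \<in> {0..1}. \<bar>f (z + t *\<^sub>R v)\<bar> < \<delta> * s}"
    have "z + (4 * rr) *\<^sub>R u \<in> ball x0 R" "0 < \<delta> * s" using zvB \<delta> s unfolding v_def by auto
    from seg[OF zB this(1) uball this(2)]
    have le: "vol ?T ^ L * s \<le> K * (\<delta> * s)" unfolding v_def s_def .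
    have "continuous_on {0..1} (\<lambda>t. f (z + t *\<^sub>R v))"
    proof (rule continuous_on_compose2[OF cont])
      show "(\<lambda>t. z + t *\<^sub>R v) ` {0..1} \<subseteq> ball x0 R"
        using convexD_alt[OF convex_ball zB zvB] by (auto simp: algebra_simps)
    qed (intro continuous_intros)
    then have "?T \<in> lmeasurable" by (rule sublevel_Icc_lmeasurable)
    then have "vol {3/4..1::real} \<le> vol ?T"
      using small by (intro measure_mono_fmeasurable) auto
    then have pw: "(1/4) ^ L \<le> vol ?T ^ L" by (intro power_mono) auto
    have "K * (\<delta> * s) = (1/5) ^ L * s" unfolding \<delta>_def using K by simp
    then have "(1/4) ^ L * s \<le> (1/5) ^ L * s"
      using le mult_right_mono[OF pw, of s] s by linarith
    then have "(1/4::real) ^ L \<le> (1/5) ^ L" using s by simp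
    moreover have "(1/5::real) ^ L < (1/4) ^ L" using L by (intro power_strict_mono) auto
    ultimately show False by simp
  qed
  then obtain t0 where t0: "t0 \<in> {3/4..1}" "\<delta> * s \<le> \<bar>f (z + t0 *\<^sub>R v)\<bar>" by blast
  define \<tau> where "\<tau> = t0 * (4 * rr)"
  define q where "q = z + \<tau> *\<^sub>R u"
  have q: "q = z + t0 *\<^sub>R v" unfolding q_def \<tau>_def v_def by simp
  have \<tau>: "3 * rr \<le> \<tau>" "\<tau> \<le> 4 * rr"
    using t0 rr unfolding \<tau>_def by (auto simp: field_simps)
  have fq: "\<delta> * s \<le> \<bar>f q\<bar>" using t0 unfolding q by simp
  have qz: "norm (q - z) \<le> 4 * rr"
  proof -
    have "norm (q - z) = \<bar>\<tau>\<bar> * norm u" unfolding q_def by simp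
    also have "\<dots> \<le> \<tau> * 1" using \<tau> rr u by (intro mult_mono) auto
    finally show ?thesis using \<tau> by simp
  qed
  have qB: "q \<in> ball x0 R"
    using Bsub[of q] norm_triangle_ineq[of "q - z" "z - c"] zc qz r\<eta> r by (simp add: algebra_simps)
  define E where "E = {x \<in> ball c r. \<bar>f x\<bar> < \<epsilon>}"
  have cB: "ball c r \<subseteq> ball x0 R"
    using Bsub r\<eta> r by (force simp: dist_norm norm_minus_commute)
  have oE: "open E" unfolding E_def by (rule open_sublevel[OF cont cB])
  \<comment> \<open>Points of \<open>E\<close> are within \<open>6 * rr\<close> of \<open>q\<close>,
    and undoing a dilation by \<open>t \<ge> 1/2\<close> at most doubles this distance.\<close>
  define Q where "Q = ball q (12 * rr)"
  have geo: "norm (y - z) < 2 * r" "norm (y - q) < 6 * rr" if "y \<in> E" for y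
  proof -
    have "norm (y - c) < r" using that unfolding E_def by (simp add: dist_norm norm_minus_commute)
    then show 1: "norm (y - z) < 2 * r"
      using zc norm_triangle_ineq4[of "y - c" "z - c"] by simp
    show "norm (y - q) < 6 * rr"
      using 1 qz r\<eta> norm_triangle_ineq4[of "y - z" "q - z"] by simp
  qed
  define \<beta> where "\<beta> = (K * \<epsilon> / (\<delta> * s)) powr (1 / L)"
  have mE: "vol E \<le> 2 * \<beta> * vol Q"
  proof (rule sublevel_by_dilations[OF oE])
    show "bounded E" unfolding E_def by (rule bounded_subset[OF bounded_ball[of c r]]) auto
    show "Q \<in> lmeasurable" unfolding Q_def by simp
    show "0 \<le> \<beta>" unfolding \<beta>_def by simp
    fix x :: 'a
    {
      fix t :: real assume t: "t \<in> {1/2..1}" and y: "q + t *\<^sub>R (x - q) \<in> E"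
      have "t * norm (x - q) < 6 * rr" using geo(2)[OF y] t by simp
      moreover have "1/2 * norm (x - q) \<le> t * norm (x - q)" using t by (intro mult_right_mono) auto
      ultimately have "norm (x - q) < 12 * rr" by simp
      then show "x \<in> Q" unfolding Q_def by (simp add: dist_norm norm_minus_commute)
    }
    assume xQ: "x \<in> Q"
    let ?T = "{t \<in> {1/2..1}. q + t *\<^sub>R (x - q) \<in> E}"
    show "vol ?T \<le> \<beta>"
    proof (cases "?T = {}")
      case True
      show ?thesis unfolding True \<beta>_def by simp
    next
      case False
      then obtain t where t: "t \<in> {1/2..1}" "q + t *\<^sub>R (x - q) \<in> E" by blast
      define y where "y = q + t *\<^sub>R (x - q)"
      \<comment> \<open>\<open>\<tau> *\<^sub>R \<omega>\<close> is the vector from \<open>y\<close>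
        to \<open>q\<close>. As \<open>x - q\<close> is a multiple of \<omega>, the segment from
        \<open>q\<close> to \<open>x\<close> has an admissible direction.\<close>
      define \<omega> where "\<omega> = u + (1 / \<tau>) *\<^sub>R (z - y)"
      have \<tau>0: "0 < \<tau>" using \<tau>(1) rr by linarith
      have "norm (z - y) < 2 * r" using geo(1)[of y] t(2) unfolding y_def by (simp add: norm_minus_commute)
      also have "2 * r \<le> \<tau> * \<eta>" using mult_right_mono[OF \<tau>(1), of \<eta>] rr r \<eta> by (simp add: mult.assoc)
      finally have "norm ((1 / \<tau>) *\<^sub>R (z - y)) < \<eta>"
        unfolding norm_scaleR using \<tau>0 by (simp add: field_simps)
      then have \<omega>: "\<omega> \<in> ball u \<eta>" unfolding \<omega>_def by (simp add: dist_norm)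
      have qy: "q - y = \<tau> *\<^sub>R \<omega>" unfolding \<omega>_def q_def using \<tau>0 by (simp add: algebra_simps)
      have "t \<noteq> 0" using t by auto
      then have "x - q = (1 / t) *\<^sub>R (y - q)" unfolding y_def by simp
      also have "y - q = - (\<tau> *\<^sub>R \<omega>)" using qy by (metis minus_diff_eq)
      finally have xq: "x - q = (- (\<tau> / t)) *\<^sub>R \<omega>" by simp
      have "norm (x - q) < 12 * rr" using xQ unfolding Q_def by (simp add: dist_norm norm_minus_commute)
      then have xB: "x \<in> ball x0 R"
        using Bsub[of x] qz zc r\<eta> rr(1) norm_triangle_ineq[of "x - q" "q - z"] norm_triangle_ineq[of "x - z" "z - c"]
        by simp
      let ?T' = "{t \<in> {0..1}. \<bar>f (q + t *\<^sub>R (x - q))\<bar> < \<epsilon>}"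
      have T': "?T' \<in> lmeasurable"
      proof -
        have "continuous_on {0..1} (\<lambda>t. f (q + t *\<^sub>R (x - q)))"
        proof (rule continuous_on_compose2[OF cont])
          show "(\<lambda>t. q + t *\<^sub>R (x - q)) ` {0..1} \<subseteq> ball x0 R"
            using convexD_alt[OF convex_ball qB xB] by (auto simp: algebra_simps)
        qed (intro continuous_intros)
        then show ?thesis by (rule sublevel_Icc_lmeasurable)
      qed
      have Tm: "?T \<in> sets lebesgue"
      proof -
        have "?T = {1/2..1} \<inter> (\<lambda>t. q + t *\<^sub>R (x - q)) -` E" by auto
        moreover have "open ((\<lambda>t. q + t *\<^sub>R (x - q)) -` E)"
          using oE by (intro open_vimage continuous_intros)
        ultimately show ?thesis by auto
      qed
      have "?T \<subseteq> ?T'" unfolding E_def by auto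
      then have mT: "vol ?T \<le> vol ?T'"
        by (rule measure_mono_fmeasurable[OF _ Tm T'])
      have "vol ?T ^ L * (\<delta> * s) \<le> vol ?T' ^ L * \<bar>f q\<bar>"
        by (rule mult_mono[OF power_mono[OF mT measure_nonneg] fq zero_le_power[OF measure_nonneg]])
          (use \<delta> s in simp)
      also have "\<dots> \<le> K * \<epsilon>"
      proof -
        have "q + (- (\<tau> / t)) *\<^sub>R \<omega> \<in> ball x0 R" unfolding xq[symmetric] using xB by simp
        from seg[OF qB this \<omega> \<epsilon>] show ?thesis unfolding xq[symmetric] .
      qed
      finally have "vol ?T ^ L \<le> K * \<epsilon> / (\<delta> * s)" using \<delta> s by (simp add: field_simps)
      then have "(vol ?T ^ L) powr (1 / L) \<le> \<beta>"
        unfolding \<beta>_def by (intro powr_mono2) auto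
      moreover have "(vol ?T ^ L) powr (1 / L) = vol ?T"
        using L by (cases "vol ?T = 0")
          (auto simp: powr_realpow[symmetric] powr_powr less_le power_0_left)
      ultimately show ?thesis by simp
    qed
  qed
  have "vol Q = (12 / \<eta>) ^ DIM('a) * vol (ball c r)"
    unfolding Q_def rr_def using measure_ball_scale[of r "12 / \<eta>" q c] r \<eta> by simp
  moreover have "\<beta> * s powr (1 / L) = (K * K * 5 ^ L) powr (1 / L) * \<epsilon> powr (1 / L)"
  proof -
    have "K * \<epsilon> / (\<delta> * s) = (K * K * 5 ^ L) * \<epsilon> / s"
      unfolding \<delta>_def using K s by (simp add: field_simps power_divide)
    then show ?thesis
      unfolding \<beta>_def using K \<epsilon> s by (simp add: powr_divide powr_mult)
  qed
  moreover have "vol E * s powr (1 / L) \<le> 2 * \<beta> * vol Q * s powr (1 / L)"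
    using mE by (intro mult_right_mono) auto
  moreover have "2 * \<beta> * vol Q * s powr (1 / L) = 2 * vol Q * (\<beta> * s powr (1 / L))"
    by (simp only: mult_ac)
  ultimately show ?thesis unfolding E_def s_def by (simp only: mult_ac)
qed

section \<open>Complex extensions of real analytic functions\<close>

definition cvec :: "real ^ 'd \<Rightarrow> complex ^ 'd" where
  "cvec x = (\<chi> i. complex_of_real (x $ i))"

lemma cvec_nth [simp]: "cvec x $ i = complex_of_real (x $ i)"
  by (simp add: cvec_def)

definition polydisc :: "real ^ 'd \<Rightarrow> real \<Rightarrow> (complex ^ 'd) set" where
  "polydisc x R = {z. \<forall>i. cmod (z $ i - complex_of_real (x $ i)) < R}"

text \<open>Holomorphy along complex lines is all that is used, and it is stable under products, which
  multivariate power series make cumbersome.\<close>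

definition complex_extension ::
  "(complex ^ 'd) set \<Rightarrow> (real ^ 'd \<Rightarrow> real) \<Rightarrow> (complex ^ 'd \<Rightarrow> complex) \<Rightarrow> bool" where
  "complex_extension S f F \<longleftrightarrow> continuous_on S F \<and>
     (\<forall>z \<omega>. (\<lambda>t. F (z + t *s \<omega>)) holomorphic_on {t. z + t *s \<omega> \<in> S}) \<and>
     (\<forall>x. cvec x \<in> S \<longrightarrow> F (cvec x) = complex_of_real (f x))"

lemma open_polydisc: "open (polydisc x R)"
proof -
  have "polydisc x R = (\<Inter>i. (\<lambda>z. cmod (z $ i - complex_of_real (x $ i))) -` {..<R})"
    unfolding polydisc_def by auto
  moreover have "open ((\<lambda>z. cmod (z $ i - complex_of_real (x $ i))) -` {..<R})" for i
    by (intro open_vimage continuous_intros open_lessThan)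
  ultimately show ?thesis by (metis (no_types, lifting) finite open_INT)
qed

lemma polydisc_mono: "R \<le> R' \<Longrightarrow> polydisc x R \<subseteq> polydisc x R'"
  unfolding polydisc_def by (auto intro: less_le_trans)

lemma cvec_in_polydisc:
  assumes "x \<in> ball x0 R"
  shows "cvec x \<in> polydisc x0 R"
proof -
  have "cmod (cvec x $ i - complex_of_real (x0 $ i)) < R" for i
  proof -
    have "cmod (cvec x $ i - complex_of_real (x0 $ i)) = \<bar>(x - x0) $ i\<bar>"
      by (simp flip: of_real_diff)
    also have "\<dots> \<le> norm (x - x0)" by (rule component_le_norm_cart)
    finally show ?thesis using assms by (simp add: dist_norm norm_minus_commute)
  qed
  then show ?thesis unfolding polydisc_def by blast
qed

lemma continuous_on_smult_line: "continuous_on A (\<lambda>t. z + t *s (\<omega> :: complex ^ 'd))"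
  unfolding vector_scalar_mult_def vec_eq_iff
  by (intro continuous_intros continuous_on_vec_lambda)

lemma open_line_preimage:
  fixes S :: "(complex ^ 'd) set"
  assumes "open S"
  shows "open {t. z + t *s \<omega> \<in> S}"
proof -
  have "open ((\<lambda>t. z + t *s \<omega>) -` S)"
    using assms by (intro open_vimage continuous_on_smult_line)
  then show ?thesis by (simp add: vimage_def)
qed

lemma complex_extension_mono:
  assumes "complex_extension S f F" "T \<subseteq> S"
  shows "complex_extension T f F"
  using assms unfolding complex_extension_def
  by (blast intro: continuous_on_subset holomorphic_on_subset)

lemma complex_extension_const: "complex_extension S (\<lambda>_. c) (\<lambda>_. complex_of_real c)"
  unfolding complex_extension_def by auto

lemma complex_extension_mult:
  assumes "complex_extension S f F" "complex_extension S g H"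
  shows "complex_extension S (\<lambda>x. f x * g x) (\<lambda>z. F z * H z)"
  using assms unfolding complex_extension_def by (auto intro!: continuous_intros holomorphic_intros)

lemma complex_extension_sum:
  assumes "\<And>i. i \<in> A \<Longrightarrow> complex_extension S (f i) (F i)"
  shows "complex_extension S (\<lambda>x. \<Sum>i\<in>A. f i x) (\<lambda>z. \<Sum>i\<in>A. F i z)"
  using assms unfolding complex_extension_def by (auto intro!: continuous_intros holomorphic_intros)

lemma complex_extension_prod:
  assumes "\<And>i. i \<in> A \<Longrightarrow> complex_extension S (f i) (F i)"
  shows "complex_extension S (\<lambda>x. \<Prod>i\<in>A. f i x) (\<lambda>z. \<Prod>i\<in>A. F i z)"
  using assms unfolding complex_extension_def by (auto intro!: continuous_intros holomorphic_intros)

lemma complex_extension_det: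
  fixes M :: "real ^ 'd \<Rightarrow> real ^ 'k ^ 'k"
  assumes "\<And>i j. \<exists>F. complex_extension S (\<lambda>x. M x $ i $ j) F"
  shows "\<exists>F. complex_extension S (\<lambda>x. det (M x)) F"
proof -
  obtain F where F: "complex_extension S (\<lambda>x. M x $ i $ j) (F i j)" for i j
    using assms by metis
  have "complex_extension S (\<lambda>x. det (M x))
     (\<lambda>z. \<Sum>p | p permutes UNIV. complex_of_real (of_int (sign p)) * (\<Prod>i\<in>UNIV. F i (p i) z))"
    unfolding det_def
    by (intro complex_extension_sum complex_extension_mult complex_extension_const complex_extension_prod F)
  then show ?thesis by blast
qed

text \<open>Convergence at the real corner \<open>x0 + (R, ..., R)\<close> is absolute and dominates
  the power series on the whole complex polydisc of radius \<open>R\<close>. The uniform limit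
  inherits continuity and, on complex lines, holomorphy.\<close>

lemma real_analytic_complex_extension:
  fixes f :: "real ^ 'd \<Rightarrow> real"
  assumes "real_analytic_on f U" "x0 \<in> U"
  shows "\<exists>R>0. \<exists>F. complex_extension (polydisc x0 R) f F"
proof -
  obtain c r where r: "r > 0"
    and hs: "\<And>y. y \<in> ball x0 r \<Longrightarrow>
        ((\<lambda>m. c m * (\<Prod>i\<in>UNIV. (y $ i - x0 $ i) ^ m i)) has_sum f y) UNIV"
    using assms unfolding real_analytic_on_def by blast
  \<comment> \<open>In a cube of half side \<open>R\<close> the l1-distance to \<open>x0\<close> is
    at most \<open>r / 2\<close>, so the cube lies in the ball of convergence.\<close>
  define R where "R = r / (2 * real CARD('d))"
  have R: "R > 0" using r unfolding R_def by simp
  have small: "y \<in> ball x0 r" if "\<And>i. \<bar>y $ i - x0 $ i\<bar> \<le> R" for y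
  proof -
    have "norm (y - x0) \<le> (\<Sum>i\<in>UNIV. \<bar>(y - x0) $ i\<bar>)" by (rule norm_le_l1_cart)
    also have "\<dots> \<le> (\<Sum>i\<in>(UNIV :: 'd set). R)" using that by (intro sum_mono) simp
    also have "\<dots> = r / 2" unfolding R_def by simp
    finally show ?thesis using r by (simp add: dist_norm norm_minus_commute)
  qed
  define M where "M m = \<bar>c m\<bar> * (\<Prod>i\<in>UNIV. R ^ m i)" for m :: "'d \<Rightarrow> nat"
  have "(\<lambda>m. c m * (\<Prod>i\<in>UNIV. R ^ m i)) summable_on UNIV"
    using hs[OF small[of "\<chi> i. x0 $ i + R"]] R by (auto simp: summable_on_def)
  then have "(\<lambda>m. norm (c m * (\<Prod>i\<in>UNIV. R ^ m i))) summable_on UNIV"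
    by (subst (asm) summable_on_iff_abs_summable_on_real)
  then have M: "M summable_on UNIV"
    unfolding M_def using R by (simp add: abs_mult abs_prod power_abs)
  define a where "a m z = complex_of_real (c m) * (\<Prod>i\<in>UNIV. (z $ i - complex_of_real (x0 $ i)) ^ m i)"
    for m and z :: "complex ^ 'd"
  define F where "F z = (\<Sum>\<^sub>\<infinity>m. a m z)" for z
  let ?S = "polydisc x0 R"
  have ul: "uniform_limit ?S (\<lambda>X z. \<Sum>m\<in>X. a m z) F (finite_subsets_at_top UNIV)"
    unfolding F_def
  proof (rule Weierstrass_m_test_general[OF _ M])
    fix m z assume z: "z \<in> ?S"
    show "norm (a m z) \<le> M m"
      unfolding a_def M_def norm_mult norm_of_real prod_norm[symmetric] norm_power
      using z unfolding polydisc_def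
      by (intro mult_left_mono prod_mono) (auto intro!: power_mono intro: less_imp_le)
  qed
  have acont: "continuous_on A (a m)" for A m unfolding a_def by (intro continuous_intros)
  have "continuous_on ?S F"
    by (rule uniform_limit_theorem[OF _ ul]) (auto intro!: always_eventually continuous_intros acont)
  moreover have "(\<lambda>t. F (z + t *s \<omega>)) holomorphic_on {t. z + t *s \<omega> \<in> ?S}" for z \<omega>
  proof -
    let ?T = "{t. z + t *s \<omega> \<in> ?S}"
    have oT: "open ?T" by (rule open_line_preimage[OF open_polydisc])
    have "(\<lambda>t. F (z + t *s \<omega>)) field_differentiable at t0" if t0: "t0 \<in> ?T" for t0
    proof -
      obtain e where e: "e > 0" "cball t0 e \<subseteq> ?T" using oT t0 open_contains_cball by blast
      have ul': "uniform_limit (cball t0 e) (\<lambda>X t. \<Sum>m\<in>X. a m (z + t *s \<omega>)) (\<lambda>t. F (z + t *s \<omega>))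
          (finite_subsets_at_top UNIV)"
        by (rule uniform_limit_compose'[OF ul]) (use e in auto)
      have ah: "(\<lambda>t. a m (z + t *s \<omega>)) holomorphic_on A" for A m
        unfolding a_def by (auto intro!: holomorphic_intros)
      obtain "(\<lambda>t. F (z + t *s \<omega>)) holomorphic_on ball t0 e"
        by (rule holomorphic_uniform_limit[OF _ ul'])
          (auto intro!: always_eventually holomorphic_intros ah holomorphic_on_imp_continuous_on)
      then show ?thesis using e(1) holomorphic_on_imp_differentiable_at[of _ "ball t0 e" t0] by auto
    qed
    then show ?thesis using oT by (auto simp: holomorphic_on_def intro: field_differentiable_at_within)
  qed
  moreover have "F (cvec x) = complex_of_real (f x)" if x: "cvec x \<in> ?S" for x
  proof -
    have "\<bar>x $ i - x0 $ i\<bar> \<le> R" for i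
      using x unfolding polydisc_def by (auto simp flip: of_real_diff intro: less_imp_le)
    from hs[OF small[OF this]]
    have "((\<lambda>m. complex_of_real (c m * (\<Prod>i\<in>UNIV. (x $ i - x0 $ i) ^ m i))) has_sum complex_of_real (f x)) UNIV"
      by (subst has_sum_of_real_iff)
    then show ?thesis unfolding F_def a_def by (intro infsumI) simp
  qed
  ultimately show ?thesis using R unfolding complex_extension_def by blast
qed

section \<open>Directional derivatives\<close>

text \<open>If \<open>F\<close> extends \<open>f\<close> near \<open>x\<close>, this is the
  \<open>j\<close>-th derivative of \<open>f (x + t *\<^sub>R v)\<close> in \<open>t\<close> at 0.
  Going through the complex function provides derivatives of all orders, continuous in
  \<open>x\<close> and \<open>v\<close>.\<close>

definition lderiv :: "(complex ^ 'd \<Rightarrow> complex) \<Rightarrow> nat \<Rightarrow> real ^ 'd \<Rightarrow> real ^ 'd \<Rightarrow> real" where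
  "lderiv F j x v = Re ((deriv ^^ j) (\<lambda>t. F (cvec x + t *s cvec v)) 0)"

lemma cvec_add_scale: "cvec (x + t *\<^sub>R v) = cvec x + complex_of_real t *s cvec v"
  by (simp add: vec_eq_iff)

lemma complex_extension_line:
  assumes "complex_extension S f F" "open S"
  shows "(\<lambda>t. F (cvec x + t *s cvec v)) holomorphic_on {t. cvec x + t *s cvec v \<in> S}"
    "open {t. cvec x + t *s cvec v \<in> S}"
  using assms open_line_preimage unfolding complex_extension_def by blast+

lemma lderiv_0:
  assumes "complex_extension S f F" "cvec x \<in> S"
  shows "lderiv F 0 x v = f x"
  using assms unfolding lderiv_def complex_extension_def by simp

text \<open>Moving the base point along the line translates one and the same holomorphic function;
  this is what makes the \<open>lderiv F j\<close> successive derivatives along a segment.\<close>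

lemma lderiv_shift:
  assumes ext: "complex_extension S f F" and S: "open S" and t: "cvec (x + t *\<^sub>R v) \<in> S"
  shows "lderiv F j (x + t *\<^sub>R v) v = Re ((deriv ^^ j) (\<lambda>s. F (cvec x + s *s cvec v)) (complex_of_real t))"
proof -
  let ?g = "\<lambda>s. F (cvec x + s *s cvec v)"
  let ?T = "{s. cvec x + s *s cvec v \<in> S}"
  note T = complex_extension_line[OF ext S, of x v]
  have "(deriv ^^ j) (\<lambda>s. ?g (1 * s + complex_of_real t)) 0 = 1 ^ j * (deriv ^^ j) ?g (1 * 0 + complex_of_real t)"
  proof (rule higher_deriv_compose_linear'[OF T(1) _ T(2)])
    show "open {s. cvec (x + t *\<^sub>R v) + s *s cvec v \<in> S}" by (rule complex_extension_line[OF ext S])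
    show "0 \<in> {s. cvec (x + t *\<^sub>R v) + s *s cvec v \<in> S}" using t by simp
  qed (simp add: cvec_add_scale algebra_simps vector_sadd_rdistrib)
  then show ?thesis
    unfolding lderiv_def by (simp add: cvec_add_scale algebra_simps vector_sadd_rdistrib)
qed

lemma lderiv_has_derivative:
  assumes ext: "complex_extension S f F" and S: "open S" and t: "cvec (x + t *\<^sub>R v) \<in> S"
  shows "((\<lambda>s. lderiv F j (x + s *\<^sub>R v) v) has_real_derivative lderiv F (Suc j) (x + t *\<^sub>R v) v) (at t)"
proof -
  let ?g = "\<lambda>s. F (cvec x + s *s cvec v)"
  let ?T = "{s. cvec x + s *s cvec v \<in> S}"
  note T = complex_extension_line[OF ext S, of x v]
  have tT: "complex_of_real t \<in> ?T" using t by (simp add: cvec_add_scale)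
  have "((deriv ^^ j) ?g has_field_derivative (deriv ^^ Suc j) ?g (complex_of_real t)) (at (complex_of_real t))"
    using holomorphic_derivI[OF holomorphic_higher_deriv[OF T] T(2) tT] by simp
  then have "((\<lambda>s. (deriv ^^ j) ?g (complex_of_real s)) has_vector_derivative (deriv ^^ Suc j) ?g (complex_of_real t)) (at t)"
    by (rule has_vector_derivative_real_field)
  then have "((\<lambda>s. Re ((deriv ^^ j) ?g (complex_of_real s))) has_vector_derivative Re ((deriv ^^ Suc j) ?g (complex_of_real t))) (at t)"
    by (rule bounded_linear.has_vector_derivative[OF bounded_linear_Re])
  then have "((\<lambda>s. Re ((deriv ^^ j) ?g (complex_of_real s))) has_real_derivative lderiv F (Suc j) (x + t *\<^sub>R v) v) (at t)"
    unfolding has_real_derivative_iff_has_vector_derivative lderiv_shift[OF ext S t] .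
  moreover have "open (complex_of_real -` ?T)"
    using T(2) by (intro open_vimage continuous_intros)
  moreover have "t \<in> complex_of_real -` ?T" using tT by simp
  moreover have "Re ((deriv ^^ j) ?g (complex_of_real s)) = lderiv F j (x + s *\<^sub>R v) v"
    if "s \<in> complex_of_real -` ?T" for s
    using that by (intro lderiv_shift[OF ext S, symmetric]) (simp add: cvec_add_scale)
  ultimately show ?thesis
    by (rule has_field_derivative_transform_within_open)
qed

text \<open>Homogeneity reduces segments of any length to directions near \<open>u\<close>: the
  common factor \<open>k ^ j\<close> does not affect the ratio condition.\<close>

lemma lderiv_scale:
  assumes ext: "complex_extension S f F" and S: "open S" and x: "cvec x \<in> S"
  shows "lderiv F j x (k *\<^sub>R v) = k ^ j * lderiv F j x v"
proof -
  let ?g = "\<lambda>s. F (cvec x + s *s cvec v)"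
  note T = complex_extension_line[OF ext S, of x v]
  have eq: "t *s cvec (k *\<^sub>R v) = (complex_of_real k * t) *s cvec v" for t by (simp add: vec_eq_iff)
  have "(deriv ^^ j) (\<lambda>s. ?g (complex_of_real k * s)) 0 = complex_of_real k ^ j * (deriv ^^ j) ?g (complex_of_real k * 0)"
  proof (rule higher_deriv_compose_linear[OF T(1) _ T(2)])
    show "open {s. cvec x + s *s cvec (k *\<^sub>R v) \<in> S}" by (rule complex_extension_line[OF ext S])
    show "0 \<in> {s. cvec x + s *s cvec (k *\<^sub>R v) \<in> S}" using x by simp
  qed (simp add: eq)
  then show ?thesis
    unfolding lderiv_def by (simp add: eq flip: of_real_power)
qed

lemma polydisc_line:
  assumes "norm (x - x0) + cmod t * norm v < R"
  shows "cvec x + t *s cvec v \<in> polydisc x0 R"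
proof -
  have "cmod ((cvec x + t *s cvec v) $ i - complex_of_real (x0 $ i)) < R" for i
  proof -
    have "(cvec x + t *s cvec v) $ i - complex_of_real (x0 $ i) = complex_of_real ((x - x0) $ i) + t * complex_of_real (v $ i)"
      by simp
    also have "cmod \<dots> \<le> \<bar>(x - x0) $ i\<bar> + cmod t * \<bar>v $ i\<bar>"
      by (rule order_trans[OF norm_triangle_ineq]) (simp only: norm_of_real norm_mult order_refl)
    also have "\<dots> \<le> norm (x - x0) + cmod t * norm v"
      by (intro add_mono mult_left_mono component_le_norm_cart) auto
    finally show ?thesis using assms by simp
  qed
  then show ?thesis unfolding polydisc_def by blast
qed

text \<open>Taylor series at 0 of \<open>F\<close> on the complex line through \<open>x0\<close> and
  \<open>y\<close>, evaluated at 1; the polydisc contains a disc of radius above 1 in that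
  line.\<close>

lemma lderiv_series:
  assumes ext: "complex_extension (polydisc x0 R) f F" and y: "y \<in> ball x0 R"
  shows "(\<lambda>j. lderiv F j x0 (y - x0) / fact j) sums f y"
proof -
  define v where "v = y - x0"
  have nv: "norm v < R" using y unfolding v_def by (simp add: dist_norm norm_minus_commute)
  then have R: "0 < R" using norm_ge_zero[of v] by linarith
  \<comment> \<open>The maximum with \<open>R / 2\<close> avoids a division by zero for
    \<open>y = x0\<close>.\<close>
  define m where "m = max (norm v) (R / 2)"
  have m: "0 < m" "m < R" "norm v \<le> m" using nv R unfolding m_def by auto
  let ?g = "\<lambda>s. F (cvec x0 + s *s cvec v)"
  have sub: "ball 0 (R / m) \<subseteq> {s. cvec x0 + s *s cvec v \<in> polydisc x0 R}"
  proof
    fix t :: complex assume "t \<in> ball 0 (R / m)"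
    then have "cmod t * m < R" using m by (simp add: field_simps)
    moreover have "cmod t * norm v \<le> cmod t * m" using m by (intro mult_left_mono) auto
    ultimately show "t \<in> {s. cvec x0 + s *s cvec v \<in> polydisc x0 R}"
      by (auto intro!: polydisc_line)
  qed
  have "?g holomorphic_on ball 0 (R / m)"
    using complex_extension_line(1)[OF ext open_polydisc] sub by (rule holomorphic_on_subset)
  moreover have "1 \<in> ball (0::complex) (R / m)" using m by simp
  ultimately have "(\<lambda>n. (deriv ^^ n) ?g 0 / fact n * (1 - 0) ^ n) sums ?g 1"
    by (rule holomorphic_power_series)
  then have "(\<lambda>n. Re ((deriv ^^ n) ?g 0 / fact n * (1 - 0) ^ n)) sums Re (?g 1)"
    by (rule sums_Re)
  moreover have "Re ((deriv ^^ n) ?g 0 / fact n * (1 - 0) ^ n) = lderiv F n x0 v / fact n" for n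
    unfolding lderiv_def using Re_divide_of_real[of "(deriv ^^ n) ?g 0" "fact n"] by simp
  moreover have "cvec x0 + 1 *s cvec v = cvec y" unfolding v_def by (simp add: vec_eq_iff)
  moreover have "F (cvec y) = complex_of_real (f y)"
    using ext cvec_in_polydisc[OF y] unfolding complex_extension_def by blast
  ultimately show ?thesis unfolding v_def by simp
qed

lemma continuous_on_cvec [continuous_intros]:
  assumes "continuous_on A g"
  shows "continuous_on A (\<lambda>x. cvec (g x))"
  unfolding cvec_def using assms by (intro continuous_on_vec_lambda continuous_intros)

text \<open>As \<open>p\<close> tends to \<open>p0\<close>, the restrictions to lines converge
  uniformly on a fixed disc, by continuity of \<open>F\<close> and compactness of the closed disc.
  Uniform convergence of holomorphic functions passes to all derivatives at the centre.\<close>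

lemma lderiv_continuous:
  fixes F :: "complex ^ 'd \<Rightarrow> complex"
  assumes ext: "complex_extension (polydisc x0 R) f F"
  shows "continuous_on (ball x0 R \<times> UNIV) (\<lambda>p. lderiv F j (fst p) (snd p))"
proof (intro continuous_at_imp_continuous_on ballI)
  fix p0 :: "(real ^ 'd) \<times> (real ^ 'd)" assume p0: "p0 \<in> ball x0 R \<times> UNIV"
  define x where "x = fst p0"
  define v where "v = snd p0"
  define e where "e = R - norm (x - x0)"
  have e: "0 < e" using p0 unfolding e_def x_def by (auto simp: dist_norm norm_minus_commute)
  define \<rho> where "\<rho> = e / (2 * (norm v + 1))"
  have nv: "0 < norm v + 1" using norm_ge_zero[of v] by linarith
  have \<rho>: "0 < \<rho>" using e nv unfolding \<rho>_def by simp
  have "\<rho> * norm v \<le> \<rho> * (norm v + 1)" using \<rho> by simp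
  also have "\<dots> = e / 2" unfolding \<rho>_def times_divide_eq_left
    using nv by (intro mult_divide_mult_cancel_right) auto
  finally have small: "norm (x - x0) + \<rho> * norm v < R" using e unfolding e_def by simp
  define U where "U = {p :: (real ^ 'd) \<times> (real ^ 'd). norm (fst p - x0) + \<rho> * norm (snd p) < R}"
  have "U = (\<lambda>p. norm (fst p - x0) + \<rho> * norm (snd p)) -` {..<R}" unfolding U_def by auto
  moreover have "open ((\<lambda>p :: (real ^ 'd) \<times> (real ^ 'd). norm (fst p - x0) + \<rho> * norm (snd p)) -` {..<R})"
    by (intro open_vimage continuous_intros open_lessThan)
  ultimately have U: "open U" by simp
  have p0U: "p0 \<in> U" using small unfolding U_def x_def v_def by simp
  have inS: "cvec (fst p) + t *s cvec (snd p) \<in> polydisc x0 R" if "p \<in> U" "t \<in> cball 0 \<rho>" for p t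
  proof (rule polydisc_line)
    have "cmod t * norm (snd p) \<le> \<rho> * norm (snd p)" using that by (intro mult_right_mono) auto
    then show "norm (fst p - x0) + cmod t * norm (snd p) < R" using that unfolding U_def by simp
  qed
  let ?\<Phi> = "\<lambda>q. F (cvec (fst (fst q)) + snd q *s cvec (snd (fst q)))"
  have cont: "continuous_on (U \<times> cball 0 \<rho>) ?\<Phi>"
  proof (rule continuous_on_compose2[of "polydisc x0 R" F])
    show "continuous_on (polydisc x0 R) F" using ext unfolding complex_extension_def by blast
    show "continuous_on (U \<times> cball 0 \<rho>) (\<lambda>q. cvec (fst (fst q)) + snd q *s cvec (snd (fst q)))"
      unfolding vector_scalar_mult_def
      by (intro continuous_intros continuous_on_vec_lambda continuous_on_component)
    show "(\<lambda>q. cvec (fst (fst q)) + snd q *s cvec (snd (fst q))) ` (U \<times> cball 0 \<rho>) \<subseteq> polydisc x0 R"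
      using inS by auto
  qed
  have ul: "uniform_limit (ball 0 \<rho>) (\<lambda>p t. F (cvec (fst p) + t *s cvec (snd p)))
      (\<lambda>t. F (cvec (fst p0) + t *s cvec (snd p0))) (at p0)"
  proof (rule uniform_limitI)
    fix \<epsilon> :: real assume "0 < \<epsilon>"
    obtain X0 where X0: "p0 \<in> X0" "open X0"
      "\<forall>p\<in>X0 \<inter> U. \<forall>t\<in>cball 0 \<rho>. dist (?\<Phi> (p, t)) (?\<Phi> (p0, t)) \<le> \<epsilon> / 2"
      using continuous_on_prod_compactE[OF cont compact_cball p0U, of "\<epsilon> / 2"] \<open>0 < \<epsilon>\<close> by auto
    have "eventually (\<lambda>p. p \<in> X0 \<inter> U) (at p0)"
      using X0 U p0U by (intro eventually_at_in_open') auto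
    then show "\<forall>\<^sub>F p in at p0. \<forall>t\<in>ball 0 \<rho>. dist (F (cvec (fst p) + t *s cvec (snd p)))
        (F (cvec (fst p0) + t *s cvec (snd p0))) < \<epsilon>"
    proof eventually_elim
      case (elim p)
      show ?case
      proof
        fix t :: complex assume "t \<in> ball 0 \<rho>"
        then have "t \<in> cball 0 \<rho>" by simp
        with X0(3) elim have "dist (?\<Phi> (p, t)) (?\<Phi> (p0, t)) \<le> \<epsilon> / 2" by blast
        then show "dist (F (cvec (fst p) + t *s cvec (snd p))) (F (cvec (fst p0) + t *s cvec (snd p0))) < \<epsilon>"
          using \<open>0 < \<epsilon>\<close> by simp
      qed
    qed
  qed
  have holo: "eventually (\<lambda>p. (\<lambda>t. F (cvec (fst p) + t *s cvec (snd p))) holomorphic_on ball 0 \<rho>) (at p0)"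
  proof -
    have "eventually (\<lambda>p. p \<in> U) (at p0)" using U p0U by (intro eventually_at_in_open')
    then show ?thesis
    proof eventually_elim
      case (elim p)
      have "ball 0 \<rho> \<subseteq> {t. cvec (fst p) + t *s cvec (snd p) \<in> polydisc x0 R}"
        using inS[OF elim] by auto
      then show ?case
        using complex_extension_line(1)[OF ext open_polydisc] holomorphic_on_subset by blast
    qed
  qed
  have "((\<lambda>p. (deriv ^^ j) (\<lambda>t. F (cvec (fst p) + t *s cvec (snd p))) 0) \<longlongrightarrow>
      (deriv ^^ j) (\<lambda>t. F (cvec (fst p0) + t *s cvec (snd p0))) 0) (at p0)"
    using \<rho> by (intro higher_deriv_complex_uniform_limit[OF ul holo]) auto
  then show "isCont (\<lambda>p. lderiv F j (fst p) (snd p)) p0"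
    unfolding isCont_def lderiv_def by (rule tendsto_Re)
qed

section \<open>Linear combinations of finitely many analytic functions\<close>

definition lincomb :: "('n::finite \<Rightarrow> 'a \<Rightarrow> real) \<Rightarrow> real ^ 'n \<Rightarrow> 'a \<Rightarrow> real" where
  "lincomb f w x = (\<Sum>n\<in>UNIV. w $ n * f n x)"

lemma lincomb_add: "lincomb f (v + w) x = lincomb f v x + lincomb f w x"
  unfolding lincomb_def by (simp add: algebra_simps sum.distrib)

lemma lincomb_scale: "lincomb f (k *\<^sub>R w) x = k * lincomb f w x"
  unfolding lincomb_def by (simp add: sum_distrib_left mult.assoc)

text \<open>The ratio hypothesis of \<open>segment_sublevel\<close> with \<kappa> = 3, uniformly in
  a cone. Without a nonvanishing clause it is invariant under scaling of \<open>w\<close> and admits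
  \<open>w = 0\<close>.\<close>

definition direction_ratio ::
  "('n::finite \<Rightarrow> complex ^ 'd \<Rightarrow> complex) \<Rightarrow> real ^ 'n \<Rightarrow> nat \<Rightarrow> real ^ 'd \<Rightarrow> real ^ 'd \<Rightarrow> real \<Rightarrow> bool" where
  "direction_ratio F w l x0 u \<delta> \<longleftrightarrow>
    (\<forall>x\<in>ball x0 \<delta>. \<forall>y\<in>ball x0 \<delta>. \<forall>v\<in>ball u \<delta>. \<forall>v'\<in>ball u \<delta>.
      \<bar>\<Sum>n\<in>UNIV. w $ n * lderiv (F n) l x v\<bar> \<le> 3 * \<bar>\<Sum>n\<in>UNIV. w $ n * lderiv (F n) l y v'\<bar>)"

text \<open>If all derivatives at \<open>x0\<close> in the direction of \<open>y\<close> vanished,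
  the Taylor series would vanish at \<open>y\<close>. A nonzero derivative changes by less than half
  of its size nearby, jointly in coefficients, point and direction; 3 is the quotient of 3/2 and
  1/2.\<close>

lemma direction_near:
  fixes F :: "'n::finite \<Rightarrow> complex ^ 'd \<Rightarrow> complex"
  assumes ext: "\<And>n. complex_extension (polydisc x0 R) (f n) (F n)" and R: "0 < R" "R \<le> 1"
    and w0: "\<exists>y\<in>ball x0 R. lincomb f w0 y \<noteq> 0"
  shows "\<exists>\<delta> u l. 0 < \<delta> \<and> norm u \<le> 1 \<and>
    (\<forall>w\<in>ball w0 \<delta>. direction_ratio F w l x0 u \<delta>)"
proof -
  obtain y where y: "y \<in> ball x0 R" "lincomb f w0 y \<noteq> 0" using w0 by blast
  define u where "u = y - x0"
  have nu: "norm u \<le> 1" using y(1) R unfolding u_def by (simp add: dist_norm norm_minus_commute)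
  define D where "D j p = (\<Sum>n\<in>UNIV. fst p $ n * lderiv (F n) j (fst (snd p)) (snd (snd p)))"
    for j and p :: "(real ^ 'n) \<times> (real ^ 'd) \<times> (real ^ 'd)"
  have "\<exists>l. D l (w0, x0, u) \<noteq> 0"
  proof (rule ccontr)
    assume "\<nexists>l. D l (w0, x0, u) \<noteq> 0"
    then have z: "(\<Sum>n\<in>UNIV. w0 $ n * lderiv (F n) j x0 u) = 0" for j unfolding D_def by simp
    have "(\<lambda>j. \<Sum>n\<in>UNIV. w0 $ n * (lderiv (F n) j x0 (y - x0) / fact j)) sums (\<Sum>n\<in>UNIV. w0 $ n * f n y)"
      by (intro sums_sum sums_mult lderiv_series[OF ext y(1)])
    moreover have "(\<Sum>n\<in>UNIV. w0 $ n * (lderiv (F n) j x0 (y - x0) / fact j)) = 0" for j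
    proof -
      have "(\<Sum>n\<in>UNIV. w0 $ n * (lderiv (F n) j x0 (y - x0) / fact j)) =
        (\<Sum>n\<in>UNIV. w0 $ n * lderiv (F n) j x0 u) / fact j"
        unfolding u_def by (simp add: sum_divide_distrib)
      then show ?thesis using z by simp
    qed
    ultimately have "lincomb f w0 y = 0"
      unfolding lincomb_def using sums_unique2[OF _ sums_zero] by simp
    then show False using y(2) by blast
  qed
  then obtain l where l: "D l (w0, x0, u) \<noteq> 0" by blast
  have "continuous_on (UNIV \<times> ball x0 R \<times> UNIV) (D l)"
    unfolding D_def
  proof (intro continuous_on_sum continuous_on_mult)
    fix n
    show "continuous_on (UNIV \<times> ball x0 R \<times> UNIV) (\<lambda>p. lderiv (F n) l (fst (snd p)) (snd (snd p)))"
      by (rule continuous_on_compose2[OF lderiv_continuous[OF ext], of _ "\<lambda>p. snd p"])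
        (auto intro!: continuous_intros)
  qed (intro continuous_intros continuous_on_component)
  moreover have "open (UNIV \<times> ball x0 R \<times> UNIV :: ((real ^ 'n) \<times> (real ^ 'd) \<times> (real ^ 'd)) set)"
    by (intro open_Times) auto
  moreover have "(w0, x0, u) \<in> UNIV \<times> ball x0 R \<times> UNIV" using R by auto
  ultimately have "isCont (D l) (w0, x0, u)"
    using continuous_on_eq_continuous_at by blast
  then obtain d where d: "0 < d"
    "\<And>p. dist p (w0, x0, u) < d \<Longrightarrow> dist (D l p) (D l (w0, x0, u)) < \<bar>D l (w0, x0, u)\<bar> / 2"
    unfolding continuous_at_eps_delta using l by (metis half_gt_zero zero_less_abs_iff)
  have near: "\<bar>D l (w, x, v) - D l (w0, x0, u)\<bar> < \<bar>D l (w0, x0, u)\<bar> / 2"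
    if "w \<in> ball w0 (d / 3)" "x \<in> ball x0 (d / 3)" "v \<in> ball u (d / 3)" for w x v
  proof -
    have "dist (w, x, v) (w0, x0, u) \<le> dist w w0 + dist (x, v) (x0, u)"
      unfolding dist_Pair_Pair[of w] by (rule sqrt_sum_squares_le_sum) auto
    also have "dist (x, v) (x0, u) \<le> dist x x0 + dist v u"
      unfolding dist_Pair_Pair by (rule sqrt_sum_squares_le_sum) auto
    finally have "dist (w, x, v) (w0, x0, u) < d" using that by (simp add: dist_commute)
    from d(2)[OF this] show ?thesis by (simp add: dist_real_def)
  qed
  have "\<bar>D l (w, x, v)\<bar> \<le> 3 * \<bar>D l (w, y, v')\<bar>"
    if "w \<in> ball w0 (d / 3)" "x \<in> ball x0 (d / 3)" "y \<in> ball x0 (d / 3)" "v \<in> ball u (d / 3)" "v' \<in> ball u (d / 3)"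
    for w x y v v'
    using near[OF that(1,2,4)] near[OF that(1,3,5)] by linarith
  then show ?thesis
    using d(1) nu unfolding D_def direction_ratio_def
    by (intro exI[of _ "d / 3"] exI[of _ u] exI[of _ l]) simp
qed

text \<open>On the unit sphere of the orthogonal complement of the relations between the \<open>f n\<close>, compactness
  makes the choice of \<open>direction_near\<close> uniform.\<close>

lemma uniform_direction:
  fixes F :: "'n::finite \<Rightarrow> complex ^ 'd \<Rightarrow> complex"
  assumes ext: "\<And>n. complex_extension (polydisc x0 R) (f n) (F n)" and R: "0 < R" "R \<le> 1"
  obtains R1 L where "0 < R1" "R1 \<le> R"
    "\<And>w. \<exists>w' u l. (\<forall>x\<in>ball x0 R. lincomb f w x = lincomb f w' x) \<and> norm u \<le> 1 \<and> l \<le> L \<and>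
      direction_ratio F w' l x0 u R1"
proof -
  define N where "N = {w. \<forall>x\<in>ball x0 R. lincomb f w x = 0}"
  have N: "subspace N"
    unfolding N_def by (intro subspaceI) (auto simp: lincomb_add lincomb_scale lincomb_def[of _ 0])
  define S where "S = {w. (\<forall>v\<in>N. orthogonal v w) \<and> norm w = 1}"
  have "S = {w. \<forall>v\<in>N. orthogonal v w} \<inter> sphere 0 1" unfolding S_def by auto
  moreover have "closed {w. \<forall>v\<in>N. orthogonal v w}"
    using subspace_orthogonal_to_vectors[of N] by (intro closed_subspace) (simp add: orthogonal_commute)
  ultimately have cS: "compact S" by (simp add: closed_Int_compact)
  have ne: "\<exists>y\<in>ball x0 R. lincomb f w0 y \<noteq> 0" if "w0 \<in> S" for w0
  proof (rule ccontr)
    assume "\<not> ?thesis"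
    then have "w0 \<in> N" unfolding N_def by blast
    then show False using that unfolding S_def by (auto simp: orthogonal_self)
  qed
  let ?P = "\<lambda>w0 \<delta> u l. 0 < \<delta> \<and> norm u \<le> 1 \<and> (\<forall>w\<in>ball w0 \<delta>. direction_ratio F w l x0 u \<delta>)"
  have "\<forall>w0\<in>S. \<exists>p. ?P w0 (fst p) (fst (snd p)) (snd (snd p))"
    unfolding split_paired_Ex fst_conv snd_conv
    by (intro ballI direction_near[where F = F and f = f, OF ext R ne])
  from bchoice[OF this] obtain p where p: "\<forall>w0\<in>S. ?P w0 (fst (p w0)) (fst (snd (p w0))) (snd (snd (p w0)))" ..
  define \<delta> u l where "\<delta> w = fst (p w)" and "u w = fst (snd (p w))" and "l w = snd (snd (p w))" for w
  have \<delta>: "0 < \<delta> w0" and u: "norm (u w0) \<le> 1"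
    and ratio: "\<And>w. w \<in> ball w0 (\<delta> w0) \<Longrightarrow> direction_ratio F w (l w0) x0 (u w0) (\<delta> w0)"
    if "w0 \<in> S" for w0
    using bspec[OF p that] unfolding \<delta>_def u_def l_def by blast+
  have "S \<subseteq> (\<Union>w\<in>S. ball w (\<delta> w))" using \<delta> by force
  then obtain S' where S': "S' \<subseteq> S" "finite S'" "S \<subseteq> (\<Union>w\<in>S'. ball w (\<delta> w))"
    using compactE_image[OF cS, of S "\<lambda>w. ball w (\<delta> w)"] by auto
  define R1 where "R1 = Min (insert R (\<delta> ` S'))"
  define L where "L = Max (insert 0 (l ` S'))"
  have R1: "0 < R1" "R1 \<le> R" unfolding R1_def using S' R \<delta> by (auto simp: subset_iff)
  have R1\<delta>: "R1 \<le> \<delta> w" if "w \<in> S'" for w unfolding R1_def using S'(2) that by (intro Min_le) auto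
  have Ll: "l w \<le> L" if "w \<in> S'" for w unfolding L_def using S'(2) that by (intro Max_ge) auto
  show ?thesis
  proof (rule that[of R1 L])
    fix w
    \<comment> \<open>The component in \<open>N\<close> does not change the function on the ball, so
      \<open>w\<close> can be replaced by \<open>w2\<close>.\<close>
    obtain w1 w2 where w12: "w1 \<in> span N" "\<And>v. v \<in> span N \<Longrightarrow> orthogonal w2 v" "w = w1 + w2"
      using orthogonal_subspace_decomp_exists[of N w] by metis
    have w1: "w1 \<in> N" using w12(1) N by (simp add: span_eq_iff[THEN iffD2])
    have eq: "\<forall>x\<in>ball x0 R. lincomb f w x = lincomb f w2 x"
      using w1 unfolding w12(3) N_def by (simp add: lincomb_add)
    show "\<exists>w' u l. (\<forall>x\<in>ball x0 R. lincomb f w x = lincomb f w' x) \<and> norm u \<le> 1 \<and> l \<le> L \<and>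
      direction_ratio F w' l x0 u R1"
    proof (cases "w2 = 0")
      case True
      then show ?thesis using eq unfolding direction_ratio_def by (intro exI[of _ w2] exI[of _ 0]) auto
    next
      case False
      \<comment> \<open>Compactness applies to the unit vector; the ratio condition then scales back
        to \<open>w2\<close>.\<close>
      define w3 where "w3 = w2 /\<^sub>R norm w2"
      have "w3 \<in> S"
        unfolding S_def w3_def using False w12(2)[OF span_base]
        by (auto simp: orthogonal_def inner_commute)
      then obtain w0 where w0: "w0 \<in> S'" "w3 \<in> ball w0 (\<delta> w0)" using S'(3) by blast
      have w0S: "w0 \<in> S" using w0 S'(1) by blast
      have sub: "ball a R1 \<subseteq> ball a (\<delta> w0)" for a :: "real ^ 'd" by (intro subset_ball R1\<delta> w0(1))
      have sc: "(\<Sum>n\<in>UNIV. w2 $ n * c n) = norm w2 * (\<Sum>n\<in>UNIV. w3 $ n * c n)" for c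
        unfolding w3_def using False by (simp add: sum_distrib_left field_simps)
      have "\<bar>\<Sum>n\<in>UNIV. w2 $ n * lderiv (F n) (l w0) x v\<bar> \<le> 3 * \<bar>\<Sum>n\<in>UNIV. w2 $ n * lderiv (F n) (l w0) y v'\<bar>"
        if "x \<in> ball x0 R1" "y \<in> ball x0 R1" "v \<in> ball (u w0) R1" "v' \<in> ball (u w0) R1" for x y v v'
      proof -
        have "\<bar>\<Sum>n\<in>UNIV. w3 $ n * lderiv (F n) (l w0) x v\<bar> \<le> 3 * \<bar>\<Sum>n\<in>UNIV. w3 $ n * lderiv (F n) (l w0) y v'\<bar>"
          using ratio[OF w0S w0(2)] that sub unfolding direction_ratio_def by blast
        from mult_left_mono[OF this, of "norm w2"] show ?thesis
          unfolding sc abs_mult by (simp add: mult_ac)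
      qed
      then have "direction_ratio F w2 (l w0) x0 (u w0) R1" unfolding direction_ratio_def by blast
      then show ?thesis using eq u[OF w0S] Ll[OF w0(1)] by blast
    qed
  qed (use R1 in auto)
qed

text \<open>Each \<open>w\<close> is replaced by coefficients \<open>w'\<close> with a direction and
  an order to which the one-variable estimate and the cone argument apply with common constants. The
  exponent is the reciprocal of a bound for the orders, raised by one to be nonzero.\<close>

lemma linear_combinations_good:
  fixes f :: "'n::finite \<Rightarrow> real ^ 'd \<Rightarrow> real"
  assumes "\<And>n. complex_extension (polydisc x0 R) (f n) (F n)" and R: "0 < R" "R \<le> 1"
  shows "\<exists>R2 C \<alpha>. 0 < R2 \<and> R2 \<le> R \<and> 0 < C \<and> 0 < \<alpha> \<and> (\<forall>w. good_on (ball x0 R2) C \<alpha> (lincomb f w))"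
proof -
  note ext = assms(1)
  obtain \<eta> L0 where \<eta>: "0 < \<eta>" "\<eta> \<le> R"
    and dir: "\<And>w. \<exists>w' u l. (\<forall>x\<in>ball x0 R. lincomb f w x = lincomb f w' x) \<and> norm u \<le> 1 \<and> l \<le> L0 \<and>
      direction_ratio F w' l x0 u \<eta>"
    by (rule uniform_direction[where F = F and f = f, OF ext R]) blast
  then have \<eta>1: "\<eta> \<le> 1" using R by simp
  define L where "L = Suc L0"
  define K :: real where "K = (1 + (3 + 1) * fact L) * real (Suc L) * (2 * real (Suc L)) ^ L"
  have K: "0 < K" unfolding K_def by (intro mult_pos_pos) (auto intro: add_pos_pos)
  define C where "C = 2 * (12 / \<eta>) ^ DIM(real ^ 'd) * (K * K * 5 ^ L) powr (1 / L)"
  have C: "0 < C" unfolding C_def using \<eta> K by simp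
  \<comment> \<open>A ball inside \<open>ball x0 R2\<close>, dilated by \<open>20 / \<eta>\<close>,
    remains inside \<open>ball x0 \<eta>\<close>.\<close>
  define R2 where "R2 = \<eta> / (1 + 20 / \<eta>)"
  have den: "1 < 1 + 20 / \<eta>" using \<eta> by simp
  have R2: "0 < R2" "R2 \<le> \<eta>" 
  proof -
    show "0 < R2" unfolding R2_def using \<eta> den by (intro divide_pos_pos) linarith+
    have "\<eta> / (1 + 20 / \<eta>) \<le> \<eta> / 1" using \<eta> den by (intro divide_left_mono mult_pos_pos) linarith+
    then show "R2 \<le> \<eta>" unfolding R2_def by simp
  qed
  have R2': "R2 + 20 / \<eta> * R2 = \<eta>"
  proof -
    have "R2 + 20 / \<eta> * R2 = (1 + 20 / \<eta>) * R2" by (simp only: distrib_right mult_1)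
    also have "\<dots> = \<eta>"
    proof -
      have "1 + 20 / \<eta> \<noteq> 0" using den by linarith
      then show ?thesis unfolding R2_def times_divide_eq_right by (rule nonzero_mult_div_cancel_left)
    qed
    finally show ?thesis .
  qed
  have "continuous_on (ball x0 R) (f n)" for n
  proof -
    have "continuous_on (ball x0 R) (\<lambda>x. Re (F n (cvec x)))"
    proof (rule continuous_on_Re[OF continuous_on_compose2[of "polydisc x0 R" "F n"]])
      show "continuous_on (polydisc x0 R) (F n)" using ext[of n] unfolding complex_extension_def by (rule conjunct1)
      show "cvec ` ball x0 R \<subseteq> polydisc x0 R" using cvec_in_polydisc by blast
    qed (intro continuous_intros)
    moreover have "Re (F n (cvec x)) = f n x" if "x \<in> ball x0 R" for x
    proof -
      have "F n (cvec x) = complex_of_real (f n x)"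
        using ext[of n] cvec_in_polydisc[OF that] unfolding complex_extension_def by blast
      then show ?thesis by simp
    qed
    ultimately show ?thesis by (rule continuous_on_eq) 
  qed
  then have cont: "continuous_on (ball x0 R) (lincomb f w)" for w
    unfolding lincomb_def by (intro continuous_intros)
  have "good_on (ball x0 R2) C (1 / L) (lincomb f w)" for w
    unfolding good_on_def
  proof (intro conjI allI impI)
    have "ball x0 R2 \<subseteq> ball x0 R" using \<eta> R2 by (intro subset_ball) simp
    then show "continuous_on (ball x0 R2) (lincomb f w)" using cont continuous_on_subset by blast
    obtain w' u l where eq: "\<And>x. x \<in> ball x0 R \<Longrightarrow> lincomb f w x = lincomb f w' x"
      and u: "norm u \<le> 1" and l: "l \<le> L0"
      and ratio: "\<And>x y v v'. x \<in> ball x0 \<eta> \<Longrightarrow> y \<in> ball x0 \<eta> \<Longrightarrow> v \<in> ball u \<eta> \<Longrightarrow> v' \<in> ball u \<eta> \<Longrightarrow>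
       \<bar>\<Sum>n\<in>UNIV. w' $ n * lderiv (F n) l x v\<bar> \<le> 3 * \<bar>\<Sum>n\<in>UNIV. w' $ n * lderiv (F n) l y v'\<bar>"
      using dir[of w] unfolding direction_ratio_def by blast
    have \<eta>R: "ball x0 \<eta> \<subseteq> ball x0 R" using \<eta> by (intro subset_ball)
    fix c r z and \<epsilon> :: real assume a: "ball c r \<subseteq> ball x0 R2 \<and> z \<in> ball c r \<and> 0 < \<epsilon>"
    have seg: "vol {t \<in> {0..1}. \<bar>lincomb f w (z + t *\<^sub>R (k *\<^sub>R v))\<bar> < \<epsilon>} ^ L * \<bar>lincomb f w z\<bar> \<le> K * \<epsilon>"
      if z: "z \<in> ball x0 \<eta>" and zv: "z + k *\<^sub>R v \<in> ball x0 \<eta>" and v: "v \<in> ball u \<eta>" and \<epsilon>: "0 < \<epsilon>" for z k v \<epsilon>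
    proof -
      define g where "g j t = (\<Sum>n\<in>UNIV. w' $ n * lderiv (F n) j (z + t *\<^sub>R (k *\<^sub>R v)) (k *\<^sub>R v))" for j t
      have inB: "z + t *\<^sub>R (k *\<^sub>R v) \<in> ball x0 \<eta>" if "t \<in> {0..1}" for t
        using convexD_alt[OF convex_ball z zv, of t] that by (simp add: algebra_simps)
      have inS: "cvec (z + t *\<^sub>R (k *\<^sub>R v)) \<in> polydisc x0 R" if "t \<in> {0..1}" for t
        using inB[OF that] \<eta>R cvec_in_polydisc by blast
      have g0: "g 0 t = lincomb f w (z + t *\<^sub>R (k *\<^sub>R v))" if "t \<in> {0..1}" for t
      proof -
        have "g 0 t = lincomb f w' (z + t *\<^sub>R (k *\<^sub>R v))"
          unfolding g_def lincomb_def using lderiv_0[OF ext inS[OF that]] by simp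
        then show ?thesis using eq inB[OF that] \<eta>R by auto
      qed
      have "vol {t \<in> {0..1}. \<bar>g 0 t\<bar> < \<epsilon>} ^ L * \<bar>g 0 0\<bar>
        \<le> (1 + (3 + 1) * fact L) * real (Suc L) * (2 * real (Suc L)) ^ L * \<epsilon>"
      proof (rule segment_sublevel[where l = l])
        show "(g j has_real_derivative g (Suc j) t) (at t)" if "t \<in> {0..1}" for j t
          unfolding g_def
          by (intro DERIV_sum DERIV_cmult lderiv_has_derivative[OF ext open_polydisc inS[OF that]])
        have gl: "g l t = k ^ l * (\<Sum>n\<in>UNIV. w' $ n * lderiv (F n) l (z + t *\<^sub>R (k *\<^sub>R v)) v)" if "t \<in> {0..1}" for t
          unfolding g_def lderiv_scale[OF ext open_polydisc inS[OF that]]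
          by (simp add: sum_distrib_left mult_ac)
        show "\<bar>g l t\<bar> \<le> 3 * \<bar>g l t'\<bar>" if t: "t \<in> {0..1}" "t' \<in> {0..1}" for t t'
          using mult_left_mono[OF ratio[OF inB[OF t(1)] inB[OF t(2)] v v], of "\<bar>k ^ l\<bar>"]
          unfolding gl[OF t(1)] gl[OF t(2)] abs_mult by (simp add: mult_ac)
      qed (use l \<epsilon> in \<open>auto simp: L_def\<close>)
      moreover have "{t \<in> {0..1}. \<bar>g 0 t\<bar> < \<epsilon>} = {t \<in> {0..1}. \<bar>lincomb f w (z + t *\<^sub>R (k *\<^sub>R v))\<bar> < \<epsilon>}"
        using g0 by (intro Collect_cong) auto
      moreover have "g 0 0 = lincomb f w z" using g0[of 0] by simp
      ultimately show ?thesis unfolding K_def by simp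
    qed
    have r: "0 < r" using a zero_le_dist[of c z] unfolding mem_ball by linarith
    have "dist c x0 + r \<le> R2" using a r by (simp add: ball_subset_ball_iff)
    then have "dist c x0 + 20 / \<eta> * r \<le> R2 + 20 / \<eta> * R2"
      using r \<eta> R2 by (intro add_mono mult_left_mono) (auto intro: order_trans[rotated])
    then have B: "ball c (20 / \<eta> * r) \<subseteq> ball x0 \<eta>" unfolding R2' by (simp add: ball_subset_ball_iff)
    have "continuous_on (ball x0 \<eta>) (lincomb f w)" using cont \<eta>R continuous_on_subset by blast
    then show "vol {x \<in> ball c r. \<bar>lincomb f w x\<bar> < \<epsilon>} * \<bar>lincomb f w z\<bar> powr (1 / L)
        \<le> C * \<epsilon> powr (1 / L) * vol (ball c r)"
      unfolding C_def
    proof (rule cone_sublevel[OF _ seg u \<eta>(1) \<eta>1 _ K B])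
      show "1 \<le> L" unfolding L_def by simp
      show "z \<in> ball c r" "0 < \<epsilon>" using a by blast+
    qed
  qed
  moreover have "0 < 1 / real L" unfolding L_def by simp
  moreover have "R2 \<le> R" using \<eta> R2 by simp
  ultimately show ?thesis using R2(1) C by blast
qed

section \<open>Exterior products as determinants\<close>

text \<open>For \<open>card I = r\<close> the numbers \<open>wdet M I a \<sigma>\<close> are, up to sign, the coordinates of the exterior product of
  the \<open>r\<close> vectors \<open>M a\<^sub>i\<close>: completing by standard basis vectors avoids determinants of varying
  size. The factor \<open>weight\<close> accounts for the diagonal matrix with entries \<open>geo_mean \<theta> / \<theta> $ j\<close>, which
  has determinant 1.\<close>

definition wdet :: "real ^ 'k ^ 'k \<Rightarrow> 'k set \<Rightarrow> real ^ 'k ^ 'k \<Rightarrow> ('k \<Rightarrow> 'k) \<Rightarrow> real" where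
  "wdet M I a \<sigma> = det (\<chi> i. if i \<in> I then M *v (a $ i) else axis (\<sigma> i) 1)"

definition weight :: "real ^ 'k \<Rightarrow> 'k set \<Rightarrow> ('k \<Rightarrow> 'k) \<Rightarrow> real" where
  "weight \<theta> I \<sigma> = (\<Prod>i\<in>-I. \<theta> $ (\<sigma> i) / geo_mean \<theta>)"

text \<open>For a basis of a subspace this is the maximum norm of the exterior product of the
  transformed basis, the substitute for the covolume. Only the values of \<sigma> off
  \<open>I\<close> count, and a repetition among them makes the determinant vanish, so the maximum
  over all functions is one over coordinates.\<close>

definition wnorm :: "real ^ 'k \<Rightarrow> real ^ 'k ^ 'k \<Rightarrow> 'k set \<Rightarrow> real ^ 'k ^ 'k \<Rightarrow> real" where
  "wnorm \<theta> M I a = Max (range (\<lambda>\<sigma>. \<bar>weight \<theta> I \<sigma> * wdet M I a \<sigma>\<bar>))"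

lemma geo_mean_pos:
  fixes \<theta> :: "real ^ 'k"
  assumes "\<And>i. 0 < \<theta> $ i"
  shows "0 < geo_mean \<theta>"
proof -
  have "0 < (\<Prod>i\<in>UNIV. \<theta> $ i)" using assms by (intro prod_pos) auto
  then show ?thesis unfolding geo_mean_def by (simp only: powr_gt_zero less_irrefl not_False_eq_True)
qed

lemma geo_mean_power:
  fixes \<theta> :: "real ^ 'k"
  assumes "\<And>i. 0 < \<theta> $ i"
  shows "geo_mean \<theta> ^ CARD('k) = (\<Prod>i\<in>UNIV. \<theta> $ i)"
proof -
  have "0 < (\<Prod>i\<in>UNIV. \<theta> $ i)" using assms by (intro prod_pos) auto
  then have "geo_mean \<theta> ^ CARD('k) = ((\<Prod>i\<in>UNIV. \<theta> $ i) powr (1 / real CARD('k))) powr real CARD('k)"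
    unfolding geo_mean_def by (intro powr_realpow[symmetric]) (simp only: powr_gt_zero)
  also have "\<dots> = (\<Prod>i\<in>UNIV. \<theta> $ i) powr 1" unfolding powr_powr by simp
  finally show ?thesis using \<open>0 < (\<Prod>i\<in>UNIV. \<theta> $ i)\<close> by (simp only: powr_one_gt_zero_iff less_imp_le powr_one)
qed

lemma weight_pos:
  fixes \<theta> :: "real ^ 'k"
  assumes "\<And>i. 0 < \<theta> $ i"
  shows "0 < weight \<theta> I \<sigma>"
  unfolding weight_def using assms geo_mean_pos[OF assms] by (intro prod_pos) auto

lemma wnorm_ge: "\<bar>weight \<theta> I \<sigma> * wdet M I a \<sigma>\<bar> \<le> wnorm \<theta> M I a"
  unfolding wnorm_def by (intro Max_ge) auto

lemma wnorm_leI: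
  assumes "\<And>\<sigma>. \<bar>weight \<theta> I \<sigma> * wdet M I a \<sigma>\<bar> \<le> K"
  shows "wnorm \<theta> M I a \<le> K"
  unfolding wnorm_def using assms by (intro Max.boundedI) auto

lemma wnorm_attained: "\<exists>\<sigma>. wnorm \<theta> M I a = \<bar>weight \<theta> I \<sigma> * wdet M I a \<sigma>\<bar>"
proof -
  have "wnorm \<theta> M I a \<in> range (\<lambda>\<sigma>. \<bar>weight \<theta> I \<sigma> * wdet M I a \<sigma>\<bar>)"
    unfolding wnorm_def by (rule Max_in) auto
  then show ?thesis by (rule rangeE) blast
qed

lemma wnorm_nonneg: "0 \<le> wnorm \<theta> M I a"
  using wnorm_ge[of \<theta> I undefined M a] by (rule order_trans[rotated]) simp

lemma det_expand_rows:
  fixes p :: "'k::finite \<Rightarrow> 'k \<Rightarrow> real ^ 'k"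
  shows "det (\<chi> i. \<Sum>l\<in>UNIV. c i l *s p i l) =
    (\<Sum>f\<in>UNIV. (\<Prod>i\<in>UNIV. c i (f i)) * det (\<chi> i. p i (f i)))"
  using det_linear_rows_sum[of "UNIV :: 'k set" "\<lambda>i l. c i l *s p i l"]
  by (simp add: det_rows_mul)

text \<open>Multilinearity separates the arguments: the coefficients involve \<open>a\<close> and
  \<sigma>, the determinants \<open>M\<close>. This gives one finite family of functions of
  \<open>x\<close> common to all subspaces.\<close>

lemma wdet_expand:
  fixes M :: "real ^ 'k ^ 'k"
  shows "wdet M I a \<sigma> = (\<Sum>f\<in>UNIV. (\<Prod>i\<in>UNIV. if i \<in> I then a $ i $ f i else if f i = \<sigma> i then 1 else 0) *
     det (\<chi> i. if i \<in> I then column (f i) M else axis (f i) 1))"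
proof -
  have "(\<chi> i. if i \<in> I then M *v (a $ i) else axis (\<sigma> i) 1) =
    (\<chi> i. \<Sum>l\<in>UNIV. (if i \<in> I then a $ i $ l else if l = \<sigma> i then 1 else 0) *s
       (if i \<in> I then column l M else axis l 1))"
  proof (subst vec_eq_iff, intro allI)
    fix i
    show "(\<chi> i. if i \<in> I then M *v (a $ i) else axis (\<sigma> i) 1) $ i =
    (\<chi> i. \<Sum>l\<in>UNIV. (if i \<in> I then a $ i $ l else if l = \<sigma> i then 1 else 0) *s
       (if i \<in> I then column l M else axis l 1)) $ i"
    proof (cases "i \<in> I")
      case True
      then show ?thesis by (simp add: matrix_mult_sum)
    next
      case False
      have "(\<Sum>l\<in>UNIV. (if l = \<sigma> i then 1 else 0) *s axis l 1) = (\<Sum>l\<in>UNIV. if l = \<sigma> i then axis (\<sigma> i) (1::real) else 0)"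
        by (intro sum.cong) auto
      then show ?thesis using False by simp
    qed
  qed
  then show ?thesis unfolding wdet_def by (simp only: det_expand_rows)
qed

text \<open>Expanding the new row \<open>M *v v\<close> in the standard basis leaves coordinates of
  the old exterior product. The coefficient is at most \<open>\<theta> $ j\<close>, which the change
  of weight turns exactly into \<open>geo_mean \<theta>\<close>; there are \<open>CARD('k)\<close>
  terms.\<close>

lemma wnorm_insert:
  fixes M :: "real ^ 'k ^ 'k" and \<theta> :: "real ^ 'k"
  assumes \<theta>: "\<And>i. 0 < \<theta> $ i" and i0: "i0 \<notin> I" and v: "\<And>j. \<bar>(M *v v) $ j\<bar> \<le> \<theta> $ j"
    and b: "\<And>i. i \<in> I \<Longrightarrow> b $ i = a $ i" "b $ i0 = v"
  shows "wnorm \<theta> M (insert i0 I) b \<le> real CARD('k) * geo_mean \<theta> * wnorm \<theta> M I a"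
proof (rule wnorm_leI)
  fix \<sigma> :: "'k \<Rightarrow> 'k"
  let ?t = "geo_mean \<theta>"
  have t: "0 < ?t" by (rule geo_mean_pos[OF \<theta>])
  define R where "R i = (if i \<in> I then M *v (a $ i) else axis (\<sigma> i) 1)" for i
  have "wdet M (insert i0 I) b \<sigma> = det (\<chi> i. if i = i0 then (\<Sum>j\<in>UNIV. (M *v v) $ j *s axis j 1) else R i)"
    unfolding wdet_def R_def
    by (intro arg_cong[where f = det] arg_cong[where f = vec_lambda] ext) (use b in \<open>auto simp: basis_expansion\<close>)
  also have "\<dots> = (\<Sum>j\<in>UNIV. det (\<chi> i. if i = i0 then (M *v v) $ j *s axis j 1 else R i))"
    by (rule det_linear_row_sum) simp
  also have "\<dots> = (\<Sum>j\<in>UNIV. (M *v v) $ j * wdet M I a (\<sigma>(i0 := j)))"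
  proof (rule sum.cong[OF refl])
    fix j
    have "det (\<chi> i. if i = i0 then (M *v v) $ j *s axis j 1 else R i) =
      (M *v v) $ j * det (\<chi> i. if i = i0 then axis j 1 else R i)"
      by (rule det_row_mul)
    also have "(\<chi> i. if i = i0 then axis j 1 else R i) = (\<chi> i. if i \<in> I then M *v (a $ i) else axis ((\<sigma>(i0 := j)) i) 1)"
      unfolding R_def using i0 by (auto simp: vec_eq_iff)
    finally show "det (\<chi> i. if i = i0 then (M *v v) $ j *s axis j 1 else R i) = (M *v v) $ j * wdet M I a (\<sigma>(i0 := j))"
      unfolding wdet_def .
  qed
  finally have e: "wdet M (insert i0 I) b \<sigma> = (\<Sum>j\<in>UNIV. (M *v v) $ j * wdet M I a (\<sigma>(i0 := j)))" .
  have w: "weight \<theta> (insert i0 I) \<sigma> * \<theta> $ j = ?t * weight \<theta> I (\<sigma>(i0 := j))" for j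
  proof -
    have "-I = insert i0 (- insert i0 I)" using i0 by auto
    then have "weight \<theta> I (\<sigma>(i0 := j)) = \<theta> $ j / ?t * (\<Prod>i\<in>- insert i0 I. \<theta> $ ((\<sigma>(i0 := j)) i) / ?t)"
      unfolding weight_def by (metis (no_types, lifting) ComplD finite fun_upd_same insertI1 prod.insert)
    also have "(\<Prod>i\<in>- insert i0 I. \<theta> $ ((\<sigma>(i0 := j)) i) / ?t) = weight \<theta> (insert i0 I) \<sigma>"
      unfolding weight_def by (intro prod.cong) auto
    finally have "weight \<theta> I (\<sigma>(i0 := j)) = \<theta> $ j / ?t * weight \<theta> (insert i0 I) \<sigma>" .
    then show ?thesis using t by (simp del: fun_upd_apply)
  qed
  have "\<bar>weight \<theta> (insert i0 I) \<sigma> * wdet M (insert i0 I) b \<sigma>\<bar>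
      = weight \<theta> (insert i0 I) \<sigma> * \<bar>\<Sum>j\<in>UNIV. (M *v v) $ j * wdet M I a (\<sigma>(i0 := j))\<bar>"
    unfolding e abs_mult using weight_pos[OF \<theta>] by (simp add: less_imp_le)
  also have "\<dots> \<le> weight \<theta> (insert i0 I) \<sigma> * (\<Sum>j\<in>UNIV. \<theta> $ j * \<bar>wdet M I a (\<sigma>(i0 := j))\<bar>)"
    using weight_pos[OF \<theta>, of "insert i0 I" \<sigma>] v
    by (intro mult_left_mono order_trans[OF sum_abs] sum_mono) (auto simp: abs_mult intro!: mult_right_mono)
  also have "\<dots> = (\<Sum>j\<in>UNIV. ?t * (weight \<theta> I (\<sigma>(i0 := j)) * \<bar>wdet M I a (\<sigma>(i0 := j))\<bar>))"
    by (simp only: sum_distrib_left mult.assoc[symmetric] w)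
  also have "\<dots> \<le> (\<Sum>j\<in>(UNIV :: 'k set). ?t * wnorm \<theta> M I a)"
  proof (intro sum_mono mult_left_mono)
    fix j
    show "weight \<theta> I (\<sigma>(i0 := j)) * \<bar>wdet M I a (\<sigma>(i0 := j))\<bar> \<le> wnorm \<theta> M I a"
      using wnorm_ge[of \<theta> I "\<sigma>(i0 := j)" M a] weight_pos[OF \<theta>, of I "\<sigma>(i0 := j)"] by (simp add: abs_mult)
  qed (use t in simp)
  finally show "\<bar>weight \<theta> (insert i0 I) \<sigma> * wdet M (insert i0 I) b \<sigma>\<bar> \<le> real CARD('k) * ?t * wnorm \<theta> M I a"
    by simp
qed

text \<open>The value for the zero subspace: the matrix is a permutation matrix or has a repeated
  row, and the numbers \<open>\<theta> $ i / geo_mean \<theta>\<close> have product 1.\<close>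

lemma wnorm_empty:
  fixes M :: "real ^ 'k ^ 'k" and \<theta> :: "real ^ 'k"
  assumes \<theta>: "\<And>i. 0 < \<theta> $ i"
  shows "wnorm \<theta> M {} a \<le> 1"
proof (rule wnorm_leI)
  fix \<sigma> :: "'k \<Rightarrow> 'k"
  have A: "(\<chi> i. if i \<in> {} then M *v (a $ i) else axis (\<sigma> i) 1) = (\<chi> i. (mat 1 :: real ^ 'k ^ 'k) $ \<sigma> i)"
    by (auto simp: vec_eq_iff mat_def axis_def)
  show "\<bar>weight \<theta> {} \<sigma> * wdet M {} a \<sigma>\<bar> \<le> 1"
  proof (cases "inj \<sigma>")
    case True
    then have perm: "\<sigma> permutes UNIV"
      by (intro bij_imp_permutes) (auto simp: bij_def finite_UNIV_inj_surj)
    have "weight \<theta> {} \<sigma> = (\<Prod>i\<in>UNIV. \<theta> $ (\<sigma> i)) / geo_mean \<theta> ^ CARD('k)"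
      unfolding weight_def by (simp add: prod_dividef)
    also have "(\<Prod>i\<in>UNIV. \<theta> $ (\<sigma> i)) = (\<Prod>i\<in>UNIV. \<theta> $ i)"
      using prod.permute[OF perm, of "\<lambda>i. \<theta> $ i"] by (simp add: o_def)
    also have "\<dots> / geo_mean \<theta> ^ CARD('k) = 1"
      unfolding geo_mean_power[OF \<theta>, symmetric] using geo_mean_pos[OF \<theta>] by simp
    finally have "weight \<theta> {} \<sigma> = 1" .
    moreover have "\<bar>wdet M {} a \<sigma>\<bar> = 1"
      unfolding wdet_def A det_permute_rows[OF perm] by (simp add: sign_def)
    ultimately show ?thesis by simp
  next
    case False
    then obtain i j where ij: "i \<noteq> j" "\<sigma> i = \<sigma> j" unfolding inj_def by blast
    have "wdet M {} a \<sigma> = 0"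
      unfolding wdet_def A by (rule det_identical_rows[OF ij(1)]) (simp add: row_def ij(2))
    then show ?thesis by simp
  qed
qed

lemma wdet_UNIV: "wdet M UNIV a \<sigma> = det a * det M"
proof -
  have "(\<chi> i. if i \<in> UNIV then M *v (a $ i) else axis (\<sigma> i) 1) = a ** transpose M"
    by (simp add: vec_eq_iff matrix_vector_mult_def matrix_matrix_mult_def transpose_def mult.commute)
  then show ?thesis unfolding wdet_def by (simp add: det_mul)
qed

lemma wnorm_UNIV: "wnorm \<theta> M UNIV a = \<bar>det a\<bar> * \<bar>det M\<bar>"
  using wnorm_attained[of \<theta> M UNIV a] by (auto simp: wdet_UNIV weight_def abs_mult)

text \<open>\<open>c\<close> is the determinant of the change of basis, filled up by the identity
  off \<open>I\<close>. As it depends neither on \<open>M\<close> nor on \<sigma>, comparing two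
  bases at the identity matrix compares them at all matrices and weights.\<close>

lemma wdet_change_basis:
  fixes a b :: "real ^ 'k ^ 'k"
  assumes "\<And>i. i \<in> I \<Longrightarrow> a $ i = (\<Sum>l\<in>I. m i l *\<^sub>R b $ l)"
  shows "\<exists>c. \<forall>M \<sigma>. wdet M I a \<sigma> = c * wdet M I b \<sigma>"
proof -
  define P :: "real ^ 'k ^ 'k" where
    "P = (\<chi> i l. if i \<in> I then (if l \<in> I then m i l else 0) else (if l = i then 1 else 0))"
  have "wdet M I a \<sigma> = det P * wdet M I b \<sigma>" for M \<sigma>
  proof -
    let ?B = "\<chi> i. if i \<in> I then M *v (b $ i) else axis (\<sigma> i) 1"
    have "(\<chi> i. if i \<in> I then M *v (a $ i) else axis (\<sigma> i) 1) $ i $ j = (P ** ?B) $ i $ j" for i j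
    proof (cases "i \<in> I")
      case True
      have "M *v (a $ i) = (\<Sum>l\<in>I. m i l *\<^sub>R (M *v (b $ l)))"
        unfolding assms[OF True] by (simp add: linear_sum[OF matrix_vector_mul_linear] matrix_vector_mult_scaleR)
      then have "(M *v (a $ i)) $ j = (\<Sum>l\<in>I. m i l * (M *v (b $ l)) $ j)" by simp
      also have "\<dots> = (\<Sum>l\<in>UNIV. (if l \<in> I then m i l else 0) * ?B $ l $ j)"
        by (intro sum.mono_neutral_cong_left) auto
      finally show ?thesis using True unfolding matrix_matrix_mult_def P_def by simp
    next
      case False
      have "(P ** ?B) $ i $ j = (\<Sum>l\<in>UNIV. (if l = i then 1 else 0) * ?B $ l $ j)"
        using False unfolding matrix_matrix_mult_def P_def by simp
      also have "\<dots> = (\<Sum>l\<in>UNIV. if l = i then ?B $ i $ j else 0)" by (intro sum.cong) auto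
      finally show ?thesis using False by simp
    qed
    then have "(\<chi> i. if i \<in> I then M *v (a $ i) else axis (\<sigma> i) 1) = P ** ?B" by (simp add: vec_eq_iff)
    then show ?thesis unfolding wdet_def by (simp add: det_mul)
  qed
  then show ?thesis by blast
qed

text \<open>A kernel vector of the transpose gives \<open>u\<close> in the span of the tuple with
  \<open>M *v u\<close> supported on the image of \<open>-I\<close> under \<sigma>, hence off
  \<open>J\<close>. So \<open>u = 0\<close>, and injectivity of \<sigma> removes the remaining
  coefficients.\<close>

lemma wdet_nonzero:
  fixes M a :: "real ^ 'k ^ 'k"
  assumes indep: "\<And>x. (\<Sum>i\<in>I. x i *\<^sub>R a $ i) = 0 \<Longrightarrow> \<forall>i\<in>I. x i = 0"
    and J: "\<And>x. (\<forall>j\<in>J. (M *v (\<Sum>i\<in>I. x i *\<^sub>R a $ i)) $ j = 0) \<Longrightarrow> (\<Sum>i\<in>I. x i *\<^sub>R a $ i) = 0"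
    and \<sigma>: "inj_on \<sigma> (-I)" "\<sigma> ` (-I) \<subseteq> -J"
  shows "wdet M I a \<sigma> \<noteq> 0"
proof
  let ?A = "\<chi> i. if i \<in> I then M *v (a $ i) else axis (\<sigma> i) 1"
  assume "wdet M I a \<sigma> = 0"
  then have "\<not> invertible (transpose ?A)" unfolding wdet_def by (simp add: invertible_det_nz)
  then obtain x where x: "x \<noteq> 0" "transpose ?A *v x = 0"
    using matrix_left_invertible_ker[of "transpose ?A"] invertible_left_inverse by blast
  define u where "u = (\<Sum>i\<in>I. x $ i *\<^sub>R a $ i)"
  have Mu: "M *v u = (\<Sum>i\<in>I. x $ i *\<^sub>R (M *v (a $ i)))"
    unfolding u_def by (simp add: linear_sum[OF matrix_vector_mul_linear] matrix_vector_mult_scaleR)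
  have comp: "(M *v u) $ j + (\<Sum>i\<in>-I. x $ i * axis (\<sigma> i) 1 $ j) = 0" for j
  proof -
    have "0 = (\<Sum>i\<in>UNIV. ?A $ i $ j * x $ i)"
      using x(2) by (simp add: vec_eq_iff matrix_vector_mult_def transpose_def)
    also have "\<dots> = (\<Sum>i\<in>I. ?A $ i $ j * x $ i) + (\<Sum>i\<in>-I. ?A $ i $ j * x $ i)"
      using sum.union_disjoint[of I "-I" "\<lambda>i. ?A $ i $ j * x $ i"] by (simp only: Compl_partition finite Compl_disjoint)
    also have "(\<Sum>i\<in>I. ?A $ i $ j * x $ i) = (M *v u) $ j"
      unfolding Mu by (simp add: mult.commute)
    also have "(\<Sum>i\<in>-I. ?A $ i $ j * x $ i) = (\<Sum>i\<in>-I. x $ i * axis (\<sigma> i) 1 $ j)"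
      by (intro sum.cong) auto
    finally show ?thesis by simp
  qed
  have "(M *v u) $ j = 0" if "j \<in> J" for j
  proof -
    have "x $ i * axis (\<sigma> i) 1 $ j = 0" if "i \<in> -I" for i
      using \<sigma>(2) that \<open>j \<in> J\<close> by (auto simp: axis_def)
    then show ?thesis using comp[of j] by (simp add: sum.neutral)
  qed
  then have u0: "u = 0" unfolding u_def by (intro J) blast
  then have xI: "\<forall>i\<in>I. x $ i = 0" unfolding u_def by (rule indep)
  have "x $ i = 0" if i: "i \<notin> I" for i
  proof -
    have "(\<Sum>i'\<in>-I. x $ i' * axis (\<sigma> i') 1 $ (\<sigma> i)) = (\<Sum>i'\<in>-I. if i' = i then x $ i else 0)"
      using \<sigma>(1) i by (intro sum.cong) (auto simp: axis_def inj_on_def)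
    then show ?thesis using comp[of "\<sigma> i"] u0 i by simp
  qed
  with xI have "x = 0" by (auto simp: vec_eq_iff)
  with x(1) show False ..
qed

lemma wdet_bound:
  fixes o' :: "real ^ 'k ^ 'k"
  assumes "\<And>i. i \<in> I \<Longrightarrow> norm (o' $ i) \<le> 1"
  shows "\<bar>wdet (mat 1) I o' \<sigma>\<bar> \<le> fact CARD('k)"
proof -
  let ?A = "\<chi> i. if i \<in> I then mat 1 *v (o' $ i) else axis (\<sigma> i) 1"
  have entry: "\<bar>?A $ i $ j\<bar> \<le> 1" for i j
    using assms[of i] component_le_norm_cart[of "o' $ i" j] by (auto simp: axis_def intro: order_trans)
  have "\<bar>det ?A\<bar> \<le> (\<Sum>p | p permutes (UNIV :: 'k set). \<bar>of_int (sign p) * (\<Prod>i\<in>UNIV. ?A $ i $ p i)\<bar>)"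
    unfolding det_def by (rule sum_abs)
  also have "\<dots> \<le> (\<Sum>p | p permutes (UNIV :: 'k set). 1)"
  proof (rule sum_mono)
    fix p :: "'k \<Rightarrow> 'k"
    have "\<bar>\<Prod>i\<in>UNIV. ?A $ i $ p i\<bar> \<le> 1" unfolding abs_prod using entry by (intro prod_le_1) auto
    then show "\<bar>of_int (sign p) * (\<Prod>i\<in>UNIV. ?A $ i $ p i)\<bar> \<le> 1" by (simp add: abs_mult sign_def)
  qed
  also have "\<dots> = fact CARD('k)" by (simp add: card_permutations)
  finally show ?thesis unfolding wdet_def .
qed

section \<open>Bases of subspaces and complementary rows\<close>

text \<open>Tuples are indexed by coordinates so that they can form part of the rows of a square
  matrix; rows off \<open>I\<close> are arbitrary.\<close>

definition tuple_basis :: "'k set \<Rightarrow> real ^ 'k ^ 'k \<Rightarrow> (real ^ 'k) set \<Rightarrow> bool" where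
  "tuple_basis I a W \<longleftrightarrow> W = span ((\<lambda>i. a $ i) ` I) \<and>
     (\<forall>x. (\<Sum>i\<in>I. x i *\<^sub>R a $ i) = 0 \<longrightarrow> (\<forall>i\<in>I. x i = 0))"

lemma span_tuple:
  fixes a :: "real ^ 'k ^ 'k"
  shows "span ((\<lambda>i. a $ i) ` I) = range (\<lambda>x. \<Sum>i\<in>I. x i *\<^sub>R a $ i)" (is "span ?T = ?R")
proof
  show "span (?T) \<subseteq> ?R"
  proof (rule span_minimal)
    show "?T \<subseteq> ?R"
    proof
      fix v assume "v \<in> ?T"
      then obtain i where i: "i \<in> I" "v = a $ i" by blast
      have "v = (\<Sum>l\<in>I. (if l = i then 1 else 0) *\<^sub>R a $ l)"
        using i by (simp add: if_distrib[of "\<lambda>c. c *\<^sub>R _"] cong: if_cong)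
      then show "v \<in> ?R"
        by (rule range_eqI[of _ _ "\<lambda>l. if l = i then 1 else 0"])
    qed
    show "subspace (?R)"
    proof (rule subspaceI)
      show "0 \<in> ?R" by (rule range_eqI[of _ _ "\<lambda>_. 0"]) simp
    next
      fix v w assume "v \<in> ?R" "w \<in> ?R"
      then obtain x y where "v = (\<Sum>i\<in>I. x i *\<^sub>R a $ i)" "w = (\<Sum>i\<in>I. y i *\<^sub>R a $ i)" by blast
      then have "v + w = (\<Sum>i\<in>I. (x i + y i) *\<^sub>R a $ i)" by (simp add: scaleR_add_left sum.distrib)
      then show "v + w \<in> ?R" by (intro range_eqI[of _ _ "\<lambda>i. x i + y i"])
    next
      fix c v assume "v \<in> ?R"
      then obtain x where "v = (\<Sum>i\<in>I. x i *\<^sub>R a $ i)" by blast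
      then have "c *\<^sub>R v = (\<Sum>i\<in>I. (c * x i) *\<^sub>R a $ i)" by (simp add: scaleR_sum_right)
      then show "c *\<^sub>R v \<in> ?R" by (intro range_eqI[of _ _ "\<lambda>i. c * x i"])
    qed
  qed
next
  show "?R \<subseteq> span (?T)"
  proof
    fix v assume "v \<in> ?R"
    then obtain x where "v = (\<Sum>i\<in>I. x i *\<^sub>R a $ i)" by blast
    then show "v \<in> span (?T)" by (simp add: span_sum span_scale span_base)
  qed
qed

lemma tuple_basis_elem:
  assumes "tuple_basis I a W" "w \<in> W"
  obtains x where "w = (\<Sum>i\<in>I. x i *\<^sub>R a $ i)"
  using assms span_tuple[of a I] unfolding tuple_basis_def by blast

lemma tuple_basis_mem:
  assumes "tuple_basis I a W"
  shows "(\<Sum>i\<in>I. x i *\<^sub>R a $ i) \<in> W" "i \<in> I \<Longrightarrow> a $ i \<in> W"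
  using assms span_tuple[of a I] span_superset[of "(\<lambda>i. a $ i) ` I"] unfolding tuple_basis_def by auto

lemma tuple_basis_subspace: "tuple_basis I a W \<Longrightarrow> subspace W"
  unfolding tuple_basis_def by simp

lemma tuple_basis_of_basis:
  fixes B :: "(real ^ 'k) set" and I :: "'k set"
  assumes B: "independent B" "W = span B" and h: "bij_betw h I B" and a: "\<And>i. i \<in> I \<Longrightarrow> a $ i = h i"
  shows "tuple_basis I a W"
proof -
  have img: "(\<lambda>i. a $ i) ` I = B" using h a unfolding bij_betw_def by (metis image_cong)
  have "x i = 0" if z: "(\<Sum>i\<in>I. x i *\<^sub>R a $ i) = 0" and i: "i \<in> I" for x i
  proof -
    define y where "y v = x (the_inv_into I h v)" for v
    have inj: "inj_on h I" using h unfolding bij_betw_def by blast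
    have yh: "y (h i) = x i" if "i \<in> I" for i unfolding y_def using the_inv_into_f_f[OF inj that] by simp
    have "(\<Sum>v\<in>B. y v *\<^sub>R v) = (\<Sum>i\<in>I. y (h i) *\<^sub>R h i)"
      by (rule sum.reindex_bij_betw[OF h, symmetric])
    also have "\<dots> = (\<Sum>i\<in>I. x i *\<^sub>R a $ i)" using yh a by (intro sum.cong) auto
    finally have "(\<Sum>v\<in>B. y v *\<^sub>R v) = 0" using z by simp
    moreover have "finite B" using h finite bij_betw_finite by blast
    ultimately have "y (h i) = 0"
      using independentD[OF B(1) _ subset_refl, of y "h i"] h i unfolding bij_betw_def by blast
    then show ?thesis using yh[OF i] by simp
  qed
  then show ?thesis unfolding tuple_basis_def img using B(2) by blast
qed

lemma tuple_basis_dim: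
  fixes a :: "real ^ 'k ^ 'k"
  assumes "tuple_basis I a W"
  shows "dim W = card I"
proof -
  have "inj_on (\<lambda>i. a $ i) I"
  proof (rule inj_onI, rule ccontr)
    fix i j assume ij: "i \<in> I" "j \<in> I" "a $ i = a $ j" "i \<noteq> j"
    let ?x = "\<lambda>l. if l = i then 1 else if l = j then -1 else (0::real)"
    have "(\<Sum>l\<in>I. ?x l *\<^sub>R a $ l) = (\<Sum>l\<in>I. (if l = i then a $ i else 0) + (if l = j then - a $ j else 0))"
      using ij(4) by (intro sum.cong) auto
    also have "\<dots> = 0" using ij by (simp add: sum.distrib)
    finally have z: "(\<Sum>l\<in>I. ?x l *\<^sub>R a $ l) = 0" .
    have "\<forall>x. (\<Sum>i\<in>I. x i *\<^sub>R a $ i) = 0 \<longrightarrow> (\<forall>i\<in>I. x i = 0)"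
      using assms unfolding tuple_basis_def by blast
    from bspec[OF mp[OF spec[OF this] z] ij(1)] show False by simp
  qed
  then have c: "card ((\<lambda>i. a $ i) ` I) = card I" by (rule card_image)
  have "independent ((\<lambda>i. a $ i) ` I)"
  proof (rule independent_if_scalars_zero)
    fix f v assume f: "(\<Sum>v\<in>(\<lambda>i. a $ i) ` I. f v *\<^sub>R v) = 0" and v: "v \<in> (\<lambda>i. a $ i) ` I"
    have "(\<Sum>i\<in>I. f (a $ i) *\<^sub>R a $ i) = 0"
      using f by (simp add: sum.reindex[OF \<open>inj_on (\<lambda>i. a $ i) I\<close>])
    moreover have "\<forall>x. (\<Sum>i\<in>I. x i *\<^sub>R a $ i) = 0 \<longrightarrow> (\<forall>i\<in>I. x i = 0)"
      using assms unfolding tuple_basis_def by blast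
    note spec[OF this, of "\<lambda>i. f (a $ i)"]
    ultimately have "\<forall>i\<in>I. f (a $ i) = 0" by blast
    then show "f v = 0" using v by blast
  qed simp
  then have "dim (span ((\<lambda>i. a $ i) ` I)) = card I" using c by (simp add: dim_eq_card_independent)
  then show ?thesis using assms unfolding tuple_basis_def by blast
qed

lemma tuple_basis_change:
  assumes "tuple_basis I a W" "tuple_basis I b W"
  shows "\<exists>c. \<forall>M \<sigma>. wdet M I a \<sigma> = c * wdet M I b \<sigma>"
proof -
  have "\<exists>x. a $ i = (\<Sum>l\<in>I. x l *\<^sub>R b $ l)" if "i \<in> I" for i
    using tuple_basis_elem[OF assms(2) tuple_basis_mem(2)[OF assms(1) that]] by metis
  then obtain m where "\<And>i. i \<in> I \<Longrightarrow> a $ i = (\<Sum>l\<in>I. m i l *\<^sub>R b $ l)" by metis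
  then show ?thesis by (rule wdet_change_basis)
qed

lemma tuple_basis_insert:
  assumes a: "tuple_basis I a W" and i0: "i0 \<notin> I" and v: "v \<notin> W"
    and b: "\<And>i. i \<in> I \<Longrightarrow> b $ i = a $ i" "b $ i0 = v"
  shows "tuple_basis (insert i0 I) b (span (insert v W))"
proof -
  have fI: "finite I" by simp
  have img: "(\<lambda>i. b $ i) ` insert i0 I = insert v ((\<lambda>i. a $ i) ` I)" using b by auto
  have eq: "span (insert v W) = span (insert v ((\<lambda>i. a $ i) ` I))"
  proof -
    have "W = span ((\<lambda>i. a $ i) ` I)" using a unfolding tuple_basis_def by blast
    then show ?thesis
      by (simp only: span_insert span_span)
  qed
  have zero: "\<forall>i\<in>insert i0 I. x i = 0" if z: "(\<Sum>i\<in>insert i0 I. x i *\<^sub>R b $ i) = 0" for x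
  proof -
    have "(\<Sum>i\<in>I. x i *\<^sub>R b $ i) = (\<Sum>i\<in>I. x i *\<^sub>R a $ i)" using b(1) by (intro sum.cong) auto
    then have e: "x i0 *\<^sub>R v + (\<Sum>i\<in>I. x i *\<^sub>R a $ i) = 0" using z i0 b(2) by simp
    have "x i0 = 0"
    proof (rule ccontr)
      assume n: "x i0 \<noteq> 0"
      have "v = (1 / x i0) *\<^sub>R (x i0 *\<^sub>R v)" using n by simp
      also have "x i0 *\<^sub>R v = - (\<Sum>i\<in>I. x i *\<^sub>R a $ i)" using e by (simp only: eq_neg_iff_add_eq_0)
      finally have "v = (1 / x i0) *\<^sub>R (- (\<Sum>i\<in>I. x i *\<^sub>R a $ i))" .
      moreover have "- (\<Sum>i\<in>I. x i *\<^sub>R a $ i) \<in> W"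
        by (intro subspace_neg tuple_basis_subspace[OF a] tuple_basis_mem(1)[OF a])
      ultimately have "v \<in> W" by (simp only: subspace_scale[OF tuple_basis_subspace[OF a]])
      with v show False ..
    qed
    moreover have "\<forall>i\<in>I. x i = 0"
    proof -
      have "(\<Sum>i\<in>I. x i *\<^sub>R a $ i) = 0" using e calculation by simp
      then show ?thesis using a unfolding tuple_basis_def by blast
    qed
    ultimately show ?thesis by blast
  qed
  show ?thesis unfolding tuple_basis_def img by (intro conjI eq allI impI zero)
qed

lemma complementary_vanish:
  fixes M :: "real ^ 'k ^ 'k"
  assumes "complementary V (span ((\<lambda>j. row j M) ` J))" and "\<And>v. v \<in> V \<Longrightarrow> orthogonal v u"
    and "\<forall>j\<in>J. (M *v u) $ j = 0"
  shows "u = 0"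
proof -
  have "orthogonal u w" if "w \<in> span ((\<lambda>j. row j M) ` J)" for w
  proof (rule orthogonal_to_span[OF that])
    fix x assume "x \<in> (\<lambda>j. row j M) ` J"
    then show "orthogonal u x"
      using assms(3) by (auto simp: orthogonal_def matrix_vector_mult_def row_def inner_vec_def mult.commute)
  qed
  moreover obtain v w where vw: "v \<in> V" "w \<in> span ((\<lambda>j. row j M) ` J)" "u = v + w"
    using assms(1) unfolding complementary_def by blast
  ultimately have "u \<bullet> w = 0" "u \<bullet> v = 0"
    using assms(2)[of v] by (auto simp: orthogonal_def inner_commute)
  moreover have "u \<bullet> u = u \<bullet> v + u \<bullet> w" using vw(3) by (metis inner_add_right)
  ultimately have "u \<bullet> u = 0" by simp
  then show ?thesis by simp
qed

text \<open>Exchange argument: if \<open>J\<close> is largest with row span meeting \<open>V\<close>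
  trivially, a row outside the sum could be added. The dimension formula then gives
  \<open>card J\<close>.\<close>

lemma exists_complementary_rows:
  fixes M :: "real ^ 'k ^ 'k"
  assumes M: "invertible M" and V: "subspace V"
  shows "\<exists>J. card J = codim V \<and> complementary V (span ((\<lambda>j. row j M) ` J))"
proof -
  let ?r = "\<lambda>J. (\<lambda>j. row j M) ` J"
  have rows: "inj (\<lambda>j. row j M)" "independent (range (\<lambda>j. row j M))" "span (range (\<lambda>j. row j M)) = UNIV"
  proof -
    show sp: "span (range (\<lambda>j. row j M)) = UNIV"
      using matrix_left_invertible_span_rows[of M] invertible_left_inverse[of M] M
      by (simp add: rows_def full_SetCompr_eq)
    then have d: "dim (range (\<lambda>j. row j M)) = CARD('k)" by (metis dim_UNIV dim_span DIM_cart DIM_real mult.right_neutral)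
    show "inj (\<lambda>j. row j M)"
    proof (rule eq_card_imp_inj_on)
      have "CARD('k) \<le> card (range (\<lambda>j. row j M))" using d dim_le_card'[of "range (\<lambda>j. row j M)"] by simp
      then show "card (range (\<lambda>j. row j M)) = CARD('k)" using card_image_le[of UNIV "\<lambda>j. row j M"] by simp
    qed simp
    then have "card (range (\<lambda>j. row j M)) = CARD('k)" by (simp add: card_image)
    then show "independent (range (\<lambda>j. row j M))"
      using sp d by (intro card_le_dim_spanning[of _ UNIV]) auto
  qed
  define P where "P J \<longleftrightarrow> V \<inter> span (?r J) = {0}" for J
  have "P {}" unfolding P_def using V by (auto simp: subspace_0)
  moreover have "\<forall>J. P J \<longrightarrow> card J < Suc CARD('k)" by (simp add: card_mono less_Suc_eq_le)
  ultimately obtain J where J: "P J" "\<And>J'. P J' \<Longrightarrow> card J' \<le> card J"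
    using ex_has_greatest_nat[of P "{}" card "Suc CARD('k)"] by blast
  let ?W = "span (?r J)"
  define T where "T = {v + w |v w. v \<in> V \<and> w \<in> ?W}"
  have TI: "v + w \<in> T" if "v \<in> V" "w \<in> ?W" for v w using that unfolding T_def by blast
  have sum: "T = UNIV"
  proof (rule ccontr)
    assume ne: "T \<noteq> UNIV"
    have ss: "subspace T" unfolding T_def using V by (intro subspace_sums) auto
    have "\<not> range (\<lambda>j. row j M) \<subseteq> T"
    proof
      assume "range (\<lambda>j. row j M) \<subseteq> T"
      then have "UNIV \<subseteq> T"
        unfolding rows(3)[symmetric] by (rule span_minimal[OF _ ss])
      then show False using ne by (simp only: top.extremum_unique)
    qed
    then obtain j where j: "row j M \<notin> T" by blast
    have "row j M \<notin> ?W"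
    proof
      assume "row j M \<in> ?W"
      from TI[OF subspace_0[OF V] this] j show False by simp
    qed
    then have jJ: "j \<notin> J" by (auto intro: span_base)
    have "P (insert j J)"
      unfolding P_def
    proof (intro equalityI subsetI)
      fix x assume x: "x \<in> V \<inter> span (?r (insert j J))"
      then obtain k where k: "x - k *\<^sub>R row j M \<in> ?W" by (auto simp: span_breakdown_eq)
      have "k = 0"
      proof (rule ccontr)
        assume "k \<noteq> 0"
        have "row j M = (1 / k) *\<^sub>R x + (- (1 / k)) *\<^sub>R (x - k *\<^sub>R row j M)"
          using \<open>k \<noteq> 0\<close> by (simp add: algebra_simps)
        moreover have "(1 / k) *\<^sub>R x \<in> V" using x V by (simp add: subspace_scale)
        moreover have "(- (1 / k)) *\<^sub>R (x - k *\<^sub>R row j M) \<in> ?W" using k by (rule span_scale)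
        ultimately show False using j TI by metis
      qed
      then have "x \<in> V \<inter> ?W" using x k by simp
      then show "x \<in> {0}" using J(1) unfolding P_def by simp
    qed (use V in \<open>auto simp: subspace_0 span_zero\<close>)
    then have "card (insert j J) \<le> card J" by (rule J(2))
    then show False using jJ by simp
  qed
  have dW: "dim ?W = card J"
  proof -
    have "independent (?r J)" using rows(2) by (rule independent_mono) auto
    moreover have "card (?r J) = card J" using rows(1) by (intro card_image) (rule inj_on_subset, auto)
    ultimately show ?thesis by (simp add: dim_eq_card_independent)
  qed
  have "dim T + dim (V \<inter> ?W) = dim V + dim ?W"
    unfolding T_def using V by (intro dim_sums_Int) auto
  then have "CARD('k) = dim V + card J"
    using J(1) dW unfolding sum P_def by simp
  then have "card J = codim V" unfolding codim_def by simp
  then show ?thesis using sum J(1) unfolding complementary_def P_def T_def by blast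
qed

section \<open>Rational subspaces\<close>

text \<open>A fixed enumeration yields one index set \<open>initial r\<close> per dimension, so all
  subspaces of equal dimension share their minors and weights.\<close>

definition idx :: "nat \<Rightarrow> 'k::finite" where
  "idx = (SOME e. bij_betw e {..<CARD('k)} UNIV)"

definition initial :: "nat \<Rightarrow> 'k::finite set" where
  "initial r = idx ` {..<r}"

lemma bij_betw_idx: "bij_betw idx {..<CARD('k)} (UNIV :: 'k::finite set)"
proof -
  have "\<exists>e. bij_betw e {..<CARD('k)} (UNIV :: 'k set)"
    using ex_bij_betw_nat_finite[of "UNIV :: 'k set"] by (simp add: atLeast0LessThan)
  then show ?thesis unfolding idx_def by (rule someI_ex)
qed

lemma card_initial:
  assumes "r \<le> CARD('k)"
  shows "card (initial r :: 'k::finite set) = r"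
proof -
  have "inj_on (idx :: nat \<Rightarrow> 'k) {..<r}"
    using bij_betw_idx[where 'k = 'k] assms unfolding bij_betw_def by (auto intro: inj_on_subset)
  then show ?thesis unfolding initial_def by (simp add: card_image)
qed

lemma initial_0: "initial 0 = {}"
  unfolding initial_def by simp

lemma initial_Suc: "initial (Suc r) = insert (idx r) (initial r)"
  unfolding initial_def by (simp add: lessThan_Suc)

lemma idx_notin:
  assumes "r < CARD('k)"
  shows "(idx r :: 'k::finite) \<notin> initial r"
proof
  assume "(idx r :: 'k) \<in> initial r"
  then have "(initial (Suc r) :: 'k set) = initial r" unfolding initial_Suc by blast
  then have "card (initial (Suc r) :: 'k set) = card (initial r :: 'k set)" by simp
  then show False using assms card_initial[where 'k = 'k, of "Suc r"] card_initial[where 'k = 'k, of r] by simp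
qed

lemma initial_CARD: "initial CARD('k) = (UNIV :: 'k::finite set)"
  using bij_betw_idx[where 'k = 'k] unfolding initial_def bij_betw_def by simp

lemma codim_orthogonal:
  fixes W :: "(real ^ 'k) set"
  assumes "subspace W"
  shows "codim {v. \<forall>w\<in>W. orthogonal w v} = dim W"
proof -
  have "dim {v \<in> UNIV. \<forall>w\<in>W. orthogonal w v} + dim W = dim (UNIV :: (real ^ 'k) set)"
    using assms by (intro dim_subspace_orthogonal_to_vectors) auto
  then show ?thesis unfolding codim_def by simp
qed

text \<open>The duality between \<open>Theta\<close> and minors: rows complementary to the
  orthogonal complement of \<open>W\<close> are rows for which the coordinates of
  \<open>M *v u\<close> in \<open>J\<close> determine \<open>u\<close> in \<open>W\<close>.\<close>

lemma tuple_basis_wdet_nonzero: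
  fixes a M :: "real ^ 'k ^ 'k"
  assumes a: "tuple_basis I a W" and J: "complementary {v. \<forall>w\<in>W. orthogonal w v} (span ((\<lambda>j. row j M) ` J))"
    and \<sigma>: "bij_betw \<sigma> (-I) (-J)"
  shows "wdet M I a \<sigma> \<noteq> 0"
proof (rule wdet_nonzero)
  show "\<forall>i\<in>I. x i = 0" if "(\<Sum>i\<in>I. x i *\<^sub>R a $ i) = 0" for x
    using a that unfolding tuple_basis_def by blast
  show "(\<Sum>i\<in>I. x i *\<^sub>R a $ i) = 0" if "\<forall>j\<in>J. (M *v (\<Sum>i\<in>I. x i *\<^sub>R a $ i)) $ j = 0" for x
  proof (rule complementary_vanish[OF J _ that])
    fix v assume "v \<in> {v. \<forall>w\<in>W. orthogonal w v}"
    then have "orthogonal (\<Sum>i\<in>I. x i *\<^sub>R a $ i) v" using tuple_basis_mem(1)[OF a] by blast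
    then show "orthogonal v (\<Sum>i\<in>I. x i *\<^sub>R a $ i)" by (simp add: orthogonal_commute)
  qed
  show "inj_on \<sigma> (-I)" "\<sigma> ` (-I) \<subseteq> -J" using \<sigma> unfolding bij_betw_def by auto
qed

lemma ex_bij_compl:
  fixes I J :: "'k::finite set"
  assumes "card I = card J"
  shows "\<exists>\<sigma>. bij_betw \<sigma> (-I) (-J)"
  using assms by (intro finite_same_card_bij) (simp_all add: Compl_eq_Diff_UNIV card_Diff_subset)

definition height :: "'k set \<Rightarrow> real ^ 'k ^ 'k \<Rightarrow> real" where
  "height I b = wnorm (\<chi> i. 1) (mat 1) I b"

lemma height_eq: "\<exists>\<sigma>. height I b = \<bar>wdet (mat 1) I b \<sigma>\<bar>" and height_ge: "\<bar>wdet (mat 1) I b \<sigma>\<bar> \<le> height I b"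
proof -
  have "weight (\<chi> i. 1) I \<tau> = 1" for \<tau> unfolding weight_def geo_mean_def by simp
  then show "\<exists>\<sigma>. height I b = \<bar>wdet (mat 1) I b \<sigma>\<bar>" "\<bar>wdet (mat 1) I b \<sigma>\<bar> \<le> height I b"
    unfolding height_def using wnorm_attained[of "\<chi> i. 1" "mat 1" I b] wnorm_ge[of "\<chi> i. 1" I \<sigma> "mat 1" b] by auto
qed

lemma height_pos:
  fixes b :: "real ^ 'k ^ 'k"
  assumes "tuple_basis I b W"
  shows "0 < height I b"
proof -
  let ?V = "{v. \<forall>w\<in>W. orthogonal w v}"
  have W: "subspace W" using tuple_basis_subspace[OF assms] .
  have V: "subspace ?V" by (rule subspace_orthogonal_to_vectors)
  have "invertible (mat 1 :: real ^ 'k ^ 'k)" unfolding invertible_def by (intro exI[of _ "mat 1"]) simp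
  from exists_complementary_rows[OF this V]
  obtain J :: "'k set" where J: "card J = codim ?V" "complementary ?V (span ((\<lambda>j. row j (mat 1)) ` J))"
    by (elim exE conjE)
  then have "card I = card J" using codim_orthogonal[OF W] tuple_basis_dim[OF assms] by simp
  then obtain \<sigma> where "bij_betw \<sigma> (-I) (-J)" using ex_bij_compl by blast
  from tuple_basis_wdet_nonzero[OF assms J(2) this] have "0 < \<bar>wdet (mat 1) I b \<sigma>\<bar>" by simp
  then show ?thesis using height_ge[of I b \<sigma>] by linarith
qed

section \<open>Integral bases of minimal height\<close>

definition int_vec :: "real ^ 'k \<Rightarrow> bool" where
  "int_vec v \<longleftrightarrow> (\<forall>i. v $ i \<in> \<int>)"

definition rational_subspace :: "(real ^ 'k) set \<Rightarrow> bool" where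
  "rational_subspace W \<longleftrightarrow> (\<exists>A. (\<forall>v\<in>A. int_vec v) \<and> W = span A)"

definition int_basis :: "(real ^ 'k) set \<Rightarrow> real ^ 'k ^ 'k \<Rightarrow> bool" where
  "int_basis W a \<longleftrightarrow> (\<forall>i\<in>initial (dim W). int_vec (a $ i)) \<and> tuple_basis (initial (dim W)) a W"

lemma dim_le_CARD: "dim (W :: (real ^ 'k) set) \<le> CARD('k)"
  using dim_subset_UNIV[of W] by simp

lemma int_basis_exists:
  fixes W :: "(real ^ 'k) set"
  assumes "rational_subspace W"
  shows "\<exists>a. int_basis W a"
proof -
  obtain A where A: "\<forall>v\<in>A. int_vec v" "W = span A" using assms unfolding rational_subspace_def by blast
  obtain B where B: "B \<subseteq> A" "independent B" "A \<subseteq> span B" "card B = dim A"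
    by (rule basis_exists[of A])
  have WB: "W = span B" unfolding A(2) using B(1,3) by (metis span_eq span_superset subset_trans)
  have "card (initial (dim W) :: 'k set) = card B" using B(4) A(2) card_initial[OF dim_le_CARD[of W]] by simp
  moreover have "finite B" using B(2) independent_imp_finite by blast
  ultimately obtain h where h: "bij_betw h (initial (dim W) :: 'k set) B"
    using finite_same_card_bij[of "initial (dim W)" B] by auto
  define a where "a = (\<chi> i. h i)"
  have "tuple_basis (initial (dim W)) a W"
    by (rule tuple_basis_of_basis[OF B(2) WB h]) (simp add: a_def)
  moreover have "\<forall>i\<in>initial (dim W). int_vec (a $ i)"
    using h A(1) B(1) unfolding a_def bij_betw_def by auto
  ultimately show ?thesis unfolding int_basis_def by blast
qed

text \<open>The minors of an integral basis are integers, and one of them is nonzero. Integrality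
  lets a minimum over all integral bases exist.\<close>

lemma int_basis_height:
  assumes "int_basis W a"
  shows "height (initial (dim W)) a = real (nat \<lfloor>height (initial (dim W)) a\<rfloor>)"
    and "1 \<le> height (initial (dim W)) a"
proof -
  let ?I = "initial (dim W)"
  obtain \<sigma> where \<sigma>: "height ?I a = \<bar>wdet (mat 1) ?I a \<sigma>\<bar>" using height_eq by blast
  have "(\<chi> i. if i \<in> ?I then mat 1 *v (a $ i) else axis (\<sigma> i) 1) $ i $ j \<in> \<int>" for i j
    using assms unfolding int_basis_def int_vec_def by (auto simp: axis_def)
  then have "wdet (mat 1) ?I a \<sigma> \<in> \<int>"
    unfolding wdet_def det_def by (intro Ints_sum Ints_mult Ints_prod) auto
  then have Z: "height ?I a \<in> \<int>" unfolding \<sigma> by (rule Ints_abs)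
  have pos: "0 < height ?I a" using assms height_pos unfolding int_basis_def by blast
  from Z obtain n where n: "height ?I a = of_int n" by (rule Ints_cases)
  with pos have "1 \<le> n" by simp
  then show "1 \<le> height ?I a" "height ?I a = real (nat \<lfloor>height ?I a\<rfloor>)" unfolding n by auto
qed

text \<open>Integral bases of minimal height serve as lattice bases of \<open>W \<inter> \<int>\<^sup>k\<close>; only their minimality is needed.\<close>

definition min_basis :: "(real ^ 'k) set \<Rightarrow> real ^ 'k ^ 'k" where
  "min_basis W = (SOME a. int_basis W a \<and>
     (\<forall>b. int_basis W b \<longrightarrow> height (initial (dim W)) a \<le> height (initial (dim W)) b))"

lemma min_basis:
  fixes W :: "(real ^ 'k) set"
  assumes "rational_subspace W"
  shows "int_basis W (min_basis W)"
    and "\<And>b. int_basis W b \<Longrightarrow> height (initial (dim W)) (min_basis W) \<le> height (initial (dim W)) b"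
proof -
  let ?I = "initial (dim W)"
  obtain a0 where "int_basis W a0" using int_basis_exists[OF assms] by blast
  then obtain a where a: "int_basis W a"
    "\<And>b. int_basis W b \<Longrightarrow> nat \<lfloor>height ?I a\<rfloor> \<le> nat \<lfloor>height ?I b\<rfloor>"
    using ex_has_least_nat[of "int_basis W" a0 "\<lambda>b. nat \<lfloor>height ?I b\<rfloor>"] by blast
  have "height ?I a \<le> height ?I b" if "int_basis W b" for b
    using a(2)[OF that] int_basis_height(1)[OF a(1)] int_basis_height(1)[OF that] by simp
  then have "\<exists>a. int_basis W a \<and> (\<forall>b. int_basis W b \<longrightarrow> height ?I a \<le> height ?I b)" using a(1) by blast
  from someI_ex[OF this] show "int_basis W (min_basis W)"
    "\<And>b. int_basis W b \<Longrightarrow> height (initial (dim W)) (min_basis W) \<le> height (initial (dim W)) b"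
    unfolding min_basis_def by blast+
qed

lemma wnorm_scale:
  assumes "\<And>\<sigma>. wdet M I b \<sigma> = c * wdet M I a \<sigma>"
  shows "wnorm \<theta> M I b = \<bar>c\<bar> * wnorm \<theta> M I a"
proof (rule antisym)
  show "wnorm \<theta> M I b \<le> \<bar>c\<bar> * wnorm \<theta> M I a"
  proof (rule wnorm_leI)
    fix \<sigma>
    have "\<bar>weight \<theta> I \<sigma> * wdet M I b \<sigma>\<bar> = \<bar>c\<bar> * \<bar>weight \<theta> I \<sigma> * wdet M I a \<sigma>\<bar>"
      unfolding assms abs_mult by simp
    then show "\<bar>weight \<theta> I \<sigma> * wdet M I b \<sigma>\<bar> \<le> \<bar>c\<bar> * wnorm \<theta> M I a"
      using wnorm_ge[of \<theta> I \<sigma> M a] by (simp add: mult_left_mono)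
  qed
  obtain \<sigma> where "wnorm \<theta> M I a = \<bar>weight \<theta> I \<sigma> * wdet M I a \<sigma>\<bar>" using wnorm_attained by blast
  then have "\<bar>c\<bar> * wnorm \<theta> M I a = \<bar>weight \<theta> I \<sigma> * wdet M I b \<sigma>\<bar>" unfolding assms abs_mult by simp
  then show "\<bar>c\<bar> * wnorm \<theta> M I a \<le> wnorm \<theta> M I b" using wnorm_ge[of \<theta> I \<sigma> M b] by simp
qed

text \<open>The factor between two bases is the same for every \<open>M\<close> and \<theta>.
  Minimality of the height, which is the case of the identity, forces its absolute value to be at
  least 1.\<close>

lemma wnorm_min_basis_le:
  assumes W: "rational_subspace W" and b: "int_basis W b"
  shows "wnorm \<theta> M (initial (dim W)) (min_basis W) \<le> wnorm \<theta> M (initial (dim W)) b"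
proof -
  let ?I = "initial (dim W)" and ?a = "min_basis W"
  have a: "int_basis W ?a" by (rule min_basis(1)[OF W])
  obtain c where c: "\<And>M \<sigma>. wdet M ?I b \<sigma> = c * wdet M ?I ?a \<sigma>"
    using tuple_basis_change[of ?I b W ?a] a b unfolding int_basis_def by blast
  have "1 * height ?I ?a \<le> \<bar>c\<bar> * height ?I ?a"
    using min_basis(2)[OF W b] wnorm_scale[OF c] unfolding height_def by simp
  then have "1 \<le> \<bar>c\<bar>" using int_basis_height(2)[OF a] by simp
  then show ?thesis
    unfolding wnorm_scale[OF c] using wnorm_nonneg[of \<theta> M ?I ?a] mult_right_mono[of 1 "\<bar>c\<bar>"] by simp
qed

section \<open>Chains of rational subspaces\<close>

definition proper_rational_subspaces :: "(real ^ 'k) set set" where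
  "proper_rational_subspaces = {W. rational_subspace W \<and> 0 < dim W \<and> dim W < CARD('k)}"

definition comparable :: "'a set \<Rightarrow> 'a set \<Rightarrow> bool" where
  "comparable W W' \<longleftrightarrow> W \<subset> W' \<or> W' \<subset> W"

lemma card_clique:
  fixes F :: "(real ^ 'k) set set"
  assumes "F \<subseteq> proper_rational_subspaces" "pairwise comparable F"
  shows "card F \<le> CARD('k)"
proof -
  have sp: "span W = W" if "W \<in> F" for W
    using that assms(1) unfolding proper_rational_subspaces_def rational_subspace_def by auto
  have "inj_on dim F"
  proof (rule inj_onI, rule ccontr)
    fix W W' assume W: "W \<in> F" "W' \<in> F" "dim W = dim W'" "W \<noteq> W'"
    then have "W \<subset> W' \<or> W' \<subset> W" using assms(2) unfolding pairwise_def comparable_def by blast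
    then show False using dim_psubset[of W W'] dim_psubset[of W' W] W sp by auto
  qed
  then have "card F = card (dim ` F)" by (simp add: card_image)
  also have "\<dots> \<le> card {..<CARD('k)}"
    using assms(1) unfolding proper_rational_subspaces_def by (intro card_mono) auto
  finally show ?thesis by simp
qed

text \<open>If \<open>W0\<close> is the largest member of the marking chain (or zero) that misses \<open>v\<close>, then the span of \<open>W0\<close>
  and \<open>v\<close> is comparable to the whole chain, but its covolume is too small.\<close>

lemma marked_no_small_vector:
  fixes \<theta> v :: "real ^ 'k"
  assumes mk: "marked proper_rational_subspaces comparable
      (\<lambda>W x. wnorm \<theta> (G x) (initial (dim W)) (min_basis W)) \<epsilon> \<rho> \<rho>' {} x"
    and \<theta>: "\<And>i. 0 < \<theta> $ i" and \<rho>': "\<rho>' \<le> 1" and \<epsilon>: "real CARD('k) * geo_mean \<theta> < \<epsilon>" "\<epsilon> \<le> \<rho>"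
    and det: "real CARD('k) * geo_mean \<theta> < \<bar>det (G x)\<bar>"
    and v: "int_vec v" "v \<noteq> 0"
  shows "\<exists>j. \<theta> $ j < \<bar>(G x *v v) $ j\<bar>"
proof (rule ccontr)
  assume "\<not> ?thesis"
  then have small: "\<bar>(G x *v v) $ j\<bar> \<le> \<theta> $ j" for j by (simp add: not_less)
  let ?\<psi> = "\<lambda>W. wnorm \<theta> (G x) (initial (dim W)) (min_basis W)"
  from mk obtain F where F0: "F \<subseteq> proper_rational_subspaces \<and> finite F \<and> pairwise comparable F"
    and lohi0: "\<forall>W\<in>F - {}. \<epsilon> \<le> ?\<psi> W \<and> ?\<psi> W \<le> \<rho>'"
    and other0: "\<forall>W\<in>proper_rational_subspaces. W \<notin> F \<and> (\<forall>W'\<in>F. comparable W W') \<longrightarrow> \<rho> \<le> ?\<psi> W"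
    unfolding marked_def by (elim exE conjE) (rule that; (intro conjI)?; assumption)
  note F = F0[THEN conjunct1] F0[THEN conjunct2, THEN conjunct1] F0[THEN conjunct2, THEN conjunct2]
  have lohi: "\<epsilon> \<le> ?\<psi> W \<and> ?\<psi> W \<le> \<rho>'" if "W \<in> F" for W
    using bspec[OF lohi0, of W] that by simp
  have other: "\<rho> \<le> ?\<psi> W" if "W \<in> proper_rational_subspaces" "W \<notin> F" "\<forall>W'\<in>F. comparable W W'" for W
    using bspec[OF other0 that(1)] that(2,3) by simp
  have sub: "subspace W" if "W \<in> F" for W
    using that F(1) unfolding proper_rational_subspaces_def rational_subspace_def by auto
  have "\<exists>W0. rational_subspace W0 \<and> v \<notin> W0 \<and> ?\<psi> W0 \<le> 1 \<and> (\<forall>W\<in>F. v \<notin> W \<longrightarrow> W \<subseteq> W0) \<and> (\<forall>W\<in>F. v \<in> W \<longrightarrow> W0 \<subseteq> W)"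
  proof (cases "{W \<in> F. v \<notin> W} = {}")
    case True
    have "rational_subspace {0 :: real ^ 'k}"
      unfolding rational_subspace_def by (intro exI[of _ "{}"]) simp
    moreover have "?\<psi> {0} \<le> 1" using wnorm_empty[OF \<theta>] by (simp add: initial_0)
    ultimately show ?thesis using True v(2) sub subspace_0 by (intro exI[of _ "{0}"]) auto
  next
    case False
    define A where "A = {W \<in> F. v \<notin> W}"
    have "finite A" "A \<noteq> {}" using F(2) False unfolding A_def by auto
    then obtain W0 where W0: "W0 \<in> A" "\<forall>W\<in>A. W0 \<subseteq> W \<longrightarrow> W0 = W"
      using finite_has_maximal[of A] by blast
    have "W \<subseteq> W0" if "W \<in> A" for W
      using W0 that F(3) unfolding A_def pairwise_def comparable_def by blast
    moreover have "W0 \<subseteq> W" if "W \<in> F" "v \<in> W" for W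
      using W0(1) that F(3) unfolding A_def pairwise_def comparable_def by blast
    moreover have "?\<psi> W0 \<le> 1" using lohi[of W0] W0(1) \<rho>' unfolding A_def by auto
    moreover have "rational_subspace W0" using W0(1) F(1) unfolding A_def proper_rational_subspaces_def by blast
    ultimately show ?thesis using W0(1) unfolding A_def by (intro exI[of _ W0]) blast
  qed
  then obtain W0 where W0: "rational_subspace W0" "v \<notin> W0" "?\<psi> W0 \<le> 1"
    and below: "\<forall>W\<in>F. v \<notin> W \<longrightarrow> W \<subseteq> W0" and above: "\<forall>W\<in>F. v \<in> W \<longrightarrow> W0 \<subseteq> W"
    by (elim exE conjE) (rule that; assumption)
  define W1 where "W1 = span (insert v W0)"
  have sW0: "span W0 = W0" using W0(1) unfolding rational_subspace_def by auto
  have d1: "dim W1 = Suc (dim W0)" unfolding W1_def dim_span dim_insert sW0 using W0(2) by simp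
  have d0: "dim W0 < CARD('k)" using dim_le_CARD[of W1] d1 by simp
  have R1: "rational_subspace W1"
  proof -
    obtain A where "\<forall>w\<in>A. int_vec w" "W0 = span A" using W0(1) unfolding rational_subspace_def by blast
    moreover from this have "W1 = span (insert v A)" unfolding W1_def by (simp only: span_insert span_span)
    ultimately show ?thesis
      unfolding rational_subspace_def using v(1) by (intro exI[of _ "insert v A"]) auto
  qed
  have vW1: "v \<in> W1" unfolding W1_def by (simp add: span_base)
  have W01: "W0 \<subseteq> W1" unfolding W1_def by (auto intro: span_base)
  let ?i = "idx (dim W0) :: 'k"
  define b where "b = (\<chi> i. if i = ?i then v else min_basis W0 $ i)"
  have ni: "?i \<notin> initial (dim W0)" by (rule idx_notin[OF d0])
  have bb: "\<And>i. i \<in> initial (dim W0) \<Longrightarrow> b $ i = min_basis W0 $ i" "b $ ?i = v"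
    unfolding b_def using ni by auto
  have a0: "int_basis W0 (min_basis W0)" by (rule min_basis(1)[OF W0(1)])
  have "tuple_basis (insert ?i (initial (dim W0))) b (span (insert v W0))"
    using a0 by (intro tuple_basis_insert[OF _ ni W0(2) bb]) (auto simp: int_basis_def)
  then have tb: "tuple_basis (initial (dim W1)) b W1"
    unfolding d1 initial_Suc unfolding W1_def .
  have "int_basis W1 b"
    unfolding int_basis_def using tb a0 bb v(1)
    by (auto simp: d1 initial_Suc int_basis_def)
  then have "?\<psi> W1 \<le> wnorm \<theta> (G x) (initial (dim W1)) b" by (rule wnorm_min_basis_le[OF R1])
  also have "\<dots> \<le> real CARD('k) * geo_mean \<theta> * ?\<psi> W0"
    unfolding d1 initial_Suc by (rule wnorm_insert[OF \<theta> ni small bb])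
  also have "\<dots> \<le> real CARD('k) * geo_mean \<theta> * 1"
    using W0(3) geo_mean_pos[OF \<theta>] by (intro mult_left_mono) auto
  finally have up: "?\<psi> W1 \<le> real CARD('k) * geo_mean \<theta>" by simp
  show False
  \<comment> \<open>Every position of \<open>W1\<close> contradicts \<open>up\<close>: the whole
    space has norm at least \<open>\<bar>det (G x)\<bar>\<close>, a member of the chain at least
    \<epsilon>, any other subspace comparable to the chain at least \<rho>.\<close>
  proof (cases "dim W1 = CARD('k)")
    case True
    have U: "initial (dim W1) = (UNIV :: 'k set)" unfolding True by (rule initial_CARD)
    have "1 \<le> height (initial (dim W1)) (min_basis W1)" by (rule int_basis_height(2)[OF min_basis(1)[OF R1]])
    then have "1 \<le> \<bar>det (min_basis W1)\<bar>" unfolding U height_def wnorm_UNIV by simp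
    then have "1 * \<bar>det (G x)\<bar> \<le> ?\<psi> W1" unfolding U wnorm_UNIV by (intro mult_right_mono) auto
    then show False using up det by simp
  next
    case False
    then have "W1 \<in> proper_rational_subspaces"
      unfolding proper_rational_subspaces_def using R1 d1 dim_le_CARD[of W1] by auto
    show False
    proof (cases "W1 \<in> F")
      case True
      then show False using lohi[OF True] up \<epsilon> by simp
    next
      case nF: False
      have "comparable W1 W" if W: "W \<in> F" for W
      proof (cases "v \<in> W")
        case True
        have "W1 \<subseteq> W"
          unfolding W1_def using above W True sub[OF W] by (intro span_minimal) auto
        then show ?thesis using W nF unfolding comparable_def by blast
      next
        case False
        then have "W \<subset> W1" using below W False W01 vW1 by blast
        then show ?thesis unfolding comparable_def by blast
      qed
      then have "\<rho> \<le> ?\<psi> W1" using other[OF \<open>W1 \<in> proper_rational_subspaces\<close> nF] by blast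
      then show False using up \<epsilon> by simp
    qed
  qed
qed

section \<open>Lower bounds from the transversality quantity\<close>

text \<open>Normalized bases for the subspaces of dimension \<open>r\<close>; the remaining rows are
  fixed at 0 for the sake of compactness.\<close>

definition orthonormal_tuples :: "nat \<Rightarrow> (real ^ 'k ^ 'k) set" where
  "orthonormal_tuples r = {q. (\<forall>i\<in>initial r. \<forall>j\<in>initial r. q $ i \<bullet> q $ j = (if i = j then 1 else 0)) \<and>
     (\<forall>i\<in>-initial r. q $ i = 0)}"

lemma compact_orthonormal_tuples: "compact (orthonormal_tuples r :: (real ^ 'k ^ 'k) set)"
proof -
  have "orthonormal_tuples r = (\<Inter>i\<in>initial r. \<Inter>j\<in>initial r. {q :: real ^ 'k ^ 'k. q $ i \<bullet> q $ j = (if i = j then 1 else 0)}) \<inter>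
    (\<Inter>i\<in>-initial r. {q. q $ i = 0})"
    unfolding orthonormal_tuples_def by auto
  moreover have "closed {q :: real ^ 'k ^ 'k. q $ i \<bullet> q $ j = (if i = j then 1 else 0)}" for i j
    by (intro closed_Collect_eq continuous_intros continuous_on_component)
  moreover have "closed {q :: real ^ 'k ^ 'k. q $ i = 0}" for i
    by (intro closed_Collect_eq continuous_intros continuous_on_component)
  ultimately have "closed (orthonormal_tuples r :: (real ^ 'k ^ 'k) set)"
    by (auto intro!: closed_Int closed_INT)
  moreover have "norm q \<le> real CARD('k)" if "q \<in> orthonormal_tuples r" for q :: "real ^ 'k ^ 'k"
  proof -
    have "norm (q $ i) \<le> 1" for i
      using that unfolding orthonormal_tuples_def norm_eq_sqrt_inner by (cases "i \<in> initial r") auto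
    then have "(\<Sum>i\<in>UNIV. norm (q $ i)) \<le> (\<Sum>i\<in>(UNIV :: 'k set). 1)" by (intro sum_mono)
    moreover have "norm q \<le> (\<Sum>i\<in>UNIV. norm (q $ i))"
      unfolding norm_vec_def by (rule L2_set_le_sum) auto
    ultimately show ?thesis by simp
  qed
  ultimately show ?thesis unfolding compact_eq_bounded_closed bounded_iff by blast
qed

lemma orthonormal_tuple_basis:
  fixes q :: "real ^ 'k ^ 'k"
  assumes "q \<in> orthonormal_tuples r"
  shows "tuple_basis (initial r) q (span ((\<lambda>i. q $ i) ` initial r))"
  unfolding tuple_basis_def
proof (intro conjI refl allI impI ballI)
  fix x :: "'k \<Rightarrow> real" and i :: 'k assume z: "(\<Sum>i\<in>initial r. x i *\<^sub>R q $ i) = 0" and i: "i \<in> initial r"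
  have "0 = (\<Sum>l\<in>initial r. x l *\<^sub>R q $ l) \<bullet> q $ i" unfolding z by simp
  also have "\<dots> = (\<Sum>l\<in>initial r. x l * (q $ l \<bullet> q $ i))" by (simp add: inner_sum_left)
  also have "\<dots> = (\<Sum>l\<in>initial r. if l = i then x i else 0)"
    using assms i unfolding orthonormal_tuples_def by (intro sum.cong) auto
  finally show "x i = 0" using i by simp
qed

lemma orthonormal_tuple_exists:
  fixes W :: "(real ^ 'k) set"
  assumes "subspace W"
  shows "\<exists>q\<in>orthonormal_tuples (dim W). tuple_basis (initial (dim W)) q W"
proof -
  obtain B where B: "B \<subseteq> W" "pairwise orthogonal B" "\<And>x. x \<in> B \<Longrightarrow> norm x = 1"
    "independent B" "card B = dim W" "span B = W"
    using orthonormal_basis_subspace[OF assms] by metis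
  have "card (initial (dim W) :: 'k set) = card B" using B(5) card_initial[OF dim_le_CARD[of W]] by simp
  moreover have "finite B" using B(4) independent_imp_finite by blast
  ultimately obtain h where h: "bij_betw h (initial (dim W) :: 'k set) B"
    using finite_same_card_bij[of "initial (dim W)" B] by auto
  define q where "q = (\<chi> i. if i \<in> initial (dim W) then h i else 0)"
  have "tuple_basis (initial (dim W)) q W"
    by (rule tuple_basis_of_basis[OF B(4) B(6)[symmetric] h]) (simp add: q_def)
  moreover have "h i \<bullet> h j = (if i = j then 1 else 0)" if "i \<in> initial (dim W)" "j \<in> initial (dim W)" for i j
  proof (cases "i = j")
    case True
    then show ?thesis using B(3)[of "h i"] h that unfolding bij_betw_def by (auto simp: norm_eq_1)
  next
    case False
    then have "h i \<noteq> h j" using h that unfolding bij_betw_def inj_on_def by blast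
    moreover have "h i \<in> B" "h j \<in> B" using h that unfolding bij_betw_def by auto
    ultimately have "orthogonal (h i) (h j)" using B(2) unfolding pairwise_def by blast
    then show ?thesis using False by (simp add: orthogonal_def)
  qed
  then have "q \<in> orthonormal_tuples (dim W)"
    unfolding orthonormal_tuples_def q_def by auto
  ultimately show ?thesis by blast
qed

lemma continuous_on_wdet: "continuous_on A (\<lambda>q. wdet M I q \<sigma>)"
proof -
  have "continuous_on A (\<lambda>q. if i \<in> I then q $ i $ j else c)" for i j and c :: real
    by (cases "i \<in> I") (auto intro!: continuous_intros continuous_on_component)
  then show ?thesis unfolding wdet_expand
    by (intro continuous_on_sum continuous_on_mult continuous_on_prod continuous_on_const)
qed

definition wdet_gap :: "('a \<Rightarrow> real ^ 'k ^ 'k) \<Rightarrow> 'a set \<Rightarrow> real \<Rightarrow> bool" where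
  "wdet_gap G B \<delta> \<longleftrightarrow> (\<forall>r<CARD('k). \<forall>\<Sigma>.
    (\<forall>q\<in>orthonormal_tuples r. \<exists>y\<in>B. \<exists>\<sigma>\<in>\<Sigma>. wdet (G y) (initial r) q \<sigma> \<noteq> 0) \<longrightarrow>
    (\<forall>q\<in>orthonormal_tuples r. \<exists>y\<in>B. \<exists>\<sigma>\<in>\<Sigma>. \<delta> \<le> \<bar>wdet (G y) (initial r) q \<sigma>\<bar>))"

text \<open>The set \<open>\<Sigma>\<close> is the only trace of \<open>\<theta>\<close>. As it ranges over a finite type, \<open>\<delta>\<close> does not depend on \<open>\<theta>\<close>.\<close>

lemma uniform_wdet_lower_bound:
  fixes G :: "'a \<Rightarrow> real ^ 'k ^ 'k"
  shows "\<exists>\<delta>>0. wdet_gap G B \<delta>"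
proof -
  let ?P = "\<lambda>r \<Sigma> \<delta>. (\<forall>q\<in>orthonormal_tuples r. \<exists>y\<in>B. \<exists>\<sigma>\<in>\<Sigma>. wdet (G y) (initial r) q \<sigma> \<noteq> 0) \<longrightarrow>
    (\<forall>q\<in>orthonormal_tuples r. \<exists>y\<in>B. \<exists>\<sigma>\<in>\<Sigma>. \<delta> \<le> \<bar>wdet (G y) (initial r) q \<sigma>\<bar>)"
  have ex: "\<exists>\<delta>>0. ?P r \<Sigma> \<delta>" for r and \<Sigma> :: "('k \<Rightarrow> 'k) set"
  proof (cases "\<forall>q\<in>orthonormal_tuples r. \<exists>y\<in>B. \<exists>\<sigma>\<in>\<Sigma>. wdet (G y) (initial r) q \<sigma> \<noteq> 0")
    case False
    then show ?thesis by (intro exI[of _ 1]) auto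
  next
    case True
    \<comment> \<open>For fixed \<open>y\<close> and \<sigma> the inequality is open in
      \<open>q\<close>. The sets increase with \<open>n\<close>, so a finite subcover reduces to one
      threshold.\<close>
    define O' where "O' n = (\<Union>y\<in>B. \<Union>\<sigma>\<in>\<Sigma>. {q. 1 / real (Suc n) < \<bar>wdet (G y) (initial r) q \<sigma>\<bar>})" for n
    have "open (O' n)" for n
      unfolding O'_def by (intro open_UN ballI open_Collect_less continuous_on_rabs continuous_on_wdet continuous_on_const)
    moreover have "orthonormal_tuples r \<subseteq> (\<Union>n\<in>UNIV. O' n)"
    proof
      fix q :: "real ^ 'k ^ 'k" assume "q \<in> orthonormal_tuples r"
      then obtain y \<sigma> where "y \<in> B" "\<sigma> \<in> \<Sigma>" "0 < \<bar>wdet (G y) (initial r) q \<sigma>\<bar>" using True by auto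
      moreover from this obtain n where "1 / real (Suc n) < \<bar>wdet (G y) (initial r) q \<sigma>\<bar>"
        using nat_approx_posE by metis
      ultimately show "q \<in> (\<Union>n\<in>UNIV. O' n)" unfolding O'_def by blast
    qed
    ultimately obtain N where N: "finite N" "orthonormal_tuples r \<subseteq> (\<Union>n\<in>N. O' n)"
      using compactE_image[OF compact_orthonormal_tuples, of UNIV O' r] by metis
    define n where "n = Max (insert 0 N)"
    have "\<exists>y\<in>B. \<exists>\<sigma>\<in>\<Sigma>. 1 / real (Suc n) \<le> \<bar>wdet (G y) (initial r) q \<sigma>\<bar>" if q: "q \<in> orthonormal_tuples r" for q
    proof -
      obtain m where "m \<in> N" "q \<in> O' m" using N(2) q by blast
      then obtain y \<sigma> where y: "y \<in> B" "\<sigma> \<in> \<Sigma>" "1 / real (Suc m) < \<bar>wdet (G y) (initial r) q \<sigma>\<bar>"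
        unfolding O'_def by blast
      have "m \<le> n" unfolding n_def using N(1) \<open>m \<in> N\<close> by (intro Max_ge) auto
      then have "1 / real (Suc n) \<le> 1 / real (Suc m)" by (intro divide_left_mono) auto
      with y show ?thesis by (meson less_imp_le order_trans)
    qed
    then show ?thesis by (intro exI[of _ "1 / real (Suc n)"]) auto
  qed
  have "\<forall>p. \<exists>\<delta>>0. ?P (fst p) (snd p) \<delta>" using ex by blast
  from choice[OF this] obtain \<delta> where \<delta>: "\<And>p. 0 < \<delta> p" "\<And>p. ?P (fst p) (snd p) (\<delta> p)" by blast
  define X where "X = {..<CARD('k)} \<times> (UNIV :: ('k \<Rightarrow> 'k) set set)"
  define d where "d = Min (insert 1 (\<delta> ` X))"
  have fin: "finite (insert 1 (\<delta> ` X))" unfolding X_def by simp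
  have "0 < d" unfolding d_def using fin \<delta>(1) by (subst Min_gr_iff) auto
  moreover have "?P r \<Sigma> d" if r: "r < CARD('k)" for r \<Sigma>
  proof -
    have "d \<le> \<delta> (r, \<Sigma>)" unfolding d_def using fin r by (intro Min_le) (auto simp: X_def)
    then show ?thesis using \<delta>(2)[of "(r, \<Sigma>)"] unfolding fst_conv snd_conv by (meson order_trans)
  qed
  ultimately show ?thesis unfolding wdet_gap_def by blast
qed

text \<open>The numbers \<open>\<theta> $ j / geo_mean \<theta>\<close> have product 1, so the
  products over \<open>J\<close> and over its complement are inverse to each other.\<close>

lemma weight_of_complement:
  fixes \<theta> :: "real ^ 'k"
  assumes \<theta>: "\<And>i. 0 < \<theta> $ i" and \<sigma>: "bij_betw \<sigma> (-I) (-J)" and c: "card I = card J"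
  shows "weight \<theta> I \<sigma> * ((\<Prod>j\<in>J. \<theta> $ j) / geo_mean \<theta> ^ card I) = 1"
proof -
  let ?t = "geo_mean \<theta>"
  have t: "0 < ?t" by (rule geo_mean_pos[OF \<theta>])
  have "weight \<theta> I \<sigma> = (\<Prod>j\<in>-J. \<theta> $ j / ?t)"
    unfolding weight_def by (rule prod.reindex_bij_betw[OF \<sigma>])
  moreover have "(\<Prod>j\<in>J. \<theta> $ j) / ?t ^ card I = (\<Prod>j\<in>J. \<theta> $ j / ?t)"
    unfolding c by (simp add: prod_dividef)
  moreover have "(\<Prod>j\<in>-J. \<theta> $ j / ?t) * (\<Prod>j\<in>J. \<theta> $ j / ?t) = (\<Prod>j\<in>UNIV. \<theta> $ j / ?t)"
    using prod.union_disjoint[of "-J" J "\<lambda>j. \<theta> $ j / ?t"] by simp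
  moreover have "(\<Prod>j\<in>UNIV. \<theta> $ j / ?t) = 1"
  proof -
    have "(\<Prod>j\<in>UNIV. \<theta> $ j / ?t) = (\<Prod>j\<in>UNIV. \<theta> $ j) / ?t ^ CARD('k)" by (simp add: prod_dividef)
    then show ?thesis unfolding geo_mean_power[OF \<theta>, symmetric] using t by simp
  qed
  ultimately show ?thesis by simp
qed

lemma Theta_bounded:
  fixes G :: "real ^ 'd \<Rightarrow> real ^ 'k ^ 'k"
  shows "\<exists>K. \<forall>x V. Theta G \<theta> x V \<le> K"
proof -
  define f where "f p = (\<Prod>j\<in>fst p. \<theta> $ j) / geo_mean \<theta> ^ snd p" for p :: "'k set \<times> nat"
  \<comment> \<open>\<open>Min {}\<close> is the value of \<open>Theta\<close> where no
    \<open>J\<close> is complementary, as can happen if \<open>G x\<close> is singular.\<close>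
  define S where "S = insert (Min {}) (f ` (UNIV \<times> {..CARD('k)}))"
  have S: "finite S" unfolding S_def by simp
  have "Theta G \<theta> x V \<in> S" for x V
  proof -
    define A where "A = {(\<Prod>j\<in>J. \<theta> $ j) / geo_mean \<theta> ^ codim V | J :: 'k set.
            card J = codim V \<and> complementary V (span ((\<lambda>j. row j (G x)) ` J))}"
    have A: "A \<subseteq> f ` (UNIV \<times> {..CARD('k)})"
      unfolding A_def f_def codim_def by (auto intro!: image_eqI[of _ _ "(_, CARD('k) - dim V)"])
    have "finite A" using A by (rule finite_subset) simp
    then have "A = {} \<or> Min A \<in> A" using Min_in by blast
    moreover have "Theta G \<theta> x V = Min A" unfolding Theta_def A_def ..
    ultimately show ?thesis using A unfolding S_def by auto
  qed
  then have "\<forall>x V. Theta G \<theta> x V \<le> Max S" using S by (auto intro: Max_ge)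
  then show ?thesis by blast
qed

text \<open>Finiteness makes \<open>enn2real\<close> faithful, and uniformity in \<open>x\<close>
  makes the real supremum in the final estimate a genuine upper bound.\<close>

lemma Theta_hat_bounded:
  fixes G :: "real ^ 'd \<Rightarrow> real ^ 'k ^ 'k"
  shows "\<exists>K\<ge>0. \<forall>x. Theta_hat G \<theta> x \<le> ennreal K"
proof -
  obtain K where K: "\<And>x V. Theta G \<theta> x V \<le> K" using Theta_bounded[of G \<theta>] by blast
  have "Theta_hat_at G \<theta> x V \<le> ennreal (max K 0)" for x V
  proof -
    have "Theta_hat_at G \<theta> x V \<le> Limsup (at x) (\<lambda>x. ennreal (Theta G \<theta> x V))"
      unfolding Theta_hat_at_def by (intro Liminf_le_Limsup) auto
    also have "\<dots> \<le> ennreal (max K 0)"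
      using K by (intro Limsup_bounded always_eventually) (auto intro!: ennreal_leI simp: le_max_iff_disj)
    finally show ?thesis .
  qed
  then have "\<forall>x. Theta_hat G \<theta> x \<le> ennreal (max K 0)"
    unfolding Theta_hat_def by (auto intro!: SUP_least)
  then show ?thesis by (intro exI[of _ "max K 0"]) auto
qed

lemma Theta_attained:
  fixes G :: "real ^ 'd \<Rightarrow> real ^ 'k ^ 'k"
  assumes M: "invertible (G x)" and V: "subspace V"
  obtains J where "card J = codim V" "complementary V (span ((\<lambda>j. row j (G x)) ` J))"
    "Theta G \<theta> x V = (\<Prod>j\<in>J. \<theta> $ j) / geo_mean \<theta> ^ codim V"
proof -
  define A where "A = {(\<Prod>j\<in>J. \<theta> $ j) / geo_mean \<theta> ^ codim V | J :: 'k set.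
            card J = codim V \<and> complementary V (span ((\<lambda>j. row j (G x)) ` J))}"
  have "A \<subseteq> (\<lambda>J. (\<Prod>j\<in>J. \<theta> $ j) / geo_mean \<theta> ^ codim V) ` UNIV" unfolding A_def by auto
  then have "finite A" by (rule finite_subset) simp
  moreover have "A \<noteq> {}"
    using exists_complementary_rows[OF M V] unfolding A_def by auto
  ultimately have "Min A \<in> A" by (rule Min_in)
  moreover have "Theta G \<theta> x V = Min A" unfolding Theta_def A_def ..
  ultimately show ?thesis using that unfolding A_def by auto
qed

text \<open>A liminf below \<open>T\<close> gives a \<open>y\<close> in the ball with
  \<open>Theta G \<theta> y V < T\<close>, for \<open>V\<close> the orthogonal complement of the
  span of \<open>q\<close>. A minimizing \<open>J\<close> names a nonzero minor whose weight, the
  inverse of \<open>Theta\<close>, is at least \<open>1 / T\<close>.\<close>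

lemma wdet_nonzero_of_Theta_hat:
  fixes G :: "real ^ 'd \<Rightarrow> real ^ 'k ^ 'k" and \<theta> :: "real ^ 'k"
  assumes \<theta>: "\<And>i. 0 < \<theta> $ i" and inv: "\<And>y. y \<in> ball c r \<Longrightarrow> invertible (G y)" and r: "0 < r"
    and T: "enn2real (Theta_hat G \<theta> c) < T"
    and n: "0 < n" "n < CARD('k)" and q: "q \<in> orthonormal_tuples n"
  shows "\<exists>y\<in>ball c r. \<exists>\<sigma>\<in>{\<sigma>. 1 / T \<le> weight \<theta> (initial n) \<sigma>}. wdet (G y) (initial n) q \<sigma> \<noteq> 0"
proof -
  let ?I = "initial n :: 'k set"
  define W where "W = span ((\<lambda>i. q $ i) ` ?I)"
  have tb: "tuple_basis ?I q W" unfolding W_def by (rule orthonormal_tuple_basis[OF q])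
  have W: "subspace W" unfolding W_def by simp
  define V where "V = {v. \<forall>w\<in>W. orthogonal w v}"
  have cI: "card ?I = n" using n by (intro card_initial) simp
  have cV: "codim V = n" unfolding V_def codim_orthogonal[OF W] tuple_basis_dim[OF tb] cI ..
  have V: "subspace V" unfolding V_def by (rule subspace_orthogonal_to_vectors)
  have T0: "0 < T" using T by (rule le_less_trans[OF enn2real_nonneg])
  obtain K where "Theta_hat G \<theta> c \<le> ennreal K" using Theta_hat_bounded[of G \<theta>] by blast
  then have fin: "Theta_hat G \<theta> c < top" by (rule le_less_trans) simp
  have "Theta_hat_at G \<theta> c V \<le> Theta_hat G \<theta> c"
    unfolding Theta_hat_def using V cV n by (intro SUP_upper) auto
  also have "\<dots> < ennreal T"
  proof -
    have "Theta_hat G \<theta> c = ennreal (enn2real (Theta_hat G \<theta> c))" using fin by (simp add: ennreal_enn2real)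
    also have "\<dots> < ennreal T" using T by (intro ennreal_lessI T0)
    finally show ?thesis .
  qed
  finally have lim: "Theta_hat_at G \<theta> c V < ennreal T" .
  have "\<exists>y\<in>ball c r. Theta G \<theta> y V < T"
  proof (rule ccontr)
    assume "\<not> ?thesis"
    then have "eventually (\<lambda>y. ennreal T \<le> ennreal (Theta G \<theta> y V)) (at c)"
      unfolding eventually_at using r by (intro exI[of _ r]) (auto simp: dist_commute not_less intro!: ennreal_leI)
    then have "ennreal T \<le> Theta_hat_at G \<theta> c V" unfolding Theta_hat_at_def by (rule Liminf_bounded)
    with lim show False by simp
  qed
  then obtain y where y: "y \<in> ball c r" "Theta G \<theta> y V < T" by blast
  obtain J where J: "card J = codim V" "complementary V (span ((\<lambda>j. row j (G y)) ` J))"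
    "Theta G \<theta> y V = (\<Prod>j\<in>J. \<theta> $ j) / geo_mean \<theta> ^ codim V"
    by (rule Theta_attained[of G y V \<theta>, OF inv[OF y(1)] V])
  have cIJ: "card ?I = card J" using cI J(1) cV by simp
  then obtain \<sigma> where \<sigma>: "bij_betw \<sigma> (-?I) (-J)" using ex_bij_compl by blast
  have "wdet (G y) ?I q \<sigma> \<noteq> 0"
    by (rule tuple_basis_wdet_nonzero[OF tb _ \<sigma>]) (use J(2) V_def in simp)
  moreover have "1 / T \<le> weight \<theta> ?I \<sigma>"
  proof -
    have "weight \<theta> ?I \<sigma> * Theta G \<theta> y V = 1"
      using weight_of_complement[OF \<theta> \<sigma> cIJ] unfolding J(3) cV cI .
    moreover have "weight \<theta> ?I \<sigma> * Theta G \<theta> y V \<le> weight \<theta> ?I \<sigma> * T"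
      using y(2) weight_pos[OF \<theta>, of ?I \<sigma>] by (intro mult_left_mono) auto
    ultimately show ?thesis using T0 by (simp add: field_simps)
  qed
  ultimately show ?thesis using y(1) by blast
qed

section \<open>The measure estimate\<close>

text \<open>These are the fixed analytic functions. All index sets occur in one finite family, so a
  single pair of constants serves subspaces of every dimension.\<close>

definition minor_fun ::
  "('a \<Rightarrow> real ^ 'k ^ 'k) \<Rightarrow> 'k set \<times> ('k \<Rightarrow> 'k) \<Rightarrow> 'a \<Rightarrow> real" where
  "minor_fun G p x = det (\<chi> i. if i \<in> fst p then column (snd p i) (G x) else axis (snd p i) 1)"

lemma wdet_lincomb: "\<exists>w. \<forall>x. k * wdet (G x) I a \<sigma> = lincomb (minor_fun G) w x"
proof -
  define u where "u f = k * (\<Prod>i\<in>UNIV. if i \<in> I then a $ i $ f i else if f i = \<sigma> i then 1 else 0)" for f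
  define w where "w = (\<chi> p. if fst p = I then u (snd p) else 0)"
  have "k * wdet (G x) I a \<sigma> = lincomb (minor_fun G) w x" for x
  proof -
    have "lincomb (minor_fun G) w x = (\<Sum>p\<in>range (Pair I). w $ p * minor_fun G p x)"
      unfolding lincomb_def by (rule sum.mono_neutral_right) (auto simp: w_def)
    also have "\<dots> = (\<Sum>f\<in>UNIV. w $ (I, f) * minor_fun G (I, f) x)"
      by (subst sum.reindex) (auto simp: inj_on_def)
    also have "\<dots> = (\<Sum>f\<in>UNIV. k * ((\<Prod>i\<in>UNIV. if i \<in> I then a $ i $ f i else if f i = \<sigma> i then 1 else 0) *
        det (\<chi> i. if i \<in> I then column (f i) (G x) else axis (f i) 1)))"
      unfolding w_def u_def minor_fun_def by (intro sum.cong refl) (simp add: mult.assoc cong: if_cong)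
    also have "\<dots> = k * wdet (G x) I a \<sigma>"
      unfolding wdet_expand sum_distrib_left ..
    finally show ?thesis ..
  qed
  then show ?thesis by blast
qed

lemma good_on_subset: "good_on B C \<alpha> f \<Longrightarrow> B' \<subseteq> B \<Longrightarrow> good_on B' C \<alpha> f"
  unfolding good_on_def by (meson continuous_on_subset order_trans)

lemma continuous_on_Max_finite:
  fixes h :: "'s \<Rightarrow> 'a::topological_space \<Rightarrow> real"
  assumes "finite S" "S \<noteq> {}" "\<And>s. s \<in> S \<Longrightarrow> continuous_on B (h s)"
  shows "continuous_on B (\<lambda>x. Max ((\<lambda>s. h s x) ` S))"
  using assms
proof (induction S rule: finite_ne_induct)
  case (insert s S)
  then have "continuous_on B (\<lambda>x. max (h s x) (Max ((\<lambda>s. h s x) ` S)))"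
    by (intro continuous_on_max) auto
  then show ?case using insert(1,2) by simp
qed auto

text \<open>The sublevel set of a maximum lies in that of each member; the member that attains the
  maximum at \<open>z\<close> gives the estimate with the same constant.\<close>

lemma good_on_Max:
  fixes g :: "'s::finite \<Rightarrow> 'a::euclidean_space \<Rightarrow> real"
  assumes g: "\<And>s. good_on B C \<alpha> (g s)"
  shows "good_on B C \<alpha> (\<lambda>x. Max (range (\<lambda>s. \<bar>g s x\<bar>)))"
  unfolding good_on_def
proof (intro conjI allI impI)
  let ?M = "\<lambda>x. Max (range (\<lambda>s. \<bar>g s x\<bar>))"
  show cont: "continuous_on B ?M"
    using g unfolding good_on_def by (intro continuous_on_Max_finite continuous_on_rabs) auto
  fix c r z and \<epsilon> :: real assume a: "ball c r \<subseteq> B \<and> z \<in> ball c r \<and> 0 < \<epsilon>"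
  have ge: "\<bar>g s x\<bar> \<le> ?M x" for s x by (intro Max_ge) auto
  have nn: "0 \<le> ?M x" for x using ge[of undefined x] by (rule order_trans[rotated]) simp
  have "?M z \<in> range (\<lambda>s. \<bar>g s z\<bar>)" by (rule Max_in) auto
  then obtain s where s: "?M z = \<bar>g s z\<bar>" by blast
  have gc: "continuous_on B (g s)" using g unfolding good_on_def by blast
  have B: "ball c r \<subseteq> B" using a by blast
  have "vol {x \<in> ball c r. \<bar>?M x\<bar> < \<epsilon>} \<le> vol {x \<in> ball c r. \<bar>g s x\<bar> < \<epsilon>}"
  proof (rule measure_mono_fmeasurable)
    show "{x \<in> ball c r. \<bar>?M x\<bar> < \<epsilon>} \<subseteq> {x \<in> ball c r. \<bar>g s x\<bar> < \<epsilon>}"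
    proof
      fix x assume "x \<in> {x \<in> ball c r. \<bar>?M x\<bar> < \<epsilon>}"
      then have "x \<in> ball c r" "?M x < \<epsilon>" using nn[of x] by auto
      then show "x \<in> {x \<in> ball c r. \<bar>g s x\<bar> < \<epsilon>}" using ge[of s x] by simp
    qed
    show "{x \<in> ball c r. \<bar>?M x\<bar> < \<epsilon>} \<in> sets lebesgue"
      using sublevel_lmeasurable[OF cont B] by (rule fmeasurableD)
    show "{x \<in> ball c r. \<bar>g s x\<bar> < \<epsilon>} \<in> lmeasurable" by (rule sublevel_lmeasurable[OF gc B])
  qed
  then have "vol {x \<in> ball c r. \<bar>?M x\<bar> < \<epsilon>} * \<bar>?M z\<bar> powr \<alpha>
     \<le> vol {x \<in> ball c r. \<bar>g s x\<bar> < \<epsilon>} * \<bar>g s z\<bar> powr \<alpha>"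
    unfolding s by (intro mult_mono) auto
  also have "\<dots> \<le> C * \<epsilon> powr \<alpha> * vol (ball c r)"
    using good_onD[OF g B, of z \<epsilon> s] a by blast
  finally show "vol {x \<in> ball c r. \<bar>?M x\<bar> < \<epsilon>} * \<bar>?M z\<bar> powr \<alpha>
     \<le> C * \<epsilon> powr \<alpha> * vol (ball c r)" .
qed

text \<open>\<theta>, \<open>I\<close> and \<open>a\<close> enter only through the coefficients of
  combinations of the \<open>minor_fun G p\<close>, hence affect neither radius nor constant nor
  exponent.\<close>

lemma wnorm_good:
  fixes G :: "real ^ 'd \<Rightarrow> real ^ 'k ^ 'k"
  assumes U: "open U" "x0 \<in> U" and G: "\<And>i j. real_analytic_on (\<lambda>x. G x $ i $ j) U"
  shows "\<exists>R C \<alpha>. 0 < R \<and> 0 < C \<and> 0 < \<alpha> \<and> ball x0 R \<subseteq> U \<and>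
    (\<forall>\<theta> I a. good_on (ball x0 R) C \<alpha> (\<lambda>x. wnorm \<theta> (G x) I a))"
proof -
  obtain e where e: "0 < e" "ball x0 e \<subseteq> U" using U openE by blast
  have "\<forall>p. \<exists>R>0. \<exists>F. complex_extension (polydisc x0 R) (\<lambda>x. G x $ fst p $ snd p) F"
    using real_analytic_complex_extension[OF G U(2)] by blast
  from choice[OF this] obtain \<rho> where \<rho>: "\<And>p. 0 < \<rho> p"
    "\<And>p. \<exists>F. complex_extension (polydisc x0 (\<rho> p)) (\<lambda>x. G x $ fst p $ snd p) F" by blast
  define R where "R = Min (insert 1 (insert e (range \<rho>)))"
  have fin: "finite (insert 1 (insert e (range \<rho>)))" by simp
  have R: "0 < R" unfolding R_def using fin \<rho>(1) e(1) by (subst Min_gr_iff) auto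
  have R1: "R \<le> 1" "R \<le> e" "\<And>p. R \<le> \<rho> p" unfolding R_def by (rule Min_le[OF fin], blast)+
  have ext: "\<exists>F. complex_extension (polydisc x0 R) (\<lambda>x. G x $ i $ j) F" for i j
    using \<rho>(2)[of "(i, j)"] complex_extension_mono[OF _ polydisc_mono[OF R1(3)]] by fastforce
  have "\<exists>F. complex_extension (polydisc x0 R) (minor_fun G p) F" for p
  proof -
    have entry: "\<exists>F. complex_extension (polydisc x0 R)
        (\<lambda>x. (\<chi> i. if i \<in> fst p then column (snd p i) (G x) else axis (snd p i) 1) $ i $ j) F" for i j
      using ext[of j "snd p i"] complex_extension_const by (cases "i \<in> fst p") (auto simp: column_def)
    show ?thesis using complex_extension_det[OF entry] unfolding minor_fun_def .
  qed
  then obtain F where F: "\<And>p. complex_extension (polydisc x0 R) (minor_fun G p) (F p)" by metis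
  from linear_combinations_good[of x0 R "minor_fun G" F, OF F R R1(1)]
  obtain R2 C \<alpha> where R2: "0 < R2" "R2 \<le> R" and C: "0 < C" "0 < \<alpha>"
    and good: "\<forall>w. good_on (ball x0 R2) C \<alpha> (lincomb (minor_fun G) w)"
    by (elim exE conjE) (rule that; assumption)
  have "good_on (ball x0 R2) C \<alpha> (\<lambda>x. wnorm \<theta> (G x) I a)" for \<theta> I a
    unfolding wnorm_def
  proof (rule good_on_Max)
    fix \<sigma>
    obtain w where "\<forall>x. weight \<theta> I \<sigma> * wdet (G x) I a \<sigma> = lincomb (minor_fun G) w x"
      using wdet_lincomb by blast
    then have "(\<lambda>x. weight \<theta> I \<sigma> * wdet (G x) I a \<sigma>) = lincomb (minor_fun G) w" by blast
    then show "good_on (ball x0 R2) C \<alpha> (\<lambda>x. weight \<theta> I \<sigma> * wdet (G x) I a \<sigma>)" using good by simp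
  qed
  moreover have "ball x0 R2 \<subseteq> U" using e(2) R1(2) R2(2) subset_ball[of R2 e x0] by (meson order_trans)
  ultimately show ?thesis using R2(1) C by blast
qed

text \<open>\<open>wdet_gap\<close> concerns orthonormal bases. Passing to the integral basis
  multiplies minors by \<open>k\<close>, with \<open>\<bar>k\<bar>\<close> at least
  \<open>1 / fact CARD('k)\<close>: at the identity matrix some integral minor is at least 1 in
  size, while orthonormal ones are at most \<open>fact CARD('k)\<close>.\<close>

lemma wnorm_lower_bound:
  fixes G :: "real ^ 'd \<Rightarrow> real ^ 'k ^ 'k" and \<theta> :: "real ^ 'k"
  assumes \<theta>: "\<And>i. 0 < \<theta> $ i" and inv: "\<And>y. y \<in> ball c r \<Longrightarrow> invertible (G y)" and r: "0 < r"
    and T: "enn2real (Theta_hat G \<theta> c) < T" and \<delta>: "0 < \<delta>"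
    and low: "wdet_gap G (ball c r) \<delta>"
    and W: "W \<in> proper_rational_subspaces"
  shows "\<exists>y\<in>ball c r. \<delta> / fact CARD('k) / T \<le> wnorm \<theta> (G y) (initial (dim W)) (min_basis W)"
proof -
  let ?n = "dim W" and ?a = "min_basis W"
  let ?\<Sigma> = "{\<sigma>. 1 / T \<le> weight \<theta> (initial ?n) \<sigma>}"
  have T0: "0 < T" using T by (rule le_less_trans[OF enn2real_nonneg])
  have n: "0 < ?n" "?n < CARD('k)" and rat: "rational_subspace W" using W unfolding proper_rational_subspaces_def by auto
  have sW: "subspace W" using rat unfolding rational_subspace_def by auto
  obtain q where q: "q \<in> orthonormal_tuples ?n" "tuple_basis (initial ?n) q W"
    using orthonormal_tuple_exists[OF sW] by blast
  have "\<forall>q\<in>orthonormal_tuples ?n. \<exists>y\<in>ball c r. \<exists>\<sigma>\<in>?\<Sigma>. wdet (G y) (initial ?n) q \<sigma> \<noteq> 0"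
    by (intro ballI wdet_nonzero_of_Theta_hat[OF \<theta> inv r T n])
  with low n(2) have "\<forall>q\<in>orthonormal_tuples ?n. \<exists>y\<in>ball c r. \<exists>\<sigma>\<in>?\<Sigma>. \<delta> \<le> \<bar>wdet (G y) (initial ?n) q \<sigma>\<bar>" unfolding wdet_gap_def by blast
  with q(1) obtain y \<sigma> where y: "y \<in> ball c r" "1 / T \<le> weight \<theta> (initial ?n) \<sigma>"
    "\<delta> \<le> \<bar>wdet (G y) (initial ?n) q \<sigma>\<bar>" by blast
  have a: "int_basis W ?a" by (rule min_basis(1)[OF rat])
  then obtain k where k: "\<And>M \<sigma>. wdet M (initial ?n) ?a \<sigma> = k * wdet M (initial ?n) q \<sigma>"
    using tuple_basis_change[of "initial ?n" ?a W q] q(2) unfolding int_basis_def by blast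
  have "1 \<le> \<bar>k\<bar> * fact CARD('k)"
  proof -
    obtain \<tau> where \<tau>: "height (initial ?n) ?a = \<bar>wdet (mat 1) (initial ?n) ?a \<tau>\<bar>" using height_eq by blast
    have "norm (q $ i) \<le> 1" if "i \<in> initial ?n" for i
      using q(1) that unfolding orthonormal_tuples_def norm_eq_sqrt_inner by auto
    then have "\<bar>wdet (mat 1) (initial ?n) q \<tau>\<bar> \<le> fact CARD('k)" by (rule wdet_bound)
    then have "\<bar>k\<bar> * \<bar>wdet (mat 1) (initial ?n) q \<tau>\<bar> \<le> \<bar>k\<bar> * fact CARD('k)" by (rule mult_left_mono) simp
    then show ?thesis using int_basis_height(2)[OF a] unfolding \<tau> k abs_mult by linarith
  qed
  then have "1 / fact CARD('k) \<le> \<bar>k\<bar>" by (simp add: field_simps)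
  then have "1 / T * (1 / fact CARD('k) * \<delta>) \<le> weight \<theta> (initial ?n) \<sigma> * (\<bar>k\<bar> * \<bar>wdet (G y) (initial ?n) q \<sigma>\<bar>)"
    using y(2,3) \<delta> T0 weight_pos[OF \<theta>] by (intro mult_mono) (auto intro: less_imp_le)
  also have "\<dots> = \<bar>weight \<theta> (initial ?n) \<sigma> * wdet (G y) (initial ?n) ?a \<sigma>\<bar>"
    unfolding k abs_mult using weight_pos[OF \<theta>, of "initial ?n" \<sigma>] by simp
  also have "\<dots> \<le> wnorm \<theta> (G y) (initial ?n) ?a" by (rule wnorm_ge)
  finally have "1 / T * (1 / fact CARD('k) * \<delta>) \<le> wnorm \<theta> (G y) (initial ?n) ?a" .
  moreover have "1 / T * (1 / fact CARD('k) * \<delta>) = \<delta> / fact CARD('k) / T" by simp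
  ultimately show ?thesis using y(1) by metis
qed

text \<open>From \<open>a + b \<le> 2 * a * max 1 b\<close>. It separates the doubling constant from
  the supremum of \<open>Theta_hat\<close>, which enter \<rho> as a sum.\<close>

lemma powr_add_le:
  fixes a b \<alpha> :: real
  assumes "1 \<le> a" "0 \<le> b" "0 < \<alpha>"
  shows "(a + b) powr \<alpha> \<le> (2 * a) powr \<alpha> * (1 + b powr \<alpha>)"
proof -
  have "a + b \<le> 2 * a * max 1 b"
  proof (cases "b \<le> 1")
    case True
    then show ?thesis using assms by simp
  next
    case False
    have "a * 1 \<le> a * b" "1 * b \<le> a * b" using False assms by (intro mult_left_mono mult_right_mono; simp)+
    then have "a + b \<le> 2 * (a * b)" by linarith
    then show ?thesis using False by simp
  qed
  then have "(a + b) powr \<alpha> \<le> (2 * a * max 1 b) powr \<alpha>" using assms by (intro powr_mono2) auto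
  also have "\<dots> = (2 * a) powr \<alpha> * (max 1 b) powr \<alpha>" using assms by (subst powr_mult) auto
  also have "(max 1 b) powr \<alpha> \<le> 1 + b powr \<alpha>" by (cases "b \<le> 1") (auto simp: max_def)
  finally show ?thesis using assms by (simp add: mult_left_mono)
qed

theorem theorem5p2:
  fixes U :: "(real ^ 'd) set"
    and G :: "real ^ 'd \<Rightarrow> real ^ 'k ^ 'k"
    and x0 :: "real ^ 'd"
  assumes "open U" and "analytic_GL_on G U" and "x0 \<in> U"
  shows "\<exists>r0 > 0. ball x0 r0 \<subseteq> U \<and>
    (\<exists>K0 > 0. \<exists>\<alpha> > 0. \<forall>c r. r > 0 \<and> ball c r \<subseteq> ball x0 r0 \<longrightarrow>
      (\<exists>\<delta> > 0. \<forall>\<theta> :: real ^ 'k. (\<forall>i. \<theta> $ i > 0) \<longrightarrow>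
        measure lebesgue (ball c r \<inter> approx_set U G \<theta>) \<le>
          K0 * (1 + (SUP x\<in>ball c r. enn2real (Theta_hat G \<theta> x) powr \<alpha> / \<delta> powr \<alpha>))
             * geo_mean \<theta> powr \<alpha> * measure lebesgue (ball c r)))"
proof -
  have inv: "invertible (G x)" if "x \<in> U" for x using assms(2) that unfolding analytic_GL_on_def by blast
  have an: "real_analytic_on (\<lambda>x. G x $ i $ j) U" for i j using assms(2) unfolding analytic_GL_on_def by blast
  let ?k = "real CARD('k)" and ?N = "CARD('k)" and ?d = "DIM(real ^ 'd)"
  obtain R C \<alpha> where R: "0 < R" "ball x0 R \<subseteq> U" and C: "0 < C" "0 < \<alpha>"
    and good: "\<And>\<theta> I a. good_on (ball x0 R) C \<alpha> (\<lambda>x. wnorm \<theta> (G x) I a)"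
    using wnorm_good[OF assms(1,3) an] by blast
  define c0 where "c0 = \<bar>det (G x0)\<bar> / 2"
  have c0: "0 < c0" unfolding c0_def using inv[OF assms(3)] by (simp add: invertible_det_nz)
  \<comment> \<open>The absolute determinant is the norm for the full index set, so its continuity
    is part of goodness.\<close>
  have "continuous_on (ball x0 R) (\<lambda>x. \<bar>det (G x)\<bar>)"
    using good[of 1 UNIV "mat 1"] unfolding good_on_def wnorm_UNIV by simp
  then have "open (ball x0 R \<inter> (\<lambda>x. \<bar>det (G x)\<bar>) -` {c0<..})" by (intro continuous_open_preimage) auto
  moreover have "x0 \<in> ball x0 R \<inter> (\<lambda>x. \<bar>det (G x)\<bar>) -` {c0<..}" using R c0 unfolding c0_def by auto
  ultimately obtain R1 where R1: "0 < R1" "ball x0 R1 \<subseteq> ball x0 R \<inter> (\<lambda>x. \<bar>det (G x)\<bar>) -` {c0<..}"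
    by (rule openE)
  have goodR1: "good_on (ball x0 R1) C \<alpha> (\<lambda>x. wnorm \<theta> (G x) I a)" for \<theta> I a
    by (rule good_on_subset[OF good]) (use R1 in blast)
  define L :: real where "L = 11 ^ ?N"
  have L: "1 \<le> L" unfolding L_def by (rule one_le_power) simp
  \<comment> \<open>A ball inside \<open>ball x0 r0\<close> stays in \<open>ball x0 R1\<close> after
    the dilation by \<open>11 ^ CARD('k)\<close> that the induction requires.\<close>
  define r0 where "r0 = R1 / (1 + L)"
  have r0: "0 < r0" "r0 + L * r0 = R1" 
  proof -
    have "0 < 1 + L" using L by linarith
    then show "0 < r0" unfolding r0_def using R1(1) by (intro divide_pos_pos)
    have "r0 + L * r0 = (1 + L) * r0" by (simp only: distrib_right mult_1)
    also have "\<dots> = R1" unfolding r0_def using \<open>0 < 1 + L\<close> by simp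
    finally show "r0 + L * r0 = R1" .
  qed
  moreover have "0 \<le> L * r0" using L r0(1) by (intro mult_nonneg_nonneg) linarith+
  ultimately have r01: "r0 \<le> R1" by linarith
  define Q where "Q = max 1 ((C * 5 ^ ?d) powr (1 / \<alpha>))"
  define CN where "CN = C * ?N * (15 ^ ?d) ^ ?N"
  \<comment> \<open>The first summand covers the main case and that of
    \<open>2 * ?k * geo_mean \<theta>\<close> above \<rho>, the second that of the same number above
    \<open>c0\<close>.\<close>
  define K0 where "K0 = (2 * ?k * (2 * Q)) powr \<alpha> * (CN + 1) + (2 * ?k / c0) powr \<alpha>"
  have Q: "1 \<le> Q" "(C * 5 ^ ?d) powr (1 / \<alpha>) \<le> Q" unfolding Q_def by auto
  have CN: "0 \<le> CN" unfolding CN_def using C by simp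
  have K0: "0 < K0" 
  proof -
    have "0 < (2 * ?k * (2 * Q)) powr \<alpha>" "0 < CN + 1" using Q CN by auto
    from mult_pos_pos[OF this] show ?thesis unfolding K0_def by (rule add_pos_nonneg) simp
  qed
  have "\<exists>\<delta>>0. \<forall>\<theta> :: real ^ 'k. (\<forall>i. \<theta> $ i > 0) \<longrightarrow>
        vol (ball c r \<inter> approx_set U G \<theta>) \<le>
          K0 * (1 + (SUP x\<in>ball c r. enn2real (Theta_hat G \<theta> x) powr \<alpha> / \<delta> powr \<alpha>))
             * geo_mean \<theta> powr \<alpha> * vol (ball c r)"
    if r: "0 < r" and B: "ball c r \<subseteq> ball x0 r0" for c r
  proof -
    have BU: "ball c r \<subseteq> U" using B r01 R1 R subset_ball[OF r01, of x0] by blast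
    have inv': "invertible (G y)" if "y \<in> ball c r" for y using inv BU that by blast
    obtain \<delta>1 where \<delta>1: "0 < \<delta>1" and low: "wdet_gap G (ball c r) \<delta>1"
      using uniform_wdet_lower_bound[of G "ball c r"] by blast
    define \<delta> where "\<delta> = \<delta>1 / fact CARD('k)"
    have \<delta>: "0 < \<delta>" unfolding \<delta>_def using \<delta>1 by simp
    show ?thesis
    proof (intro exI[of _ \<delta>] conjI \<delta> allI impI)
      fix \<theta> :: "real ^ 'k" assume "\<forall>i. \<theta> $ i > 0"
      then have \<theta>: "\<And>i. 0 < \<theta> $ i" by blast
      let ?t = "geo_mean \<theta>" and ?m = "vol (ball c r)"
      let ?A = "ball c r \<inter> approx_set U G \<theta>" and ?Z = "(2 * ?k * (2 * Q)) powr \<alpha>"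
      have t: "0 < ?t" by (rule geo_mean_pos[OF \<theta>])
      have m: "0 \<le> ?m" by simp
      let ?f = "\<lambda>x. enn2real (Theta_hat G \<theta> x) powr \<alpha> / \<delta> powr \<alpha>"
      define S where "S = (SUP x\<in>ball c r. ?f x)"
      obtain K where K: "0 \<le> K" "\<forall>x. Theta_hat G \<theta> x \<le> ennreal K" using Theta_hat_bounded[of G \<theta>] by blast
      have "?f x \<le> K powr \<alpha> / \<delta> powr \<alpha>" for x
      proof -
        have "enn2real (Theta_hat G \<theta> x) \<le> K" using K by (intro enn2real_leI) auto
        then show ?thesis using C by (intro divide_right_mono powr_mono2) auto
      qed
      then have "bdd_above (?f ` ball c r)" by (intro bdd_aboveI2)
      then have cS: "?f c \<le> S" unfolding S_def using r by (intro cSUP_upper) auto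
      have S0: "0 \<le> S" by (rule order_trans[OF _ cS]) simp
      define s where "s = S powr (1 / \<alpha>)"
      have s0: "0 \<le> s" unfolding s_def by simp
      have s\<alpha>: "s powr \<alpha> = S" unfolding s_def using C S0 by (simp add: powr_powr)
      have "(enn2real (Theta_hat G \<theta> c) / \<delta>) powr \<alpha> \<le> s powr \<alpha>"
        using cS \<delta> unfolding s\<alpha> by (simp add: powr_divide)
      then have "enn2real (Theta_hat G \<theta> c) / \<delta> \<le> s"
        using powr_less_mono2[OF C(2) s0] by (meson not_le)
      then have "enn2real (Theta_hat G \<theta> c) \<le> \<delta> * s" using \<delta> by (simp add: field_simps)
      also have "\<dots> < \<delta> * (Q + s)" using \<delta> Q by (intro mult_strict_left_mono) auto
      finally have T: "enn2real (Theta_hat G \<theta> c) < \<delta> * (Q + s)" .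
      \<comment> \<open>The summand \<open>Q\<close> has two effects:
        \<open>\<delta> * (Q + s)\<close> strictly exceeds \<open>Theta_hat\<close> at
        \<open>c\<close>, even if both that and \<open>s\<close> are 0, and the doubled threshold is
        at most \<open>Q * \<rho> \<le> 1\<close>.\<close>
      define \<rho> where "\<rho> = 1 / (Q + s)"
      have \<rho>: "0 < \<rho>" "\<rho> * (Q + s) = 1" unfolding \<rho>_def using Q s0 by auto
      have low\<rho>: "\<exists>y\<in>ball c r. \<rho> \<le> wnorm \<theta> (G y) (initial (dim W)) (min_basis W)"
        if "W \<in> proper_rational_subspaces" for W
      proof -
        have "\<delta>1 / fact CARD('k) / (\<delta> * (Q + s)) = \<rho>"
          unfolding \<rho>_def \<delta>_def[symmetric] using \<delta> by simp
        then show ?thesis using wnorm_lower_bound[OF \<theta> inv' r T \<delta>1 low that] by simp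
      qed
      have Qs: "(Q + s) powr \<alpha> \<le> (2 * Q) powr \<alpha> * (1 + S)"
        using powr_add_le[OF Q(1) s0 C(2)] unfolding s\<alpha> .
      have key: "(2 * ?k * ?t / \<rho>) powr \<alpha> \<le> ?Z * (1 + S) * ?t powr \<alpha>"
      proof -
        have "(2 * ?k * ?t / \<rho>) powr \<alpha> = (2 * ?k) powr \<alpha> * ?t powr \<alpha> * (Q + s) powr \<alpha>"
          unfolding \<rho>_def using t Q s0 by (simp add: powr_mult)
        also have "\<dots> \<le> (2 * ?k) powr \<alpha> * ?t powr \<alpha> * ((2 * Q) powr \<alpha> * (1 + S))"
          by (intro mult_left_mono Qs) auto
        also have "\<dots> = ?Z * (1 + S) * ?t powr \<alpha>"
        proof -
          have "?Z = (2 * ?k) powr \<alpha> * (2 * Q) powr \<alpha>"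
            using Q by (subst powr_mult) auto
          then show ?thesis by (simp only: mult_ac)
        qed
        finally show ?thesis .
      qed
      \<comment> \<open>\<open>measure\<close> is 0 off the measurable sets, so this monotonicity
        holds in either case.\<close>
      have meas_le: "vol (?A) \<le> vol E"
        if "?A \<subseteq> E" "E \<in> lmeasurable" for E
      proof (cases "?A \<in> sets lebesgue")
        case True
        then show ?thesis using that by (intro measure_mono_fmeasurable)
      next
        case False
        then show ?thesis by (simp add: measure_notin_sets)
      qed
      have "\<exists>X. vol (?A) \<le> X * ((1 + S) * ?t powr \<alpha> * ?m) \<and> X \<le> K0"
      proof -
        \<comment> \<open>In the first two cases the right-hand side is already at least the volume
          of the ball.\<close>
        consider "\<rho> < 2 * ?k * ?t" | "c0 < 2 * ?k * ?t" | "2 * ?k * ?t \<le> \<rho>" "2 * ?k * ?t \<le> c0" by linarith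
        then show ?thesis
        proof cases
          case 1
          have "1 powr \<alpha> \<le> (2 * ?k * ?t / \<rho>) powr \<alpha>" using 1 \<rho> C by (intro powr_mono2) auto
          then have "1 \<le> ?Z * (1 + S) * ?t powr \<alpha>" using key by simp
          then have "1 * ?m \<le> ?Z * (1 + S) * ?t powr \<alpha> * ?m" using m by (intro mult_right_mono)
          moreover have "vol (?A) \<le> ?m" by (intro meas_le) auto
          moreover have "?Z \<le> K0"
            unfolding K0_def using CN by (simp add: distrib_left add_increasing2)
          ultimately show ?thesis by (intro exI[of _ ?Z]) (simp add: mult.assoc)
        next
          case 2
          let ?X = "(2 * ?k / c0) powr \<alpha>"
          have "1 powr \<alpha> \<le> (2 * ?k / c0 * ?t) powr \<alpha>" using 2 c0 C by (intro powr_mono2) (auto simp: field_simps)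
          also have "\<dots> = ?X * ?t powr \<alpha>" using c0 t by (subst powr_mult) auto
          also have "\<dots> \<le> ?X * ((1 + S) * ?t powr \<alpha>)"
            using S0 by (intro mult_left_mono) (auto simp: distrib_right)
          finally have "1 * ?m \<le> ?X * ((1 + S) * ?t powr \<alpha>) * ?m" using m by (intro mult_right_mono) auto
          moreover have "vol (?A) \<le> ?m" by (intro meas_le) auto
          moreover have "?X \<le> K0" unfolding K0_def using CN by simp
          ultimately show ?thesis by (intro exI[of _ ?X]) (simp add: mult.assoc)
        next
          case 3
          let ?\<psi> = "\<lambda>W x. wnorm \<theta> (G x) (initial (dim W)) (min_basis W)"
          \<comment> \<open>The factor 2 puts the threshold strictly above \<open>?k * ?t\<close>,
            the largest norm that a small integer vector can produce.\<close>
          let ?\<epsilon> = "2 * ?k * ?t" and ?\<rho>' = "(C * 5 ^ ?d) powr (1 / \<alpha>) * \<rho>"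
          have kt: "0 < ?k * ?t" using t by simp
          have BL: "ball c (11 ^ ?N * r) \<subseteq> ball x0 R1"
          proof -
            have "dist c x0 + r \<le> r0" using B r by (simp add: ball_subset_ball_iff)
            then have "r \<le> r0" "dist c x0 \<le> r0" using zero_le_dist[of c x0] r by linarith+
            then have "dist c x0 + L * r \<le> r0 + L * r0" using L by (intro add_mono mult_left_mono) auto
            then show ?thesis unfolding r0(2) L_def[symmetric] by (simp add: ball_subset_ball_iff)
          qed
          have "\<exists>E\<in>lmeasurable. vol E
              \<le> (C * ?N * (15 ^ ?d) ^ ?N) * (?\<epsilon> / \<rho>) powr \<alpha> * vol (ball c r) \<and>
            (\<forall>x\<in>ball c r - E. marked proper_rational_subspaces comparable ?\<psi> ?\<epsilon> \<rho> ?\<rho>' {} x)"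
          proof (rule nondivergence[where B = "ball x0 R1" and N = ?N])
            show "good_on (ball x0 R1) C \<alpha> (?\<psi> W)" for W :: "(real ^ 'k) set" by (rule goodR1)
            show "0 \<le> ?\<psi> W x" for W :: "(real ^ 'k) set" and x by (rule wnorm_nonneg)
            show "comparable W' W" if "comparable W W'" for W W' :: "(real ^ 'k) set"
              using that unfolding comparable_def by blast
            show "card F \<le> ?N" if "F \<subseteq> proper_rational_subspaces" "finite F" "pairwise comparable F"
              for F :: "(real ^ 'k) set set" using card_clique[OF that(1,3)] .
            show "\<exists>z\<in>ball c r. \<rho> \<le> ?\<psi> W z" if "W \<in> proper_rational_subspaces" for W :: "(real ^ 'k) set"
              by (rule low\<rho>[OF that])
          qed (use C t \<rho>(1) r BL in \<open>auto simp: pairwise_def\<close>)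
          then obtain E where E: "E \<in> lmeasurable"
            "vol E \<le> CN * (?\<epsilon> / \<rho>) powr \<alpha> * ?m"
            "\<And>x. x \<in> ball c r - E \<Longrightarrow> marked proper_rational_subspaces comparable ?\<psi> ?\<epsilon> \<rho> ?\<rho>' {} x"
            unfolding CN_def by blast
          have "?A \<subseteq> E"
          proof
            fix x assume x: "x \<in> ?A"
            then obtain a :: "int ^ 'k" where a: "a \<noteq> 0"
              "\<And>i. \<bar>\<Sum>j\<in>UNIV. G x $ i $ j * real_of_int (a $ j)\<bar> \<le> \<theta> $ i"
              unfolding approx_set_def by blast
            define v where "v = (\<chi> j. real_of_int (a $ j))"
            have v: "int_vec v" "v \<noteq> 0" using a(1) unfolding v_def int_vec_def by (auto simp: vec_eq_iff)
            have small: "\<bar>(G x *v v) $ i\<bar> \<le> \<theta> $ i" for i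
              using a(2)[of i] unfolding v_def matrix_vector_mult_def by simp
            show "x \<in> E"
            proof (rule ccontr)
              assume "x \<notin> E"
              then have mk: "marked proper_rational_subspaces comparable ?\<psi> ?\<epsilon> \<rho> ?\<rho>' {} x" using E(3) x by blast
              have "?\<rho>' \<le> Q * \<rho>" using Q \<rho> by (intro mult_right_mono) auto
              also have "\<dots> \<le> (Q + s) * \<rho>" using s0 \<rho> by (intro mult_right_mono) auto
              also have "\<dots> = 1" using \<rho>(2) by (simp add: mult.commute)
              finally have r1: "?\<rho>' \<le> 1" .
              have "x \<in> ball x0 R1" using x B r01 subset_ball[OF r01, of x0] by blast
              then have "c0 < \<bar>det (G x)\<bar>" using R1 by auto
              then have dt: "?k * ?t < \<bar>det (G x)\<bar>" using 3 kt by linarith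
              have e1: "?k * ?t < ?\<epsilon>" using kt by linarith
              show False
                using marked_no_small_vector[OF mk \<theta> r1 e1 3(1) dt v] small by (meson not_le)
            qed
          qed
          then have "vol (?A) \<le> vol E"
            using E(1) by (rule meas_le)
          also have "\<dots> \<le> CN * (?\<epsilon> / \<rho>) powr \<alpha> * ?m" by (rule E(2))
          also have "\<dots> \<le> CN * (?Z * (1 + S) * ?t powr \<alpha>) * ?m"
            using CN m by (intro mult_right_mono mult_left_mono key)
          also have "\<dots> = ?Z * CN * ((1 + S) * ?t powr \<alpha> * ?m)"
            by (simp only: mult_ac)
          finally have "vol (?A)
            \<le> ?Z * CN * ((1 + S) * ?t powr \<alpha> * ?m)" .
          moreover have "?Z * CN \<le> K0"
            unfolding K0_def by (simp add: distrib_left)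
          ultimately show ?thesis by blast
        qed
      qed
      then obtain X where X: "vol (?A) \<le> X * ((1 + S) * ?t powr \<alpha> * ?m)" "X \<le> K0"
        by blast
      note X(1)
      also have "X * ((1 + S) * ?t powr \<alpha> * ?m) \<le> K0 * ((1 + S) * ?t powr \<alpha> * ?m)"
        using X(2) S0 m by (intro mult_right_mono) auto
      finally show "vol (?A) \<le>
          K0 * (1 + (SUP x\<in>ball c r. ?f x)) * ?t powr \<alpha> * ?m"
        unfolding S_def by (simp only: mult.assoc)
    qed
  qed
  moreover have "ball x0 r0 \<subseteq> U" using R R1 r01 subset_ball[OF r01, of x0] by blast
  ultimately show ?thesis using r0(1) K0 C(2) by blast
qed

end
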